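(* (1) $\mathbf{Q}$ inherits the middle-inverse property from $\widehat{\mathbf{PR_a}}$. In particular, for a $\mathbf{PR_a}$-map $f=f(a):A\to B$ with given point $a_0:\mathbb{1}\to A$, $\mathbf{Q}$ inherits as a (partial) middle inverse of $f$ the partial map $$f^-(b)=\mathrm{count}_A\bigl(\mu^{\mathbf{PR_a}}\{n\,|\,f(\mathrm{count}_A(n))\doteq_B b\}\bigr)\mathrel{\hat=}\mathrm{count}_A\bigl(\mu^{\mathbf{Q}}\{n\,|\,f(\mathrm{count}_A(n))\doteq_B b\}\bigr):B\rightharpoonup\mathbb{N}\to A,$$ that is, $f\,\hat\circ\,f^-\,\hat\circ\,f\mathrel{\hat=}f$. (2) For a pointed $\mathbf{PR_a}$-map $f:A\to B$, with point $a_0:\mathbb{1}\to A$, the map $$f'(b)=\begin{cases} f^-(b) & \text{if } \exists n\ f(\mathrm{count}_A(n))\doteq_B b,\\ a_0 & \text{otherwise, i.e. if } \forall n\ f(\mathrm{count}_A(n))\ne_B b\end{cases}$$ is a total $\mathbf{Q}$-map $f':B\to A$ that is a middle inverse of $f$: $f\circ f'\circ f=f$ in $\mathbf{Q}$.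
   Context: $\mathbf{PR_a}$ is the categorical (free-variables, equational) theory of primitive recursion with predicate abstraction. Its objects are finite powers of $\mathbb{N}$ and the objects $\{A\,|\,\chi\}$ defined by primitive recursive predicates $\chi:A\to 2$. Its maps are primitive recursive map terms modulo derivable equality (on the defining predicate). $\doteq_B$ is the equality predicate on $B$. For an object $A$ with a point $a_0:\mathbb{1}\to A$, $\mathrm{count}_A:\mathbb{N}\to A$ is the canonical primitive recursive retractive count (enumeration) of $A$, defined via Cantor ordering and using the point $a_0$. For a theory $\mathbf{S}$ extending $\mathbf{PR_a}$, $\widehat{\mathbf{S}}$ is the theory of partial maps over $\mathbf{S}$. A partial map $f:A\rightharpoonup B$ is given by $\mathbf{S}$-maps $d_f:D_f\to A$ and $\widehat f:D_f\to B$ that are right-unique: $d_f(\hat a)=d_f(\hat a')\Rightarrow\widehat f(\hat a)=\widehat f(\hat a')$. $f\mathrel{\hat=}g$ means inclusion of partial maps in both directions, where inclusion of $f$ in $g$ means that there is an $\mathbf{S}$-map $i:D_f\to D_g$ with $d_g i=d_f$, $\widehat g i=\widehat f$. $\hat\circ$ is composition of partial maps. For a $\mathbf{PR_a}$-predicate $\varphi:A\times\mathbb{N}\to2$, $\mu^{\mathbf{PR_a}}\{n\,|\,\varphi(a,n)\}:A\rightharpoonup\mathbb{N}$ is the partial map with $D=\{(a,n)\,|\,\varphi(a,n)\}$, $d(a,n)=a$ and rule $(a,n)\mapsto\min\{n'\le n\,|\,\varphi(a,n')\}$. $\mu^{\mathbf{Q}}\{n\,|\,\varphi(a,n)\}$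 is the partial map over $\mathbf{Q}$ with domain of definition $\{a\in A\,|\,\exists n\,\varphi(a,n)\}\subseteq A$ and rule $a\mapsto\min\{n'\,|\,\varphi(a,n')\}$. The middle-inverse property of a theory: every (pointed) map $f:A\to B$ admits a map $f':B\to A$ of the theory with $f\circ f'\circ f=f$. $\mathbf{Q}=\mathbf{PR_a}+\forall\exists!$ is the Cartesian extension of $\mathbf{PR_a}$ by classical quantification. For predicates $\varphi:A\times B\to 2$ there are (total) predicates $\exists_b\varphi(a,b),\forall_b\varphi(a,b):A\to 2$ with the usual properties, and the following hold: (a) the quantified law of excluded middle, $\mathbf{Q}\vdash[\forall_b\varphi(a,b)\vee\exists_b\neg\varphi(a,b)]=\mathrm{true}_A$; (b) map definition by unique existence: if $\mathbf{Q}\vdash(\forall a\in A)(\exists! b\in B)\varphi(a,b)$, then there is a unique $\mathbf{Q}$-map $f_\varphi:A\to B$ with $\mathbf{Q}\vdash[f_\varphi(a)\doteq_B b]=\varphi(a,b):A\times B\to 2$. *)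

theory Defs
  imports Main
begin

text \<open>
  The two theories are given as formal systems.  Raw map terms are typed, and identified,
  by two mutually inductive judgements, so a map is a typable term and equality of maps is
  derivable equality, not equality in some model.  The index \<open>thPR\<close> is the free-variable
  (equational) theory of primitive recursion over the finite powers of the natural numbers
  object; \<open>thQ\<close> adds quantifiers and definition of maps by unique existence.
\<close>

datatype thy = thPR | thQ

datatype obj = One | NatO | Prod obj obj

datatype tm =
    Idm obj
  | Bang obj                (* the map to the terminal object *)
  | Zr                      (* zero, from One to NatO *)
  | Sc                      (* successor *)
  | Lp obj obj              (* left projection *)
  | Rp obj obj              (* right projection *)
  | Ind tm tm               (* map induced into a product *)
  | Cmp tm tm  (infixr "\<odot>" 70)
  | Iter tm                 (* iteration of g on A: (a, n) goes to (g^n)(a) *)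
  | ExT obj obj tm           (* (ExT A B phi)(a) = (exists b in B) phi(a, b) *)
  | AllT obj obj tm
  | Desc obj obj tm         (* the b in B with phi(a, b), as a map from A to B *)


section \<open>Primitive recursive arithmetic and logic, as map terms\<close>

text \<open>Truth values are the numbers 0 (false) and 1 (true).\<close>

definition trueT :: "obj \<Rightarrow> tm" where
  "trueT A = Sc \<odot> Zr \<odot> Bang A"

definition negm :: tm where
  "negm = Iter (Zr \<odot> Bang NatO) \<odot> Ind (trueT NatO) (Idm NatO)"

definition sgnm :: tm where
  "sgnm = negm \<odot> negm"

text \<open>The predecessor is the first component of the n-th iterate of
  (x, y) to (y, y + 1) at (0, 0).\<close>

definition predm :: tm where
  "predm = Lp NatO NatO \<odot> Iter (Ind (Rp NatO NatO) (Sc \<odot> Rp NatO NatO))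
             \<odot> Ind (Ind (Zr \<odot> Bang NatO) (Zr \<odot> Bang NatO)) (Idm NatO)"

definition addm :: tm where
  "addm = Iter Sc"

definition subm :: tm where
  "subm = Iter predm"

definition negT :: "tm \<Rightarrow> tm" where
  "negT p = negm \<odot> p"

definition disjT :: "tm \<Rightarrow> tm \<Rightarrow> tm" where
  "disjT p q = sgnm \<odot> addm \<odot> Ind p q"

definition conjT :: "tm \<Rightarrow> tm \<Rightarrow> tm" where
  "conjT p q = negT (disjT (negT p) (negT q))"

definition impT :: "tm \<Rightarrow> tm \<Rightarrow> tm" where
  "impT p q = disjT (negT p) q"

definition leT :: "tm \<Rightarrow> tm \<Rightarrow> tm" where
  "leT f g = negT (subm \<odot> Ind f g)"

text \<open>The equality predicate on a finite power of N; \<open>eqT B f g\<close> is [f(a) = g(a)] for maps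
  f, g into B.\<close>

fun eqp :: "obj \<Rightarrow> tm" where
  "eqp One = trueT (Prod One One)"
| "eqp NatO = conjT (leT (Lp NatO NatO) (Rp NatO NatO)) (leT (Rp NatO NatO) (Lp NatO NatO))"
| "eqp (Prod A B) =
     (let L = Lp (Prod A B) (Prod A B); R = Rp (Prod A B) (Prod A B) in
      conjT (eqp A \<odot> Ind (Lp A B \<odot> L) (Lp A B \<odot> R))
            (eqp B \<odot> Ind (Rp A B \<odot> L) (Rp A B \<odot> R)))"

definition eqT :: "obj \<Rightarrow> tm \<Rightarrow> tm \<Rightarrow> tm" where
  "eqT B f g = eqp B \<odot> Ind f g"

text \<open>\<open>condT A p x y\<close> is "if p then x else y" for maps x, y into A: iterating (u, v) to (u, u)
  at (x, y) at least once puts x into the second component.\<close>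

definition condT :: "obj \<Rightarrow> tm \<Rightarrow> tm \<Rightarrow> tm \<Rightarrow> tm" where
  "condT A p x y = Rp A A \<odot> Iter (Ind (Lp A A) (Lp A A)) \<odot> Ind (Ind x y) p"

definition exuT :: "obj \<Rightarrow> obj \<Rightarrow> tm \<Rightarrow> tm" where
  "exuT A B \<phi> =
     ExT A B (conjT \<phi>
       (AllT (Prod A B) B
         (impT (\<phi> \<odot> Ind (Lp A B \<odot> Lp (Prod A B) B) (Rp (Prod A B) B))
               (eqT B (Rp A B \<odot> Lp (Prod A B) B) (Rp (Prod A B) B)))))"


section \<open>The formal systems\<close>

text \<open>
  The rule \<open>iter_uniq\<close> is Freyd's uniqueness of the iterated map.  A predicate on A is a map
  from A to N invariant under \<open>sgnm\<close>.  The quantifier rules are, besides LEM, the adjunctions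
  with substitution along the left projection and stability under substitution.  Quantification
  and description are postulated over finite powers of N; the forms over the objects {A | chi}
  are obtained by relativisation (all these powers have a zero, used as value outside the
  domain).  All schemata, iteration included, apply to arbitrary maps of the theory.
\<close>

inductive
  mp :: "thy \<Rightarrow> tm \<Rightarrow> obj \<Rightarrow> obj \<Rightarrow> bool"  ("(_ \<turnstile> _ \<Colon>/ _ \<rightarrow> _)" [51, 51, 51, 51] 50)
and
  deq :: "thy \<Rightarrow> tm \<Rightarrow> tm \<Rightarrow> obj \<Rightarrow> obj \<Rightarrow> bool"
    ("(_ \<turnstile> _ \<approx> _ \<Colon>/ _ \<rightarrow> _)" [51, 51, 51, 51, 51] 50)
for S :: thy
where
  mp_id: "S \<turnstile> Idm A \<Colon> A \<rightarrow> A"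
| mp_bang: "S \<turnstile> Bang A \<Colon> A \<rightarrow> One"
| mp_zr: "S \<turnstile> Zr \<Colon> One \<rightarrow> NatO"
| mp_sc: "S \<turnstile> Sc \<Colon> NatO \<rightarrow> NatO"
| mp_lp: "S \<turnstile> Lp A B \<Colon> Prod A B \<rightarrow> A"
| mp_rp: "S \<turnstile> Rp A B \<Colon> Prod A B \<rightarrow> B"
| mp_ind: "S \<turnstile> f \<Colon> C \<rightarrow> A \<Longrightarrow> S \<turnstile> g \<Colon> C \<rightarrow> B \<Longrightarrow> S \<turnstile> Ind f g \<Colon> C \<rightarrow> Prod A B"
| mp_cmp: "S \<turnstile> f \<Colon> A \<rightarrow> B \<Longrightarrow> S \<turnstile> g \<Colon> B \<rightarrow> C \<Longrightarrow> S \<turnstile> g \<odot> f \<Colon> A \<rightarrow> C"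
| mp_iter: "S \<turnstile> g \<Colon> A \<rightarrow> A \<Longrightarrow> S \<turnstile> Iter g \<Colon> Prod A NatO \<rightarrow> A"
| mp_ex: "S = thQ \<Longrightarrow> S \<turnstile> \<phi> \<Colon> Prod A B \<rightarrow> NatO \<Longrightarrow> S \<turnstile> sgnm \<odot> \<phi> \<approx> \<phi> \<Colon> Prod A B \<rightarrow> NatO
    \<Longrightarrow> S \<turnstile> ExT A B \<phi> \<Colon> A \<rightarrow> NatO"
| mp_all: "S = thQ \<Longrightarrow> S \<turnstile> \<phi> \<Colon> Prod A B \<rightarrow> NatO \<Longrightarrow> S \<turnstile> sgnm \<odot> \<phi> \<approx> \<phi> \<Colon> Prod A B \<rightarrow> NatO
    \<Longrightarrow> S \<turnstile> AllT A B \<phi> \<Colon> A \<rightarrow> NatO"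
| mp_desc: "S = thQ \<Longrightarrow> S \<turnstile> \<phi> \<Colon> Prod A B \<rightarrow> NatO \<Longrightarrow> S \<turnstile> sgnm \<odot> \<phi> \<approx> \<phi> \<Colon> Prod A B \<rightarrow> NatO
    \<Longrightarrow> S \<turnstile> exuT A B \<phi> \<approx> trueT A \<Colon> A \<rightarrow> NatO
    \<Longrightarrow> S \<turnstile> Desc A B \<phi> \<Colon> A \<rightarrow> B"

| eq_refl: "S \<turnstile> f \<Colon> A \<rightarrow> B \<Longrightarrow> S \<turnstile> f \<approx> f \<Colon> A \<rightarrow> B"
| eq_sym: "S \<turnstile> f \<approx> g \<Colon> A \<rightarrow> B \<Longrightarrow> S \<turnstile> g \<approx> f \<Colon> A \<rightarrow> B"
| eq_trans: "S \<turnstile> f \<approx> g \<Colon> A \<rightarrow> B \<Longrightarrow> S \<turnstile> g \<approx> h \<Colon> A \<rightarrow> B \<Longrightarrow> S \<turnstile> f \<approx> h \<Colon> A \<rightarrow> B"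
| cmp_cong: "S \<turnstile> f \<approx> f' \<Colon> A \<rightarrow> B \<Longrightarrow> S \<turnstile> g \<approx> g' \<Colon> B \<rightarrow> C \<Longrightarrow> S \<turnstile> g \<odot> f \<approx> g' \<odot> f' \<Colon> A \<rightarrow> C"
| ind_cong: "S \<turnstile> f \<approx> f' \<Colon> C \<rightarrow> A \<Longrightarrow> S \<turnstile> g \<approx> g' \<Colon> C \<rightarrow> B
    \<Longrightarrow> S \<turnstile> Ind f g \<approx> Ind f' g' \<Colon> C \<rightarrow> Prod A B"
| iter_cong: "S \<turnstile> g \<approx> g' \<Colon> A \<rightarrow> A \<Longrightarrow> S \<turnstile> Iter g \<approx> Iter g' \<Colon> Prod A NatO \<rightarrow> A"

| cmp_assoc: "S \<turnstile> f \<Colon> A \<rightarrow> B \<Longrightarrow> S \<turnstile> g \<Colon> B \<rightarrow> C \<Longrightarrow> S \<turnstile> h \<Colon> C \<rightarrow> D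
    \<Longrightarrow> S \<turnstile> (h \<odot> g) \<odot> f \<approx> h \<odot> (g \<odot> f) \<Colon> A \<rightarrow> D"
| id_left: "S \<turnstile> f \<Colon> A \<rightarrow> B \<Longrightarrow> S \<turnstile> Idm B \<odot> f \<approx> f \<Colon> A \<rightarrow> B"
| id_right: "S \<turnstile> f \<Colon> A \<rightarrow> B \<Longrightarrow> S \<turnstile> f \<odot> Idm A \<approx> f \<Colon> A \<rightarrow> B"
| bang_uniq: "S \<turnstile> f \<Colon> A \<rightarrow> One \<Longrightarrow> S \<turnstile> f \<approx> Bang A \<Colon> A \<rightarrow> One"
| lp_ind: "S \<turnstile> f \<Colon> C \<rightarrow> A \<Longrightarrow> S \<turnstile> g \<Colon> C \<rightarrow> B \<Longrightarrow> S \<turnstile> Lp A B \<odot> Ind f g \<approx> f \<Colon> C \<rightarrow> A"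
| rp_ind: "S \<turnstile> f \<Colon> C \<rightarrow> A \<Longrightarrow> S \<turnstile> g \<Colon> C \<rightarrow> B \<Longrightarrow> S \<turnstile> Rp A B \<odot> Ind f g \<approx> g \<Colon> C \<rightarrow> B"
| ind_uniq: "S \<turnstile> h \<Colon> C \<rightarrow> Prod A B
    \<Longrightarrow> S \<turnstile> Ind (Lp A B \<odot> h) (Rp A B \<odot> h) \<approx> h \<Colon> C \<rightarrow> Prod A B"

| iter_zr: "S \<turnstile> g \<Colon> A \<rightarrow> A
    \<Longrightarrow> S \<turnstile> Iter g \<odot> Ind (Idm A) (Zr \<odot> Bang A) \<approx> Idm A \<Colon> A \<rightarrow> A"
| iter_sc: "S \<turnstile> g \<Colon> A \<rightarrow> A
    \<Longrightarrow> S \<turnstile> Iter g \<odot> Ind (Lp A NatO) (Sc \<odot> Rp A NatO) \<approx> g \<odot> Iter g \<Colon> Prod A NatO \<rightarrow> A"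
| iter_uniq: "S \<turnstile> f \<Colon> A \<rightarrow> B \<Longrightarrow> S \<turnstile> g \<Colon> B \<rightarrow> B \<Longrightarrow> S \<turnstile> h \<Colon> Prod A NatO \<rightarrow> B
    \<Longrightarrow> S \<turnstile> h \<odot> Ind (Idm A) (Zr \<odot> Bang A) \<approx> f \<Colon> A \<rightarrow> B
    \<Longrightarrow> S \<turnstile> h \<odot> Ind (Lp A NatO) (Sc \<odot> Rp A NatO) \<approx> g \<odot> h \<Colon> Prod A NatO \<rightarrow> B
    \<Longrightarrow> S \<turnstile> h \<approx> Iter g \<odot> Ind (f \<odot> Lp A NatO) (Rp A NatO) \<Colon> Prod A NatO \<rightarrow> B"

| ex_pred: "S \<turnstile> ExT A B \<phi> \<Colon> A \<rightarrow> NatO \<Longrightarrow> S \<turnstile> sgnm \<odot> ExT A B \<phi> \<approx> ExT A B \<phi> \<Colon> A \<rightarrow> NatO"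
| all_pred: "S \<turnstile> AllT A B \<phi> \<Colon> A \<rightarrow> NatO \<Longrightarrow> S \<turnstile> sgnm \<odot> AllT A B \<phi> \<approx> AllT A B \<phi> \<Colon> A \<rightarrow> NatO"
| ex_cong: "S \<turnstile> ExT A B \<phi> \<Colon> A \<rightarrow> NatO \<Longrightarrow> S \<turnstile> \<phi> \<approx> \<psi> \<Colon> Prod A B \<rightarrow> NatO
    \<Longrightarrow> S \<turnstile> ExT A B \<phi> \<approx> ExT A B \<psi> \<Colon> A \<rightarrow> NatO"
| all_cong: "S \<turnstile> AllT A B \<phi> \<Colon> A \<rightarrow> NatO \<Longrightarrow> S \<turnstile> \<phi> \<approx> \<psi> \<Colon> Prod A B \<rightarrow> NatO
    \<Longrightarrow> S \<turnstile> AllT A B \<phi> \<approx> AllT A B \<psi> \<Colon> A \<rightarrow> NatO"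
| ex_intro: "S \<turnstile> ExT A B \<phi> \<Colon> A \<rightarrow> NatO
    \<Longrightarrow> S \<turnstile> impT \<phi> (ExT A B \<phi> \<odot> Lp A B) \<approx> trueT (Prod A B) \<Colon> Prod A B \<rightarrow> NatO"
| ex_elim: "S \<turnstile> ExT A B \<phi> \<Colon> A \<rightarrow> NatO \<Longrightarrow> S \<turnstile> \<psi> \<Colon> A \<rightarrow> NatO \<Longrightarrow> S \<turnstile> sgnm \<odot> \<psi> \<approx> \<psi> \<Colon> A \<rightarrow> NatO
    \<Longrightarrow> S \<turnstile> impT \<phi> (\<psi> \<odot> Lp A B) \<approx> trueT (Prod A B) \<Colon> Prod A B \<rightarrow> NatO
    \<Longrightarrow> S \<turnstile> impT (ExT A B \<phi>) \<psi> \<approx> trueT A \<Colon> A \<rightarrow> NatO"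
| all_elim: "S \<turnstile> AllT A B \<phi> \<Colon> A \<rightarrow> NatO
    \<Longrightarrow> S \<turnstile> impT (AllT A B \<phi> \<odot> Lp A B) \<phi> \<approx> trueT (Prod A B) \<Colon> Prod A B \<rightarrow> NatO"
| all_intro: "S \<turnstile> AllT A B \<phi> \<Colon> A \<rightarrow> NatO \<Longrightarrow> S \<turnstile> \<psi> \<Colon> A \<rightarrow> NatO \<Longrightarrow> S \<turnstile> sgnm \<odot> \<psi> \<approx> \<psi> \<Colon> A \<rightarrow> NatO
    \<Longrightarrow> S \<turnstile> impT (\<psi> \<odot> Lp A B) \<phi> \<approx> trueT (Prod A B) \<Colon> Prod A B \<rightarrow> NatO
    \<Longrightarrow> S \<turnstile> impT \<psi> (AllT A B \<phi>) \<approx> trueT A \<Colon> A \<rightarrow> NatO"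
| ex_subst: "S \<turnstile> ExT A B \<phi> \<Colon> A \<rightarrow> NatO \<Longrightarrow> S \<turnstile> f \<Colon> C \<rightarrow> A
    \<Longrightarrow> S \<turnstile> ExT A B \<phi> \<odot> f \<approx> ExT C B (\<phi> \<odot> Ind (f \<odot> Lp C B) (Rp C B)) \<Colon> C \<rightarrow> NatO"
| all_subst: "S \<turnstile> AllT A B \<phi> \<Colon> A \<rightarrow> NatO \<Longrightarrow> S \<turnstile> f \<Colon> C \<rightarrow> A
    \<Longrightarrow> S \<turnstile> AllT A B \<phi> \<odot> f \<approx> AllT C B (\<phi> \<odot> Ind (f \<odot> Lp C B) (Rp C B)) \<Colon> C \<rightarrow> NatO"
| quant_lem: "S \<turnstile> AllT A B \<phi> \<Colon> A \<rightarrow> NatO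
    \<Longrightarrow> S \<turnstile> disjT (AllT A B \<phi>) (ExT A B (negT \<phi>)) \<approx> trueT A \<Colon> A \<rightarrow> NatO"

| desc_graph: "S \<turnstile> Desc A B \<phi> \<Colon> A \<rightarrow> B
    \<Longrightarrow> S \<turnstile> eqT B (Desc A B \<phi> \<odot> Lp A B) (Rp A B) \<approx> \<phi> \<Colon> Prod A B \<rightarrow> NatO"
| desc_uniq: "S \<turnstile> Desc A B \<phi> \<Colon> A \<rightarrow> B \<Longrightarrow> S \<turnstile> g \<Colon> A \<rightarrow> B
    \<Longrightarrow> S \<turnstile> eqT B (g \<odot> Lp A B) (Rp A B) \<approx> \<phi> \<Colon> Prod A B \<rightarrow> NatO
    \<Longrightarrow> S \<turnstile> g \<approx> Desc A B \<phi> \<Colon> A \<rightarrow> B"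


section \<open>Predicate abstraction\<close>

text \<open>
  \<open>Abs A \<chi>\<close> is the object {A | chi}.  For \<open>thPR\<close> the objects and maps below are those of
  \<open>PR\<^sub>a\<close>, for \<open>thQ\<close> those of Q.  Maps are represented by terms on the underlying objects and
  taken modulo \<open>aeq\<close>, derivable equality on the defining predicate; composition is \<open>Cmp\<close>.
\<close>

datatype aobj = Abs (base: obj) (dpred: tm)

definition isobj :: "thy \<Rightarrow> aobj \<Rightarrow> bool" where
  "isobj S X \<longleftrightarrow> S \<turnstile> dpred X \<Colon> base X \<rightarrow> NatO \<and>
                 S \<turnstile> sgnm \<odot> dpred X \<approx> dpred X \<Colon> base X \<rightarrow> NatO"

definition amap :: "thy \<Rightarrow> tm \<Rightarrow> aobj \<Rightarrow> aobj \<Rightarrow> bool" where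
  "amap S f X Y \<longleftrightarrow> isobj S X \<and> isobj S Y \<and> S \<turnstile> f \<Colon> base X \<rightarrow> base Y \<and>
     S \<turnstile> impT (dpred X) (dpred Y \<odot> f) \<approx> trueT (base X) \<Colon> base X \<rightarrow> NatO"

definition aeq :: "thy \<Rightarrow> tm \<Rightarrow> tm \<Rightarrow> aobj \<Rightarrow> aobj \<Rightarrow> bool" where
  "aeq S f g X Y \<longleftrightarrow> amap S f X Y \<and> amap S g X Y \<and>
     S \<turnstile> impT (dpred X) (eqT (base Y) f g) \<approx> trueT (base X) \<Colon> base X \<rightarrow> NatO"

definition fundO :: "obj \<Rightarrow> aobj" where
  "fundO A = Abs A (trueT A)"

definition prodO :: "aobj \<Rightarrow> aobj \<Rightarrow> aobj" where
  "prodO X Y = Abs (Prod (base X) (base Y))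
     (conjT (dpred X \<odot> Lp (base X) (base Y)) (dpred Y \<odot> Rp (base X) (base Y)))"

definition subO :: "aobj \<Rightarrow> tm \<Rightarrow> aobj" where
  "subO X \<psi> = Abs (base X) (conjT (dpred X) \<psi>)"


section \<open>Cantor count\<close>

text \<open>The Cantor ordering (0,0), (0,1), (1,0), (0,2), (1,1), (2,0), ... of N x N.\<close>

definition cantor_step :: tm where
  "cantor_step =
     condT (Prod NatO NatO) (Rp NatO NatO)
       (Ind (Sc \<odot> Lp NatO NatO) (predm \<odot> Rp NatO NatO))
       (Ind (Zr \<odot> Bang (Prod NatO NatO)) (Sc \<odot> Lp NatO NatO))"

definition cantor :: tm where
  "cantor = Iter cantor_step \<odot> Ind (Ind (Zr \<odot> Bang NatO) (Zr \<odot> Bang NatO)) (Idm NatO)"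

fun count_fund :: "obj \<Rightarrow> tm" where
  "count_fund One = Bang NatO"
| "count_fund NatO = Idm NatO"
| "count_fund (Prod A B) =
     Ind (count_fund A \<odot> Lp NatO NatO) (count_fund B \<odot> Rp NatO NatO) \<odot> cantor"

text \<open>On {A | chi} the values outside chi are replaced by the point.\<close>

definition count :: "aobj \<Rightarrow> tm \<Rightarrow> tm" where
  "count X a0 = condT (base X) (dpred X \<odot> count_fund (base X))
                  (count_fund (base X)) (a0 \<odot> Bang NatO)"


section \<open>Partial maps\<close>

datatype pmap = PMap (pdom: aobj) (pemb: tm) (prule: tm)

definition is_pmap :: "thy \<Rightarrow> pmap \<Rightarrow> aobj \<Rightarrow> aobj \<Rightarrow> bool" where
  "is_pmap S F X Y \<longleftrightarrow>
     amap S (pemb F) (pdom F) X \<and> amap S (prule F) (pdom F) Y \<and>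
     (let D = base (pdom F); L = Lp D D; R = Rp D D in
      S \<turnstile> impT (conjT (dpred (prodO (pdom F) (pdom F)))
                      (eqT (base X) (pemb F \<odot> L) (pemb F \<odot> R)))
                (eqT (base Y) (prule F \<odot> L) (prule F \<odot> R))
        \<approx> trueT (Prod D D) \<Colon> Prod D D \<rightarrow> NatO)"

definition pincl :: "thy \<Rightarrow> aobj \<Rightarrow> aobj \<Rightarrow> pmap \<Rightarrow> pmap \<Rightarrow> bool" where
  "pincl S X Y F G \<longleftrightarrow>
     (\<exists>i. amap S i (pdom F) (pdom G) \<and>
          aeq S (pemb G \<odot> i) (pemb F) (pdom F) X \<and>
          aeq S (prule G \<odot> i) (prule F) (pdom F) Y)"

definition peq :: "thy \<Rightarrow> aobj \<Rightarrow> aobj \<Rightarrow> pmap \<Rightarrow> pmap \<Rightarrow> bool" where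
  "peq S X Y F G \<longleftrightarrow> pincl S X Y F G \<and> pincl S X Y G F"

definition tot :: "aobj \<Rightarrow> tm \<Rightarrow> pmap" where
  "tot X f = PMap X (Idm (base X)) f"

text \<open>\<open>pcomp Y G F\<close> is G after F, with Y the object in the middle; the domain is the pullback.\<close>

definition pcomp :: "aobj \<Rightarrow> pmap \<Rightarrow> pmap \<Rightarrow> pmap" where
  "pcomp Y G F =
     (let L = Lp (base (pdom F)) (base (pdom G)); R = Rp (base (pdom F)) (base (pdom G)) in
      PMap (subO (prodO (pdom F) (pdom G)) (eqT (base Y) (prule F \<odot> L) (pemb G \<odot> R)))
           (pemb F \<odot> L) (prule G \<odot> R))"


section \<open>Minimum operators\<close>

text \<open>
  \<open>bmin A \<phi>\<close> is (a, n) to min {n' \<le> n | phi(a, n')}, with value n if there is no such n': n-fold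
  iteration of "stay at m if phi(a, m), else go to m + 1" from m = 0, with a kept along.
\<close>

definition bmin :: "obj \<Rightarrow> tm \<Rightarrow> tm" where
  "bmin A \<phi> =
     Rp A NatO \<odot> Iter (Ind (Lp A NatO) (condT NatO \<phi> (Rp A NatO) (Sc \<odot> Rp A NatO)))
       \<odot> Ind (Ind (Lp A NatO) (Zr \<odot> Bang (Prod A NatO))) (Rp A NatO)"

definition muPR :: "aobj \<Rightarrow> tm \<Rightarrow> pmap" where
  "muPR X \<phi> = PMap (subO (prodO X (fundO NatO)) \<phi>) (Lp (base X) NatO) (bmin (base X) \<phi>)"

text \<open>\<open>is_least A \<phi>\<close> holds at (a, n) iff phi(a, n) and n \<le> n' whenever phi(a, n').\<close>

definition is_least :: "obj \<Rightarrow> tm \<Rightarrow> tm" where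
  "is_least A \<phi> =
     conjT \<phi>
       (AllT (Prod A NatO) NatO
         (impT (\<phi> \<odot> Ind (Lp A NatO \<odot> Lp (Prod A NatO) NatO) (Rp (Prod A NatO) NatO))
               (leT (Rp A NatO \<odot> Lp (Prod A NatO) NatO) (Rp (Prod A NatO) NatO))))"

text \<open>A term for the rule of \<open>muQ\<close> needs values on all of A; outside the domain of \<open>muQ\<close> it is
  given the value 0, which is irrelevant to the partial map.\<close>

definition minQ :: "obj \<Rightarrow> tm \<Rightarrow> tm" where
  "minQ A \<phi> =
     Desc A NatO
       (disjT (is_least A \<phi>)
              (conjT (negT (ExT A NatO \<phi> \<odot> Lp A NatO))
                     (eqT NatO (Rp A NatO) (Zr \<odot> Bang (Prod A NatO)))))"

definition muQ :: "aobj \<Rightarrow> tm \<Rightarrow> pmap" where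
  "muQ X \<phi> = PMap (subO X (ExT (base X) NatO \<phi>)) (Idm (base X)) (minQ (base X) \<phi>)"


section \<open>Middle inverses\<close>

definition middle_inverse_property :: "thy \<Rightarrow> bool" where
  "middle_inverse_property S \<longleftrightarrow>
     (\<forall>X Y a0 f. amap S a0 (fundO One) X \<and> amap S f X Y \<longrightarrow>
        (\<exists>f'. amap S f' Y X \<and> aeq S (f \<odot> f' \<odot> f) f X Y))"

definition hat_middle_inverse_property :: "thy \<Rightarrow> bool" where
  "hat_middle_inverse_property S \<longleftrightarrow>
     (\<forall>X Y a0 F. amap S a0 (fundO One) X \<and> is_pmap S F X Y \<longrightarrow>
        (\<exists>G. is_pmap S G Y X \<and> peq S X Y (pcomp X F (pcomp Y G F)) F))"

text \<open>\<open>hits X Y a0 f\<close> is the predicate f(count n) = b of (b, n).\<close>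

definition hits :: "aobj \<Rightarrow> aobj \<Rightarrow> tm \<Rightarrow> tm \<Rightarrow> tm" where
  "hits X Y a0 f =
     eqT (base Y) (f \<odot> count X a0 \<odot> Rp (base Y) NatO) (Lp (base Y) NatO)"

definition fminusPR :: "aobj \<Rightarrow> aobj \<Rightarrow> tm \<Rightarrow> tm \<Rightarrow> pmap" where
  "fminusPR X Y a0 f =
     pcomp (fundO NatO) (tot (fundO NatO) (count X a0)) (muPR Y (hits X Y a0 f))"

definition fminusQ :: "aobj \<Rightarrow> aobj \<Rightarrow> tm \<Rightarrow> tm \<Rightarrow> pmap" where
  "fminusQ X Y a0 f =
     pcomp (fundO NatO) (tot (fundO NatO) (count X a0)) (muQ Y (hits X Y a0 f))"

definition fprime :: "aobj \<Rightarrow> aobj \<Rightarrow> tm \<Rightarrow> tm \<Rightarrow> tm" where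
  "fprime X Y a0 f =
     condT (base X) (ExT (base Y) NatO (hits X Y a0 f))
       (count X a0 \<odot> minQ (base Y) (hits X Y a0 f))
       (a0 \<odot> Bang (base Y))"

end

theory Submission
  imports Defs
begin

text \<open>
  Informally the theorem is a few lines of elementary number theory.  If \<open>f(a) = b\<close> then some
  number n, namely an index of a under the count, satisfies \<open>f(count(n)) = b\<close>; the least such n
  depends on b alone, so sending b to \<open>count(n)\<close> is a right-unique rule, and
  \<open>f(count(n)) = b\<close> says that it is a middle inverse of f.  In Q the least n exists on the whole
  image, by excluded middle and unique existence, and a case distinction makes the rule total.

  All of this has to be shown derivable in two formal systems.  Instead of writing derivations, the
  proof passes through a completeness theorem.  A model over a context object C interprets an object
  A by the terms from C to A modulo a congruence, and a term by composition.  A maximal congruence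
  that separates two given terms makes every number of its model either zero or a successor: the
  conditional term, which is definable by iteration, splits each congruence along any number p into
  the parts "p is zero" and "p is not zero", and a maximal one has to coincide with one of the two.
  So two terms are derivably equal if they have the same values in all two-valued models
  (\<open>complete\<close>), and in such a model truth values behave like those of the metalogic.

  What remains is ordinary reasoning inside a model of arithmetic.  Induction for definable
  predicates (\<open>nat_induct\<close>) follows from uniqueness of iterated maps.  Commutativity of
  \<open>x + (y - x)\<close>, with truncated subtraction (\<open>max_comm\<close>), makes the equality predicate sound, so
  that equations become predicates.  The bounded minimum is least (\<open>bmin_le\<close>, \<open>bmin_holds\<close>), and
  the Cantor count is onto because an index can be computed (\<open>count_index\<close>).  In models of Q the
  quantifiers over numbers have their classical meaning (\<open>ExT_NatO_iff\<close>), since the least witness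
  is itself a map.  The partial inverses of total and of partial maps are instances of one criterion
  (\<open>middle_inverse_criterion\<close>), which is used over both theories.
\<close>

section \<open>Typing\<close>

named_theorems typing

lemmas [typing] = mp_id mp_bang mp_zr mp_sc mp_lp mp_rp mp_ind mp_cmp mp_iter

lemma typ_trueT [typing]: "S \<turnstile> trueT A \<Colon> A \<rightarrow> NatO"
  unfolding trueT_def by (rule typing)+

lemma typ_negm [typing]: "S \<turnstile> negm \<Colon> NatO \<rightarrow> NatO"
  unfolding negm_def by (rule typing)+

lemma typ_sgnm [typing]: "S \<turnstile> sgnm \<Colon> NatO \<rightarrow> NatO"
  unfolding sgnm_def by (rule typing)+

lemma typ_predm [typing]: "S \<turnstile> predm \<Colon> NatO \<rightarrow> NatO"
  unfolding predm_def by (rule typing)+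

lemma typ_addm [typing]: "S \<turnstile> addm \<Colon> Prod NatO NatO \<rightarrow> NatO"
  unfolding addm_def by (rule typing)+

lemma typ_subm [typing]: "S \<turnstile> subm \<Colon> Prod NatO NatO \<rightarrow> NatO"
  unfolding subm_def by (rule typing)+

lemma typ_negT [typing]: "S \<turnstile> p \<Colon> A \<rightarrow> NatO \<Longrightarrow> S \<turnstile> negT p \<Colon> A \<rightarrow> NatO"
  unfolding negT_def by (rule typing | assumption)+

lemma typ_disjT [typing]:
  "S \<turnstile> p \<Colon> A \<rightarrow> NatO \<Longrightarrow> S \<turnstile> q \<Colon> A \<rightarrow> NatO \<Longrightarrow> S \<turnstile> disjT p q \<Colon> A \<rightarrow> NatO"
  unfolding disjT_def by (rule typing | assumption)+

lemma typ_conjT [typing]: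
  "S \<turnstile> p \<Colon> A \<rightarrow> NatO \<Longrightarrow> S \<turnstile> q \<Colon> A \<rightarrow> NatO \<Longrightarrow> S \<turnstile> conjT p q \<Colon> A \<rightarrow> NatO"
  unfolding conjT_def by (rule typing | assumption)+

lemma typ_impT [typing]:
  "S \<turnstile> p \<Colon> A \<rightarrow> NatO \<Longrightarrow> S \<turnstile> q \<Colon> A \<rightarrow> NatO \<Longrightarrow> S \<turnstile> impT p q \<Colon> A \<rightarrow> NatO"
  unfolding impT_def by (rule typing | assumption)+

lemma typ_leT [typing]:
  "S \<turnstile> f \<Colon> A \<rightarrow> NatO \<Longrightarrow> S \<turnstile> g \<Colon> A \<rightarrow> NatO \<Longrightarrow> S \<turnstile> leT f g \<Colon> A \<rightarrow> NatO"
  unfolding leT_def by (rule typing | assumption)+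

lemma typ_eqp [typing]: "S \<turnstile> eqp A \<Colon> Prod A A \<rightarrow> NatO"
  by (induction A) (auto simp: Let_def intro!: typing)

lemma typ_eqT [typing]:
  "S \<turnstile> f \<Colon> A \<rightarrow> B \<Longrightarrow> S \<turnstile> g \<Colon> A \<rightarrow> B \<Longrightarrow> S \<turnstile> eqT B f g \<Colon> A \<rightarrow> NatO"
  unfolding eqT_def by (rule typing | assumption)+

lemma typ_condT [typing]:
  "S \<turnstile> p \<Colon> A \<rightarrow> NatO \<Longrightarrow> S \<turnstile> x \<Colon> A \<rightarrow> B \<Longrightarrow> S \<turnstile> y \<Colon> A \<rightarrow> B \<Longrightarrow> S \<turnstile> condT B p x y \<Colon> A \<rightarrow> B"
  unfolding condT_def by (rule typing | assumption)+

inductive_cases mp_IdmE: "S \<turnstile> Idm A \<Colon> C \<rightarrow> B"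
inductive_cases mp_BangE: "S \<turnstile> Bang A \<Colon> C \<rightarrow> B"
inductive_cases mp_ZrE: "S \<turnstile> Zr \<Colon> C \<rightarrow> B"
inductive_cases mp_ScE: "S \<turnstile> Sc \<Colon> C \<rightarrow> B"
inductive_cases mp_LpE: "S \<turnstile> Lp A A' \<Colon> C \<rightarrow> B"
inductive_cases mp_RpE: "S \<turnstile> Rp A A' \<Colon> C \<rightarrow> B"
inductive_cases mp_IndE: "S \<turnstile> Ind f g \<Colon> C \<rightarrow> B"
inductive_cases mp_CmpE: "S \<turnstile> g \<odot> f \<Colon> C \<rightarrow> B"
inductive_cases mp_IterE: "S \<turnstile> Iter g \<Colon> C \<rightarrow> B"
inductive_cases mp_ExTE: "S \<turnstile> ExT A A' p \<Colon> C \<rightarrow> B"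
inductive_cases mp_AllTE: "S \<turnstile> AllT A A' p \<Colon> C \<rightarrow> B"
inductive_cases mp_DescE: "S \<turnstile> Desc A A' p \<Colon> C \<rightarrow> B"

lemmas mp_elims = mp_IdmE mp_BangE mp_ZrE mp_ScE mp_LpE mp_RpE mp_IndE mp_CmpE mp_IterE
  mp_ExTE mp_AllTE mp_DescE

section \<open>Models made of terms over a context\<close>

datatype val = VU | VP (vfst: val) (vsnd: val) | VN "tm set"

type_synonym ctx = "obj \<times> (obj \<times> tm \<times> tm) set"

text \<open>
  In a model an element of \<open>NatO\<close> is a class of terms \<open>C \<rightarrow> NatO\<close>, while the elements of \<open>One\<close>
  and of products are given concretely.  Since values of product type are pairs on the nose, the
  cartesian part of a term evaluates by unconditional rewriting; only iteration, the quantifiers and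
  description have to go back to terms, through \<open>reify\<close>.  A pair \<open>M = (C, R)\<close> consists of the context
  object and the congruence.
\<close>

fun reflect :: "ctx \<Rightarrow> obj \<Rightarrow> tm \<Rightarrow> val" where
  "reflect M One t = VU"
| "reflect M NatO t = VN {s. (NatO, t, s) \<in> snd M}"
| "reflect M (Prod A B) t = VP (reflect M A (Lp A B \<odot> t)) (reflect M B (Rp A B \<odot> t))"

fun reify :: "ctx \<Rightarrow> val \<Rightarrow> tm" where
  "reify M VU = Bang (fst M)"
| "reify M (VN X) = (SOME t. t \<in> X)"
| "reify M (VP a b) = Ind (reify M a) (reify M b)"

fun cod :: "tm \<Rightarrow> obj" where
  "cod (Iter g) = cod g"
| "cod (Idm A) = A"
| "cod (Bang A) = One"
| "cod (Lp A B) = A"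
| "cod (Rp A B) = B"
| "cod (Ind f g) = Prod (cod f) (cod g)"
| "cod (g \<odot> f) = cod g"
| "cod (Desc A B p) = B"
| "cod _ = NatO"

lemma cod_eq: "S \<turnstile> f \<Colon> A \<rightarrow> B \<Longrightarrow> cod f = B"
  by (induction f arbitrary: A B) (auto elim: mp_elims)

fun ev :: "ctx \<Rightarrow> tm \<Rightarrow> val \<Rightarrow> val" where
  "ev M (Idm A) v = v"
| "ev M (Bang A) v = VU"
| "ev M (Lp A B) v = vfst v"
| "ev M (Rp A B) v = vsnd v"
| "ev M (Ind f g) v = VP (ev M f v) (ev M g v)"
| "ev M (g \<odot> f) v = ev M g (ev M f v)"
| "ev M f v = reflect M (cod f) (f \<odot> reify M v)"

text \<open>Reflexivity at t stands for "t is a term of the context": the congruences below relate typed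
  terms only.\<close>

definition El :: "ctx \<Rightarrow> obj \<Rightarrow> val set" where
  "El M A = reflect M A ` {t. (A, t, t) \<in> snd M}"

locale congr =
  fixes S :: thy and M :: ctx
  assumes R_typ: "(A, f, g) \<in> snd M \<Longrightarrow> S \<turnstile> f \<Colon> fst M \<rightarrow> A \<and> S \<turnstile> g \<Colon> fst M \<rightarrow> A"
    and R_deq: "S \<turnstile> f \<Colon> fst M \<rightarrow> A \<Longrightarrow> S \<turnstile> g \<Colon> fst M \<rightarrow> A \<Longrightarrow> S \<turnstile> f \<approx> g \<Colon> fst M \<rightarrow> A
      \<Longrightarrow> (A, f, g) \<in> snd M"
    and R_sym: "(A, f, g) \<in> snd M \<Longrightarrow> (A, g, f) \<in> snd M"
    and R_trans: "(A, f, g) \<in> snd M \<Longrightarrow> (A, g, h) \<in> snd M \<Longrightarrow> (A, f, h) \<in> snd M"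
    and R_cmp: "(A, f, g) \<in> snd M \<Longrightarrow> S \<turnstile> h \<Colon> A \<rightarrow> B \<Longrightarrow> (B, h \<odot> f, h \<odot> g) \<in> snd M"
    and R_ind: "(A, f, f') \<in> snd M \<Longrightarrow> (B, g, g') \<in> snd M
      \<Longrightarrow> (Prod A B, Ind f g, Ind f' g') \<in> snd M"
begin

abbreviation "trm A t \<equiv> S \<turnstile> t \<Colon> fst M \<rightarrow> A"

lemma R_refl: "trm A t \<Longrightarrow> (A, t, t) \<in> snd M"
  by (simp add: R_deq eq_refl)

lemma El_iff: "v \<in> El M A \<longleftrightarrow> (\<exists>t. trm A t \<and> v = reflect M A t)"
  unfolding El_def using R_refl R_typ by blast

lemma R_ind_uniq: "trm (Prod A B) t \<Longrightarrow> (Prod A B, Ind (Lp A B \<odot> t) (Rp A B \<odot> t), t) \<in> snd M"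
  by (rule R_deq) (rule typing ind_uniq | assumption)+

lemma reflect_eq_iff: "trm A s \<Longrightarrow> trm A t \<Longrightarrow> reflect M A s = reflect M A t \<longleftrightarrow> (A, s, t) \<in> snd M"
proof (induction A arbitrary: s t)
  case One
  have "S \<turnstile> s \<approx> t \<Colon> fst M \<rightarrow> One"
    by (rule eq_trans[OF bang_uniq[OF One(1)] eq_sym[OF bang_uniq[OF One(2)]]])
  then show ?case using One by (simp add: R_deq)
next
  case NatO
  have "{r. (NatO, s, r) \<in> snd M} = {r. (NatO, t, r) \<in> snd M} \<longleftrightarrow> (NatO, s, t) \<in> snd M"
    using R_refl[OF NatO(2)] R_sym R_trans by blast
  then show ?case by simp
next
  case (Prod A B)
  note t = Prod.prems
  have typs: "trm A (Lp A B \<odot> s)" "trm A (Lp A B \<odot> t)" "trm B (Rp A B \<odot> s)" "trm B (Rp A B \<odot> t)"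
    using t by (auto intro: typing)
  show ?case
  proof
    assume "reflect M (Prod A B) s = reflect M (Prod A B) t"
    then have "(A, Lp A B \<odot> s, Lp A B \<odot> t) \<in> snd M" "(B, Rp A B \<odot> s, Rp A B \<odot> t) \<in> snd M"
      using Prod.IH typs by auto
    then have "(Prod A B, Ind (Lp A B \<odot> s) (Rp A B \<odot> s), Ind (Lp A B \<odot> t) (Rp A B \<odot> t)) \<in> snd M"
      by (rule R_ind)
    then show "(Prod A B, s, t) \<in> snd M"
      using R_ind_uniq t R_sym R_trans by blast
  next
    assume "(Prod A B, s, t) \<in> snd M"
    then have "(A, Lp A B \<odot> s, Lp A B \<odot> t) \<in> snd M" "(B, Rp A B \<odot> s, Rp A B \<odot> t) \<in> snd M"
      by (auto intro: R_cmp typing)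
    then show "reflect M (Prod A B) s = reflect M (Prod A B) t"
      using Prod.IH typs by auto
  qed
qed

lemma reflect_deq: "trm A s \<Longrightarrow> trm A t \<Longrightarrow> S \<turnstile> s \<approx> t \<Colon> fst M \<rightarrow> A \<Longrightarrow> reflect M A s = reflect M A t"
  by (simp add: reflect_eq_iff R_deq)

lemma reify_reflect: "trm A t \<Longrightarrow> (A, reify M (reflect M A t), t) \<in> snd M"
proof (induction A arbitrary: t)
  case One
  have "S \<turnstile> Bang (fst M) \<approx> t \<Colon> fst M \<rightarrow> One"
    by (rule eq_sym[OF bang_uniq[OF One]])
  then show ?case using One by (simp add: R_deq mp_bang)
next
  case NatO
  then have "(NatO, t, SOME s. (NatO, t, s) \<in> snd M) \<in> snd M"
    using R_refl by (metis someI)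
  then show ?case by (simp add: R_sym)
next
  case (Prod A B)
  then have "(Prod A B, reify M (reflect M (Prod A B) t), Ind (Lp A B \<odot> t) (Rp A B \<odot> t)) \<in> snd M"
    using Prod.IH(1)[OF mp_cmp[OF Prod.prems mp_lp]] Prod.IH(2)[OF mp_cmp[OF Prod.prems mp_rp]]
    by (simp add: R_ind)
  then show ?case by (rule R_trans[OF _ R_ind_uniq[OF Prod.prems]])
qed

lemma reflect_cmp_reify:
  assumes "S \<turnstile> f \<Colon> A \<rightarrow> B" "trm A t"
  shows "reflect M B (f \<odot> reify M (reflect M A t)) = reflect M B (f \<odot> t)"
proof -
  have "(B, f \<odot> reify M (reflect M A t), f \<odot> t) \<in> snd M"
    by (rule R_cmp[OF reify_reflect[OF assms(2)] assms(1)])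
  then show ?thesis using R_typ reflect_eq_iff by blast
qed

text \<open>
  Evaluation is composition; everything else about \<open>ev\<close> rests on this.
\<close>

lemma ev_reflect: "S \<turnstile> f \<Colon> A \<rightarrow> B \<Longrightarrow> trm A t \<Longrightarrow> ev M f (reflect M A t) = reflect M B (f \<odot> t)"
proof (induction f arbitrary: A B t)
  case (Idm X)
  then have "A = X" "B = X" by (auto elim!: mp_IdmE)
  moreover have "reflect M X t = reflect M X (Idm X \<odot> t)"
    by (rule reflect_deq) (use Idm calculation in \<open>auto intro!: typing eq_sym[OF id_left]\<close>)
  ultimately show ?case by simp
next
  case (Ind f g)
  from Ind.prems(1) obtain B1 B2 where B: "B = Prod B1 B2" "S \<turnstile> f \<Colon> A \<rightarrow> B1" "S \<turnstile> g \<Colon> A \<rightarrow> B2"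
    by (auto elim: mp_IndE)
  have fg: "S \<turnstile> Ind f g \<Colon> A \<rightarrow> Prod B1 B2" using B by (auto intro: typing)
  have "reflect M B1 (f \<odot> t) = reflect M B1 (Lp B1 B2 \<odot> (Ind f g \<odot> t))"
  proof (rule reflect_deq)
    have "S \<turnstile> (Lp B1 B2 \<odot> Ind f g) \<odot> t \<approx> f \<odot> t \<Colon> fst M \<rightarrow> B1"
      using B Ind.prems by (auto intro!: cmp_cong lp_ind eq_refl)
    moreover have "S \<turnstile> (Lp B1 B2 \<odot> Ind f g) \<odot> t \<approx> Lp B1 B2 \<odot> (Ind f g \<odot> t) \<Colon> fst M \<rightarrow> B1"
      using fg Ind.prems by (auto intro!: cmp_assoc typing)
    ultimately show "S \<turnstile> f \<odot> t \<approx> Lp B1 B2 \<odot> (Ind f g \<odot> t) \<Colon> fst M \<rightarrow> B1"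
      by (rule eq_trans[OF eq_sym])
  qed (use B Ind.prems fg in \<open>auto intro: typing\<close>)
  moreover have "reflect M B2 (g \<odot> t) = reflect M B2 (Rp B1 B2 \<odot> (Ind f g \<odot> t))"
  proof (rule reflect_deq)
    have "S \<turnstile> (Rp B1 B2 \<odot> Ind f g) \<odot> t \<approx> g \<odot> t \<Colon> fst M \<rightarrow> B2"
      using B Ind.prems by (auto intro!: cmp_cong rp_ind eq_refl)
    moreover have "S \<turnstile> (Rp B1 B2 \<odot> Ind f g) \<odot> t \<approx> Rp B1 B2 \<odot> (Ind f g \<odot> t) \<Colon> fst M \<rightarrow> B2"
      using fg Ind.prems by (auto intro!: cmp_assoc typing)
    ultimately show "S \<turnstile> g \<odot> t \<approx> Rp B1 B2 \<odot> (Ind f g \<odot> t) \<Colon> fst M \<rightarrow> B2"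
      by (rule eq_trans[OF eq_sym])
  qed (use B Ind.prems fg in \<open>auto intro: typing\<close>)
  ultimately show ?case using Ind B by simp
next
  case (Cmp g f)
  from Cmp.prems(1) obtain D where D: "S \<turnstile> f \<Colon> A \<rightarrow> D" "S \<turnstile> g \<Colon> D \<rightarrow> B"
    by (auto elim: mp_CmpE)
  have "ev M (g \<odot> f) (reflect M A t) = reflect M B (g \<odot> (f \<odot> t))"
    using Cmp D by (auto intro: typing)
  also have "\<dots> = reflect M B ((g \<odot> f) \<odot> t)"
    by (rule reflect_deq) (use D Cmp.prems in \<open>auto intro!: typing eq_sym[OF cmp_assoc] intro: typing\<close>)
  finally show ?case .
next
  case (Iter g)
  then have "cod g = B" using cod_eq[OF Iter.prems(1)] by simp
  then show ?case using reflect_cmp_reify[OF Iter.prems] by simp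
next
  case (Bang X)
  then show ?case by (auto elim!: mp_BangE)
next
  case (Lp X Y)
  then show ?case by (auto elim!: mp_LpE)
next
  case (Rp X Y)
  then show ?case by (auto elim!: mp_RpE)
next
  case Zr
  then have "B = NatO" by (auto elim!: mp_ZrE)
  then show ?case using reflect_cmp_reify[OF Zr] by simp
next
  case Sc
  then have "B = NatO" by (auto elim!: mp_ScE)
  then show ?case using reflect_cmp_reify[OF Sc] by simp
next
  case (ExT X Y p)
  then have "B = NatO" by (auto elim!: mp_ExTE)
  then show ?case using reflect_cmp_reify[OF ExT.prems] by simp
next
  case (AllT X Y p)
  then have "B = NatO" by (auto elim!: mp_AllTE)
  then show ?case using reflect_cmp_reify[OF AllT.prems] by simp
next
  case (Desc X Y p)
  then have "B = Y" by (auto elim!: mp_DescE)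
  then show ?case using reflect_cmp_reify[OF Desc.prems] by simp
qed

end


text \<open>These clauses re-enter terms; the laws derived from the axioms of the calculus replace them.\<close>

declare ev.simps(7-12) [simp del]

context congr
begin

abbreviation "zr \<equiv> ev M Zr VU"
abbreviation "sc n \<equiv> ev M Sc n"

lemma reflect_in_El [intro]: "trm A t \<Longrightarrow> reflect M A t \<in> El M A"
  by (auto simp: El_iff)

lemma ev_El: "S \<turnstile> f \<Colon> A \<rightarrow> B \<Longrightarrow> v \<in> El M A \<Longrightarrow> ev M f v \<in> El M B"
  by (auto simp: El_iff ev_reflect intro: typing)

lemma sound:
  assumes "S \<turnstile> f \<approx> g \<Colon> A \<rightarrow> B" "S \<turnstile> f \<Colon> A \<rightarrow> B" "S \<turnstile> g \<Colon> A \<rightarrow> B" "v \<in> El M A"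
  shows "ev M f v = ev M g v"
proof -
  obtain t where t: "trm A t" "v = reflect M A t" using assms El_iff by auto
  have "reflect M B (f \<odot> t) = reflect M B (g \<odot> t)"
    by (rule reflect_deq) (use assms t in \<open>auto intro: typing cmp_cong eq_refl\<close>)
  then show ?thesis using t assms by (simp add: ev_reflect)
qed

lemma VU_El [simp]: "VU \<in> El M One"
  using reflect_in_El[OF mp_bang] by simp

lemma El_One: "v \<in> El M One \<Longrightarrow> v = VU"
  by (auto simp: El_iff)

lemma reflect_Ind: "trm A f \<Longrightarrow> trm B g \<Longrightarrow> reflect M (Prod A B) (Ind f g) = VP (reflect M A f) (reflect M B g)"
  using reflect_deq[OF mp_cmp[OF mp_ind mp_lp] _ lp_ind] reflect_deq[OF mp_cmp[OF mp_ind mp_rp] _ rp_ind]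
  by simp

lemma VP_El [simp]: "VP a b \<in> El M (Prod A B) \<longleftrightarrow> a \<in> El M A \<and> b \<in> El M B"
proof
  assume "VP a b \<in> El M (Prod A B)"
  then show "a \<in> El M A \<and> b \<in> El M B" by (auto simp: El_iff intro: typing)
next
  assume "a \<in> El M A \<and> b \<in> El M B"
  then obtain f g where "trm A f" "trm B g" "a = reflect M A f" "b = reflect M B g"
    by (auto simp: El_iff)
  then have "trm (Prod A B) (Ind f g)" "VP a b = reflect M (Prod A B) (Ind f g)"
    by (simp_all only: reflect_Ind mp_ind)
  then show "VP a b \<in> El M (Prod A B)" by (metis reflect_in_El)
qed

lemma El_ProdE:
  assumes "v \<in> El M (Prod A B)"
  obtains a b where "v = VP a b" "a \<in> El M A" "b \<in> El M B"
proof -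
  obtain t where t: "trm (Prod A B) t" "v = reflect M (Prod A B) t" using assms El_iff by auto
  show thesis
    by (rule that[of "reflect M A (Lp A B \<odot> t)" "reflect M B (Rp A B \<odot> t)"])
      (use t in \<open>auto intro!: reflect_in_El intro: typing\<close>)
qed

lemma vfst_El [simp]: "v \<in> El M (Prod A B) \<Longrightarrow> vfst v \<in> El M A"
  by (auto elim: El_ProdE)

lemma vsnd_El [simp]: "v \<in> El M (Prod A B) \<Longrightarrow> vsnd v \<in> El M B"
  by (auto elim: El_ProdE)

lemma VP_eta: "v \<in> El M (Prod A B) \<Longrightarrow> VP (vfst v) (vsnd v) = v"
  by (auto elim: El_ProdE)

lemma zr_El [simp]: "zr \<in> El M NatO"
  by (rule ev_El[OF mp_zr]) simp

lemma sc_El [simp]: "n \<in> El M NatO \<Longrightarrow> sc n \<in> El M NatO"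
  by (rule ev_El[OF mp_sc])

lemma Iter_El: "S \<turnstile> g \<Colon> A \<rightarrow> A \<Longrightarrow> a \<in> El M A \<Longrightarrow> n \<in> El M NatO \<Longrightarrow> ev M (Iter g) (VP a n) \<in> El M A"
  by (rule ev_El[OF mp_iter]) simp_all

lemma typ_iter_zr: "S \<turnstile> g \<Colon> A \<rightarrow> A \<Longrightarrow> S \<turnstile> Iter g \<odot> Ind (Idm A) (Zr \<odot> Bang A) \<Colon> A \<rightarrow> A"
  by (rule typing | assumption)+

lemma Iter_zr: "S \<turnstile> g \<Colon> A \<rightarrow> A \<Longrightarrow> a \<in> El M A \<Longrightarrow> ev M (Iter g) (VP a zr) = a"
  using sound[OF iter_zr typ_iter_zr mp_id, of g A a] by simp

lemma typ_iter_sc: "S \<turnstile> g \<Colon> A \<rightarrow> A \<Longrightarrow>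
    S \<turnstile> Iter g \<odot> Ind (Lp A NatO) (Sc \<odot> Rp A NatO) \<Colon> Prod A NatO \<rightarrow> A"
  by (rule typing | assumption)+

lemma Iter_sc: "S \<turnstile> g \<Colon> A \<rightarrow> A \<Longrightarrow> a \<in> El M A \<Longrightarrow> n \<in> El M NatO \<Longrightarrow>
    ev M (Iter g) (VP a (sc n)) = ev M g (ev M (Iter g) (VP a n))"
  using sound[OF iter_sc typ_iter_sc mp_cmp[OF mp_iter], of g A "VP a n"] by simp

lemma R_reflect: "(A, f, g) \<in> snd M \<Longrightarrow> reflect M A f = reflect M A g"
  using R_typ reflect_eq_iff by blast

end

lemmas prod_elim = congr.El_ProdE[rotated]

text \<open>
  Derivable equality itself is the least congruence, and the identity term is a generic element of its
  context.  Hence equality of values in all congruences is derivable equality.  This already turns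
  the equational reasoning needed before two-valuedness into evaluation.
\<close>

lemma congr_deq:
  "congr S (C, {(A, f, g). S \<turnstile> f \<Colon> C \<rightarrow> A \<and> S \<turnstile> g \<Colon> C \<rightarrow> A \<and> S \<turnstile> f \<approx> g \<Colon> C \<rightarrow> A})"
  by unfold_locales (auto intro: eq_sym eq_trans cmp_cong ind_cong eq_refl typing)

lemma complete_congr:
  assumes f: "S \<turnstile> f \<Colon> A \<rightarrow> B" and g: "S \<turnstile> g \<Colon> A \<rightarrow> B"
    and eq: "\<And>M v. congr S M \<Longrightarrow> v \<in> El M A \<Longrightarrow> ev M f v = ev M g v"
  shows "S \<turnstile> f \<approx> g \<Colon> A \<rightarrow> B"
proof -
  let ?M = "(A, {(B, f, g). S \<turnstile> f \<Colon> A \<rightarrow> B \<and> S \<turnstile> g \<Colon> A \<rightarrow> B \<and> S \<turnstile> f \<approx> g \<Colon> A \<rightarrow> B})"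
  interpret congr S ?M by (rule congr_deq)
  have id: "trm A (Idm A)" by (simp add: mp_id)
  have "ev ?M f (reflect ?M A (Idm A)) = ev ?M g (reflect ?M A (Idm A))"
    by (rule eq) (use id congr_axioms in auto)
  then have "reflect ?M B (f \<odot> Idm A) = reflect ?M B (g \<odot> Idm A)"
    using ev_reflect[OF f id] ev_reflect[OF g id] by simp
  moreover have "trm B (f \<odot> Idm A)" "trm B (g \<odot> Idm A)"
    using f g by (auto intro: typing)
  ultimately have "S \<turnstile> f \<odot> Idm A \<approx> g \<odot> Idm A \<Colon> A \<rightarrow> B"
    using reflect_eq_iff by fastforce
  then show ?thesis using id_right[OF f] id_right[OF g] eq_sym eq_trans by metis
qed

section \<open>Case distinction on numbers\<close>

lemma iter_eq_deq:
  assumes h: "S \<turnstile> h \<Colon> Prod A NatO \<rightarrow> B" and h': "S \<turnstile> h' \<Colon> Prod A NatO \<rightarrow> B"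
    and g: "S \<turnstile> g \<Colon> B \<rightarrow> B"
    and z: "S \<turnstile> h \<odot> Ind (Idm A) (Zr \<odot> Bang A) \<approx> h' \<odot> Ind (Idm A) (Zr \<odot> Bang A) \<Colon> A \<rightarrow> B"
    and s: "S \<turnstile> h \<odot> Ind (Lp A NatO) (Sc \<odot> Rp A NatO) \<approx> g \<odot> h \<Colon> Prod A NatO \<rightarrow> B"
    and s': "S \<turnstile> h' \<odot> Ind (Lp A NatO) (Sc \<odot> Rp A NatO) \<approx> g \<odot> h' \<Colon> Prod A NatO \<rightarrow> B"
  shows "S \<turnstile> h \<approx> h' \<Colon> Prod A NatO \<rightarrow> B"
proof -
  have f: "S \<turnstile> h \<odot> Ind (Idm A) (Zr \<odot> Bang A) \<Colon> A \<rightarrow> B" by (rule typing h)+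
  show ?thesis
    by (rule eq_trans[OF iter_uniq[OF f g h eq_refl[OF f] s]
          eq_sym[OF iter_uniq[OF f g h' eq_sym[OF z] s']]])
qed

lemma iter_eq_congr:
  assumes h: "S \<turnstile> h \<Colon> Prod A NatO \<rightarrow> B" and h': "S \<turnstile> h' \<Colon> Prod A NatO \<rightarrow> B"
    and g: "S \<turnstile> g \<Colon> B \<rightarrow> B"
    and z: "\<And>M a. congr S M \<Longrightarrow> a \<in> El M A \<Longrightarrow> ev M h (VP a (ev M Zr VU)) = ev M h' (VP a (ev M Zr VU))"
    and s: "\<And>M a n. congr S M \<Longrightarrow> a \<in> El M A \<Longrightarrow> n \<in> El M NatO \<Longrightarrow>
      ev M h (VP a (ev M Sc n)) = ev M g (ev M h (VP a n))"
    and s': "\<And>M a n. congr S M \<Longrightarrow> a \<in> El M A \<Longrightarrow> n \<in> El M NatO \<Longrightarrow>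
      ev M h' (VP a (ev M Sc n)) = ev M g (ev M h' (VP a n))"
  shows "S \<turnstile> h \<approx> h' \<Colon> Prod A NatO \<rightarrow> B"
proof (rule iter_eq_deq[OF h h' g])
  show "S \<turnstile> h \<odot> Ind (Idm A) (Zr \<odot> Bang A) \<approx> h' \<odot> Ind (Idm A) (Zr \<odot> Bang A) \<Colon> A \<rightarrow> B"
    by (rule complete_congr) (rule typing h h' | simp add: z)+
  show "S \<turnstile> h \<odot> Ind (Lp A NatO) (Sc \<odot> Rp A NatO) \<approx> g \<odot> h \<Colon> Prod A NatO \<rightarrow> B"
    by (rule complete_congr) (rule typing h h' g | auto elim!: prod_elim simp: s)+
  show "S \<turnstile> h' \<odot> Ind (Lp A NatO) (Sc \<odot> Rp A NatO) \<approx> g \<odot> h' \<Colon> Prod A NatO \<rightarrow> B"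
    by (rule complete_congr) (rule typing h h' g | auto elim!: prod_elim simp: s')+
qed

text \<open>
  A map out of \<open>A \<times> NatO\<close> is determined by its values at zero and at successors.  The reason is that
  \<open>(a, n) \<mapsto> ((a, n), h(a, n))\<close> is an iterated map whose step forgets the old value and computes
  \<open>h(a, n + 1)\<close> afresh, and this step uses only the values of h at successors.
\<close>

lemma case_eq_congr:
  assumes h: "S \<turnstile> h \<Colon> Prod A NatO \<rightarrow> B" and h': "S \<turnstile> h' \<Colon> Prod A NatO \<rightarrow> B"
    and z: "\<And>M a. congr S M \<Longrightarrow> a \<in> El M A \<Longrightarrow> ev M h (VP a (ev M Zr VU)) = ev M h' (VP a (ev M Zr VU))"
    and s: "\<And>M a n. congr S M \<Longrightarrow> a \<in> El M A \<Longrightarrow> n \<in> El M NatO \<Longrightarrow>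
      ev M h (VP a (ev M Sc n)) = ev M h' (VP a (ev M Sc n))"
    and M: "congr S M" and a: "a \<in> El M A" and n: "n \<in> El M NatO"
  shows "ev M h (VP a n) = ev M h' (VP a n)"
proof -
  let ?P = "Prod A NatO"
  let ?n = "Ind (Lp A NatO \<odot> Lp ?P B) (Sc \<odot> Rp A NatO \<odot> Lp ?P B)"
  let ?g = "Ind ?n (h \<odot> ?n)"
  have t: "S \<turnstile> Ind (Idm ?P) h \<Colon> ?P \<rightarrow> Prod ?P B" "S \<turnstile> Ind (Idm ?P) h' \<Colon> ?P \<rightarrow> Prod ?P B"
    by (rule typing h h')+
  have g: "S \<turnstile> ?g \<Colon> Prod ?P B \<rightarrow> Prod ?P B" by (rule typing h)+
  have "S \<turnstile> Ind (Idm ?P) h \<approx> Ind (Idm ?P) h' \<Colon> ?P \<rightarrow> Prod ?P B"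
    by (rule iter_eq_congr[OF t g]) (simp_all add: z s)
  from congr.sound[OF M this t, of "VP a n"] show ?thesis
    using M a n by (simp add: congr.VP_El)
qed

text \<open>The conditional as an operation on elements: \<open>((x, y), n)\<close> goes to y for n = 0 and to x
  otherwise.  The identities below are proved by case distinction; they make "equal if n is not 0"
  and "equal if n is 0" congruences.\<close>

definition sel :: "obj \<Rightarrow> tm" where
  "sel B = Rp B B \<odot> Iter (Ind (Lp B B) (Lp B B))"

lemma typ_sel [typing]: "S \<turnstile> sel B \<Colon> Prod (Prod B B) NatO \<rightarrow> B"
  unfolding sel_def by (rule typing)+

lemma ev_condT: "ev M (condT B p x y) v = ev M (sel B) (VP (VP (ev M x v) (ev M y v)) (ev M p v))"
  by (simp add: condT_def sel_def)

context congr
begin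

lemma sel_El: "x \<in> El M B \<Longrightarrow> y \<in> El M B \<Longrightarrow> n \<in> El M NatO \<Longrightarrow> ev M (sel B) (VP (VP x y) n) \<in> El M B"
  by (rule ev_El[OF typ_sel]) simp

lemma typ_swap: "S \<turnstile> Ind (Lp B B) (Lp B B) \<Colon> Prod B B \<rightarrow> Prod B B"
  by (rule typing)+

lemma sel_zr: "x \<in> El M B \<Longrightarrow> y \<in> El M B \<Longrightarrow> ev M (sel B) (VP (VP x y) zr) = y"
  by (simp add: sel_def Iter_zr[OF typ_swap])

end

lemma (in congr) sel_sc:
  assumes "x \<in> El M B" "y \<in> El M B" "n \<in> El M NatO"
  shows "ev M (sel B) (VP (VP x y) (sc n)) = x"
proof -
  let ?P = "Prod (Prod B B) NatO"
  have t: "S \<turnstile> Lp B B \<odot> Iter (Ind (Lp B B) (Lp B B)) \<Colon> ?P \<rightarrow> B"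
    "S \<turnstile> Lp B B \<odot> Lp (Prod B B) NatO \<Colon> ?P \<rightarrow> B" by (rule typing)+
  have "S \<turnstile> Lp B B \<odot> Iter (Ind (Lp B B) (Lp B B)) \<approx> Lp B B \<odot> Lp (Prod B B) NatO \<Colon> ?P \<rightarrow> B"
    by (rule iter_eq_congr[OF t mp_id])
      (simp_all add: congr.Iter_zr[OF _ congr.typ_swap] congr.Iter_sc[OF _ congr.typ_swap])
  from sound[OF this t, of "VP (VP x y) n"] show ?thesis
    using assms by (simp add: sel_def Iter_sc[OF typ_swap])
qed

lemma (in congr) pred_zr: "ev M predm zr = zr"
proof -
  have t: "S \<turnstile> Ind (Rp NatO NatO) (Sc \<odot> Rp NatO NatO) \<Colon> Prod NatO NatO \<rightarrow> Prod NatO NatO"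
    by (rule typing)+
  show ?thesis by (simp add: predm_def Iter_zr[OF t])
qed

lemma (in congr) pred_sc: 
  assumes n: "n \<in> El M NatO" 
  shows "ev M predm (sc n) = n"
proof -
  let ?P = "Prod One NatO"
  let ?z = "Zr \<odot> Bang ?P"
  let ?g = "Ind (Rp NatO NatO) (Sc \<odot> Rp NatO NatO)"
  let ?h = "Rp NatO NatO \<odot> Iter ?g \<odot> Ind (Ind ?z ?z) (Rp One NatO)"
  have g: "S \<turnstile> ?g \<Colon> Prod NatO NatO \<rightarrow> Prod NatO NatO" by (rule typing)+
  have t: "S \<turnstile> ?h \<Colon> ?P \<rightarrow> NatO" "S \<turnstile> Rp One NatO \<Colon> ?P \<rightarrow> NatO" by (rule typing)+
  have "S \<turnstile> ?h \<approx> Rp One NatO \<Colon> ?P \<rightarrow> NatO"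
    by (rule iter_eq_congr[OF t mp_sc])
      (simp_all add: congr.Iter_zr[OF _ g] congr.Iter_sc[OF _ g] congr.VP_El congr.zr_El)
  from sound[OF this t, of "VP VU n"] show ?thesis
    using n by (simp add: predm_def Iter_sc[OF g])
qed

lemma (in congr) sel_case:
  assumes "x \<in> El M B" "n \<in> El M NatO"
  shows "ev M (sel B) (VP (VP x x) n) = x"
proof -
  have "ev M (sel B \<odot> Ind (Ind (Lp B NatO) (Lp B NatO)) (Rp B NatO)) (VP x n) = ev M (Lp B NatO) (VP x n)"
    by (rule case_eq_congr[OF _ _ _ _ congr_axioms assms])
      (rule typing | simp add: congr.sel_sc congr.sel_zr)+
  then show ?thesis by simp
qed

lemma (in congr) sel_sel1:
  assumes "x \<in> El M B" "y \<in> El M B" "z \<in> El M B" "n \<in> El M NatO"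
  shows "ev M (sel B) (VP (VP (ev M (sel B) (VP (VP x y) n)) z) n) = ev M (sel B) (VP (VP x z) n)"
proof -
  let ?A = "Prod (Prod B B) B"
  let ?x = "Lp B B \<odot> Lp (Prod B B) B \<odot> Lp ?A NatO"
  let ?y = "Rp B B \<odot> Lp (Prod B B) B \<odot> Lp ?A NatO"
  let ?z = "Rp (Prod B B) B \<odot> Lp ?A NatO"
  let ?n = "Rp ?A NatO"
  have "ev M (sel B \<odot> Ind (Ind (sel B \<odot> Ind (Ind ?x ?y) ?n) ?z) ?n) (VP (VP (VP x y) z) n)
    = ev M (sel B \<odot> Ind (Ind ?x ?z) ?n) (VP (VP (VP x y) z) n)"
    by (rule case_eq_congr[where A="?A" and B=B, OF _ _ _ _ congr_axioms _ assms(4)])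
      (rule typing | use assms in \<open>auto elim!: prod_elim simp: congr.sel_sc congr.sel_zr\<close>)+
  then show ?thesis by simp
qed

lemma (in congr) sel_sel2:
  assumes "x \<in> El M B" "y \<in> El M B" "z \<in> El M B" "n \<in> El M NatO"
  shows "ev M (sel B) (VP (VP x (ev M (sel B) (VP (VP y z) n))) n) = ev M (sel B) (VP (VP x z) n)"
proof -
  let ?A = "Prod (Prod B B) B"
  let ?x = "Lp B B \<odot> Lp (Prod B B) B \<odot> Lp ?A NatO"
  let ?y = "Rp B B \<odot> Lp (Prod B B) B \<odot> Lp ?A NatO"
  let ?z = "Rp (Prod B B) B \<odot> Lp ?A NatO"
  let ?n = "Rp ?A NatO"
  have "ev M (sel B \<odot> Ind (Ind ?x (sel B \<odot> Ind (Ind ?y ?z) ?n)) ?n) (VP (VP (VP x y) z) n)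
    = ev M (sel B \<odot> Ind (Ind ?x ?z) ?n) (VP (VP (VP x y) z) n)"
    by (rule case_eq_congr[where A="?A" and B=B, OF _ _ _ _ congr_axioms _ assms(4)])
      (rule typing | use assms in \<open>auto elim!: prod_elim simp: congr.sel_sc congr.sel_zr\<close>)+
  then show ?thesis by simp
qed

lemma (in congr) sel_ev:
  assumes h: "S \<turnstile> h \<Colon> A \<rightarrow> B" and "x \<in> El M A" "y \<in> El M A" "n \<in> El M NatO"
  shows "ev M h (ev M (sel A) (VP (VP x y) n)) = ev M (sel B) (VP (VP (ev M h x) (ev M h y)) n)"
proof -
  let ?A = "Prod A A"
  let ?x = "Lp A A \<odot> Lp ?A NatO"
  let ?y = "Rp A A \<odot> Lp ?A NatO"
  have "ev M (h \<odot> sel A) (VP (VP x y) n)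
    = ev M (sel B \<odot> Ind (Ind (h \<odot> ?x) (h \<odot> ?y)) (Rp ?A NatO)) (VP (VP x y) n)"
    by (rule case_eq_congr[where A="?A" and B=B, OF _ _ _ _ congr_axioms _ assms(4)])
      (rule typing h | use assms in \<open>auto elim!: prod_elim
          simp: congr.sel_sc congr.sel_zr congr.ev_El[OF _ h]\<close>)+
  then show ?thesis by simp
qed

lemma (in congr) sel_pred:
  assumes n: "n \<in> El M NatO"
  shows "ev M (sel NatO) (VP (VP n (sc (ev M predm n))) n) = sc (ev M predm n)"
proof -
  let ?n = "Rp One NatO"
  have "ev M (sel NatO \<odot> Ind (Ind ?n (Sc \<odot> predm \<odot> ?n)) ?n) (VP VU n) = ev M (Sc \<odot> predm \<odot> ?n) (VP VU n)"
    by (rule case_eq_congr[OF _ _ _ _ congr_axioms _ n])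
      (rule typing | simp add: congr.sel_sc congr.sel_zr congr.pred_sc congr.pred_zr congr.sc_El congr.zr_El)+
  then show ?thesis by simp
qed

lemma (in congr) sel_zero:
  assumes n: "n \<in> El M NatO"
  shows "ev M (sel NatO) (VP (VP n zr) n) = n"
proof -
  let ?n = "Rp One NatO"
  have "ev M (sel NatO \<odot> Ind (Ind ?n (Zr \<odot> Bang (Prod One NatO))) ?n) (VP VU n) = ev M ?n (VP VU n)"
    by (rule case_eq_congr[OF _ _ _ _ congr_axioms _ n])
      (rule typing | simp add: congr.sel_sc congr.sel_zr congr.sc_El congr.zr_El)+
  then show ?thesis by simp
qed


section \<open>Two-valued models and completeness\<close>

locale model = congr +
  assumes two: "n \<in> El M NatO \<Longrightarrow> n = zr \<or> n = sc (ev M predm n)"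
    and nontriv: "zr \<noteq> sc zr"

lemma (in congr) refine:
  fixes E :: "obj \<Rightarrow> val \<Rightarrow> val \<Rightarrow> bool"
  assumes r: "\<And>A x. x \<in> El M A \<Longrightarrow> E A x x"
    and s: "\<And>A x y. x \<in> El M A \<Longrightarrow> y \<in> El M A \<Longrightarrow> E A x y \<Longrightarrow> E A y x"
    and t: "\<And>A x y z. x \<in> El M A \<Longrightarrow> y \<in> El M A \<Longrightarrow> z \<in> El M A \<Longrightarrow> E A x y \<Longrightarrow> E A y z \<Longrightarrow> E A x z"
    and h: "\<And>A B h x y. S \<turnstile> h \<Colon> A \<rightarrow> B \<Longrightarrow> x \<in> El M A \<Longrightarrow> y \<in> El M A \<Longrightarrow> E A x y
      \<Longrightarrow> E B (ev M h x) (ev M h y)"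
    and p: "\<And>A B x y x' y'. x \<in> El M A \<Longrightarrow> x' \<in> El M A \<Longrightarrow> y \<in> El M B \<Longrightarrow> y' \<in> El M B
      \<Longrightarrow> E A x x' \<Longrightarrow> E B y y' \<Longrightarrow> E (Prod A B) (VP x y) (VP x' y')"
  defines "R' \<equiv> {(A, f, g). trm A f \<and> trm A g \<and> E A (reflect M A f) (reflect M A g)}"
  shows "congr S (fst M, R')" "snd M \<subseteq> R'"
proof -
  show "congr S (fst M, R')"
  proof
    fix A f g assume "(A, f, g) \<in> snd (fst M, R')"
    then show "S \<turnstile> f \<Colon> fst (fst M, R') \<rightarrow> A \<and> S \<turnstile> g \<Colon> fst (fst M, R') \<rightarrow> A"
      by (simp add: R'_def)
  next
    fix A f g assume "S \<turnstile> f \<Colon> fst (fst M, R') \<rightarrow> A" "S \<turnstile> g \<Colon> fst (fst M, R') \<rightarrow> A"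
      "S \<turnstile> f \<approx> g \<Colon> fst (fst M, R') \<rightarrow> A"
    then show "(A, f, g) \<in> snd (fst M, R')"
      using reflect_deq[of f A g] r[of "reflect M A g" A] by (auto simp: R'_def)
  next
    fix A f g assume "(A, f, g) \<in> snd (fst M, R')"
    then show "(A, g, f) \<in> snd (fst M, R')"
      using s by (auto simp: R'_def)
  next
    fix A f g h assume "(A, f, g) \<in> snd (fst M, R')" "(A, g, h) \<in> snd (fst M, R')"
    then show "(A, f, h) \<in> snd (fst M, R')"
      using t[of "reflect M A f" A "reflect M A g" "reflect M A h"] by (auto simp: R'_def)
  next
    fix A f g h B assume a: "(A, f, g) \<in> snd (fst M, R')" "S \<turnstile> h \<Colon> A \<rightarrow> B"
    then have "E B (reflect M B (h \<odot> f)) (reflect M B (h \<odot> g))"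
      using h[of h A B "reflect M A f" "reflect M A g"] by (auto simp: R'_def ev_reflect)
    then show "(B, h \<odot> f, h \<odot> g) \<in> snd (fst M, R')"
      using a by (auto simp: R'_def intro: typing)
  next
    fix A f f' B g g' assume a: "(A, f, f') \<in> snd (fst M, R')" "(B, g, g') \<in> snd (fst M, R')"
    have "E (Prod A B) (VP (reflect M A f) (reflect M B g)) (VP (reflect M A f') (reflect M B g'))"
      by (rule p) (use a in \<open>auto simp: R'_def\<close>)
    then have "E (Prod A B) (reflect M (Prod A B) (Ind f g)) (reflect M (Prod A B) (Ind f' g'))"
      using a by (simp add: R'_def reflect_Ind del: reflect.simps)
    then show "(Prod A B, Ind f g, Ind f' g') \<in> snd (fst M, R')"
      using a by (simp add: R'_def mp_ind del: reflect.simps)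
  qed
  show "snd M \<subseteq> R'"
    using R_reflect R_typ r[OF reflect_in_El] unfolding R'_def by fastforce
qed

text \<open>
  Every number n splits the congruence in two: x and y agree where n is not 0 iff
  \<open>sel((x, y), n) = y\<close>, and where n is 0 iff \<open>sel((x, y), n) = x\<close>.  Terms that agree in both senses are
  equal, so one of the two coarser congruences still separates a and b, and by maximality it is the
  given one.  In the first, n equals the successor of its predecessor; in the second, n equals 0.
\<close>

lemma (in congr) maximal_two:
  assumes ab: "(B, a, b) \<notin> snd M" "trm B a" "trm B b"
    and max: "\<And>R'. congr S (fst M, R') \<Longrightarrow> snd M \<subseteq> R' \<Longrightarrow> (B, a, b) \<notin> R' \<Longrightarrow> R' = snd M"
    and n: "n \<in> El M NatO"
  shows "n = zr \<or> n = sc (ev M predm n)"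
proof -
  define s where "s A x y = ev M (sel A) (VP (VP x y) n)" for A x y
  have s_El: "s A x y \<in> El M A" if "x \<in> El M A" "y \<in> El M A" for A x y
    unfolding s_def using that n sel_El by blast
  have s0: "s A x x = x" if "x \<in> El M A" for A x
    unfolding s_def using that n sel_case by blast
  have s1: "s A (s A x y) z = s A x z" if "x \<in> El M A" "y \<in> El M A" "z \<in> El M A" for A x y z
    unfolding s_def using that n sel_sel1 by blast
  have s2: "s A x (s A y z) = s A x z" if "x \<in> El M A" "y \<in> El M A" "z \<in> El M A" for A x y z
    unfolding s_def using that n sel_sel2 by blast
  have sh: "ev M h (s A x y) = s B (ev M h x) (ev M h y)"
    if "S \<turnstile> h \<Colon> A \<rightarrow> B" "x \<in> El M A" "y \<in> El M A" for A B h x y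
    unfolding s_def using that n sel_ev by blast
  have sp: "s (Prod A B) (VP x y) (VP x' y') = VP (s A x x') (s B y y')"
    if "x \<in> El M A" "x' \<in> El M A" "y \<in> El M B" "y' \<in> El M B" for A B x x' y y'
  proof -
    have "s (Prod A B) (VP x y) (VP x' y') \<in> El M (Prod A B)"
      using that by (simp add: s_El)
    moreover have "vfst (s (Prod A B) (VP x y) (VP x' y')) = s A x x'"
      using sh[OF mp_lp, of "VP x y" A B "VP x' y'"] that by simp
    moreover have "vsnd (s (Prod A B) (VP x y) (VP x' y')) = s B y y'"
      using sh[OF mp_rp, of "VP x y" A B "VP x' y'"] that by simp
    ultimately show ?thesis using VP_eta by metis
  qed
  define Rpos where "Rpos = {(A, f, g). trm A f \<and> trm A g \<and> s A (reflect M A f) (reflect M A g) = reflect M A g}"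
  define Rneg where "Rneg = {(A, f, g). trm A f \<and> trm A g \<and> s A (reflect M A f) (reflect M A g) = reflect M A f}"
  have Rpos: "congr S (fst M, Rpos)" "snd M \<subseteq> Rpos"
    unfolding Rpos_def
    by (rule refine[where E = "\<lambda>A x y. s A x y = y"]; metis s0 s1 sh sp)+
  have Rneg: "congr S (fst M, Rneg)" "snd M \<subseteq> Rneg"
    unfolding Rneg_def
    by (rule refine[where E = "\<lambda>A x y. s A x y = x"]; metis s0 s2 sh sp)+
  have "reflect M B a \<noteq> reflect M B b" using ab reflect_eq_iff by simp
  then have "(B, a, b) \<notin> Rpos \<or> (B, a, b) \<notin> Rneg"
    unfolding Rpos_def Rneg_def by auto
  then have "Rpos = snd M \<or> Rneg = snd M" using max Rpos Rneg by blast
  then show ?thesis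
  proof
    assume R: "Rpos = snd M"
    obtain t where t: "trm NatO t" "n = reflect M NatO t" using n El_iff by auto
    have t': "trm NatO (Sc \<odot> predm \<odot> t)" by (rule typing t)+
    have e: "reflect M NatO (Sc \<odot> predm \<odot> t) = sc (ev M predm n)"
      using t by (simp add: ev_reflect[OF mp_sc mp_cmp[OF t(1) typ_predm]] ev_reflect[OF typ_predm t(1)] del: reflect.simps)
    have "s NatO n (sc (ev M predm n)) = sc (ev M predm n)"
      unfolding s_def by (rule sel_pred[OF n])
    then have "(NatO, t, Sc \<odot> predm \<odot> t) \<in> Rpos"
      unfolding Rpos_def using t t' e by (simp del: reflect.simps)
    then have "reflect M NatO t = reflect M NatO (Sc \<odot> predm \<odot> t)"
      using R R_reflect by blast
    then show ?thesis using t e by (simp del: reflect.simps)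
  next
    assume R: "Rneg = snd M"
    obtain t where t: "trm NatO t" "n = reflect M NatO t" using n El_iff by auto
    have t': "trm NatO (Zr \<odot> Bang (fst M))" by (rule typing t)+
    have e: "reflect M NatO (Zr \<odot> Bang (fst M)) = zr"
      using ev_reflect[OF mp_zr mp_bang] by simp
    have "s NatO n zr = n"
      unfolding s_def by (rule sel_zero[OF n])
    then have "(NatO, t, Zr \<odot> Bang (fst M)) \<in> Rneg"
      unfolding Rneg_def using t t' e by (simp del: reflect.simps)
    then have "reflect M NatO t = reflect M NatO (Zr \<odot> Bang (fst M))"
      using R R_reflect by blast
    then show ?thesis using t e by (simp del: reflect.simps)
  qed
qed

lemma (in congr) nontriv_if:
  assumes "(B, a, b) \<notin> snd M" "trm B a" "trm B b"
  shows "zr \<noteq> sc zr"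
proof
  assume *: "zr = sc zr"
  have El: "reflect M B a \<in> El M B" "reflect M B b \<in> El M B" using assms by auto
  have "reflect M B a = reflect M B b"
    using sel_zr[OF El] sel_sc[OF El zr_El] * by simp
  then show False using assms reflect_eq_iff by simp
qed

lemma congr_Union:
  assumes ch: "subset.chain UNIV Z" "Z \<noteq> {}" and c: "\<And>R. R \<in> Z \<Longrightarrow> congr S (C, R)"
  shows "congr S (C, \<Union>Z)"
proof -
  have join: "\<exists>R\<in>Z. x \<in> R \<and> y \<in> R" if "x \<in> \<Union>Z" "y \<in> \<Union>Z" for x y
    using that ch unfolding subset.chain_def by blast
  show ?thesis
  proof
    fix A f g assume "(A, f, g) \<in> snd (C, \<Union>Z)"
    then obtain R where R: "R \<in> Z" "(A, f, g) \<in> R" by auto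
    then show "S \<turnstile> f \<Colon> fst (C, \<Union>Z) \<rightarrow> A \<and> S \<turnstile> g \<Colon> fst (C, \<Union>Z) \<rightarrow> A"
      using congr.R_typ[OF c[OF R(1)], of A f g] by simp
  next
    fix A f g assume a: "S \<turnstile> f \<Colon> fst (C, \<Union>Z) \<rightarrow> A" "S \<turnstile> g \<Colon> fst (C, \<Union>Z) \<rightarrow> A"
      "S \<turnstile> f \<approx> g \<Colon> fst (C, \<Union>Z) \<rightarrow> A"
    from ch(2) obtain R where R: "R \<in> Z" by auto
    then show "(A, f, g) \<in> snd (C, \<Union>Z)"
      using congr.R_deq[OF c[OF R(1)], of f A g] a by auto
  next
    fix A f g assume "(A, f, g) \<in> snd (C, \<Union>Z)"
    then obtain R where R: "R \<in> Z" "(A, f, g) \<in> R" by auto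
    then show "(A, g, f) \<in> snd (C, \<Union>Z)"
      using congr.R_sym[OF c[OF R(1)], of A f g] by auto
  next
    fix A f g h assume "(A, f, g) \<in> snd (C, \<Union>Z)" "(A, g, h) \<in> snd (C, \<Union>Z)"
    then obtain R where R: "R \<in> Z" "(A, f, g) \<in> R" "(A, g, h) \<in> R"
      using join[of "(A, f, g)" "(A, g, h)"] by auto
    then show "(A, f, h) \<in> snd (C, \<Union>Z)"
      using congr.R_trans[OF c[OF R(1)], of A f g h] by auto
  next
    fix A f g h B assume "(A, f, g) \<in> snd (C, \<Union>Z)" and h: "S \<turnstile> h \<Colon> A \<rightarrow> B"
    then obtain R where R: "R \<in> Z" "(A, f, g) \<in> R" by auto
    then show "(B, h \<odot> f, h \<odot> g) \<in> snd (C, \<Union>Z)"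
      using congr.R_cmp[OF c[OF R(1)] _ h, of f g] by auto
  next
    fix A f f' B g g' assume "(A, f, f') \<in> snd (C, \<Union>Z)" "(B, g, g') \<in> snd (C, \<Union>Z)"
    then obtain R where R: "R \<in> Z" "(A, f, f') \<in> R" "(B, g, g') \<in> R"
      using join[of "(A, f, f')" "(B, g, g')"] by auto
    then show "(Prod A B, Ind f g, Ind f' g') \<in> snd (C, \<Union>Z)"
      using congr.R_ind[OF c[OF R(1)], of A f f' B g g'] by auto
  qed
qed

text \<open>
  Zorn's lemma yields a congruence that is maximal among those separating a and b.
\<close>

lemma separating_model:
  assumes ab: "S \<turnstile> a \<Colon> C \<rightarrow> B" "S \<turnstile> b \<Colon> C \<rightarrow> B" "\<not> S \<turnstile> a \<approx> b \<Colon> C \<rightarrow> B"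
  shows "\<exists>R. model S (C, R) \<and> (B, a, b) \<notin> R"
proof -
  define F where "F = {R. congr S (C, R) \<and> (B, a, b) \<notin> R}"
  have "F \<noteq> {}" using congr_deq[of S C] ab unfolding F_def by blast
  moreover have "\<Union>Z \<in> F" if "Z \<noteq> {}" "subset.chain F Z" for Z
  proof -
    have "subset.chain UNIV Z" "\<forall>R\<in>Z. congr S (C, R) \<and> (B, a, b) \<notin> R"
      using that unfolding subset.chain_def F_def by blast+
    then show ?thesis using congr_Union[OF _ that(1)] unfolding F_def by blast
  qed
  ultimately obtain R where R: "R \<in> F" "\<And>X. X \<in> F \<Longrightarrow> R \<subseteq> X \<Longrightarrow> X = R"
    using subset_Zorn_nonempty[of F] by blast
  interpret congr S "(C, R)" using R F_def by simp
  have sep: "(B, a, b) \<notin> snd (C, R)" "trm B a" "trm B b" using R ab F_def by simp_all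
  have "model S (C, R)"
  proof
    fix n assume n: "n \<in> El (C, R) NatO"
    show "n = zr \<or> n = sc (ev (C, R) predm n)"
      by (rule maximal_two[OF sep _ n]) (use R in \<open>auto simp: F_def\<close>)
  qed (rule nontriv_if[OF sep])
  then show ?thesis using sep by auto
qed

theorem complete:
  assumes f: "S \<turnstile> f \<Colon> A \<rightarrow> B" and g: "S \<turnstile> g \<Colon> A \<rightarrow> B"
    and eq: "\<And>M v. model S M \<Longrightarrow> v \<in> El M A \<Longrightarrow> ev M f v = ev M g v"
  shows "S \<turnstile> f \<approx> g \<Colon> A \<rightarrow> B"
proof (rule ccontr)
  assume "\<not> S \<turnstile> f \<approx> g \<Colon> A \<rightarrow> B"
  then obtain R where R: "model S (A, R)" "(B, f, g) \<notin> R"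
    using separating_model[OF f g] by blast
  interpret model S "(A, R)" by fact
  have id: "trm A (Idm A)" by (simp add: mp_id)
  have "reflect (A, R) B (f \<odot> Idm A) = reflect (A, R) B (g \<odot> Idm A)"
    using eq[OF R(1) reflect_in_El[OF id]] ev_reflect[OF f id] ev_reflect[OF g id] by simp
  moreover have "reflect (A, R) B (f \<odot> Idm A) = reflect (A, R) B f" "reflect (A, R) B (g \<odot> Idm A) = reflect (A, R) B g"
    by (rule reflect_deq; use f g in \<open>auto intro: typing id_right\<close>)+
  ultimately have "(B, f, g) \<in> snd (A, R)" using reflect_eq_iff[of f B g] f g by simp
  then show False using R by simp
qed


section \<open>Truth values and induction\<close>

text \<open>Falsity is the number 0, and any other number counts as true.\<close>

abbreviation (in congr) "bv b \<equiv> (if b then sc zr else zr)"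

context model
begin

lemma nat_cases:
  assumes "n \<in> El M NatO"
  obtains "n = zr" | m where "m \<in> El M NatO" "n = sc m"
  using two[OF assms] ev_El[OF typ_predm assms] by blast

lemma ev_negm_zr: "ev M negm zr = sc zr"
  using Iter_zr[of "Zr \<odot> Bang NatO" NatO "sc zr"] by (simp add: negm_def trueT_def mp_cmp[OF mp_bang mp_zr])

lemma ev_negm_sc: "n \<in> El M NatO \<Longrightarrow> ev M negm (sc n) = zr"
  using Iter_sc[of "Zr \<odot> Bang NatO" NatO "sc zr" n] by (simp add: negm_def trueT_def mp_cmp[OF mp_bang mp_zr])

lemma sc_neq [simp]: "n \<in> El M NatO \<Longrightarrow> sc n \<noteq> zr"
  using ev_negm_zr ev_negm_sc[of n] nontriv by auto

lemma zr_neq [simp]: "n \<in> El M NatO \<Longrightarrow> zr \<noteq> sc n"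
  using sc_neq[of n] by metis

lemma bv_iff [simp]: "bv b = zr \<longleftrightarrow> \<not> b" "bv b = sc zr \<longleftrightarrow> b" "bv b = bv c \<longleftrightarrow> b = c"
  by simp_all

lemma bv_El [simp]: "bv b \<in> El M NatO"
  by simp

lemma pred_El [simp]: "n \<in> El M NatO \<Longrightarrow> ev M predm n \<in> El M NatO"
  by (rule ev_El[OF typ_predm])

lemma ad_El [simp]: "m \<in> El M NatO \<Longrightarrow> n \<in> El M NatO \<Longrightarrow> ev M addm (VP m n) \<in> El M NatO"
  by (rule ev_El[OF typ_addm]) simp

lemma sb_El [simp]: "m \<in> El M NatO \<Longrightarrow> n \<in> El M NatO \<Longrightarrow> ev M subm (VP m n) \<in> El M NatO"
  by (rule ev_El[OF typ_subm]) simp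

lemma ev_negm: "n \<in> El M NatO \<Longrightarrow> ev M negm n = bv (n = zr)"
  by (rule nat_cases) (auto simp: ev_negm_zr ev_negm_sc)

lemma ev_sgnm: "n \<in> El M NatO \<Longrightarrow> ev M sgnm n = bv (n \<noteq> zr)"
  by (simp add: sgnm_def ev_negm)

lemma ad_zr [simp]: "m \<in> El M NatO \<Longrightarrow> ev M addm (VP m zr) = m"
  by (simp add: addm_def Iter_zr[OF mp_sc])

lemma ad_sc [simp]: "m \<in> El M NatO \<Longrightarrow> n \<in> El M NatO \<Longrightarrow>
    ev M addm (VP m (sc n)) = sc (ev M addm (VP m n))"
  by (simp add: addm_def Iter_sc[OF mp_sc])

lemma sb_zr [simp]: "m \<in> El M NatO \<Longrightarrow> ev M subm (VP m zr) = m"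
  by (simp add: subm_def Iter_zr[OF typ_predm])

lemma sb_sc: "m \<in> El M NatO \<Longrightarrow> n \<in> El M NatO \<Longrightarrow>
    ev M subm (VP m (sc n)) = ev M predm (ev M subm (VP m n))"
  by (simp add: subm_def Iter_sc[OF typ_predm])

lemma ad_eq_zr: "m \<in> El M NatO \<Longrightarrow> n \<in> El M NatO \<Longrightarrow>
    ev M addm (VP m n) = zr \<longleftrightarrow> m = zr \<and> n = zr"
  by (rule nat_cases[of n]) auto

lemma ev_trueT [simp]: "ev M (trueT A) v = sc zr"
  by (simp add: trueT_def)

lemma ev_negT [simp]: "ev M p v \<in> El M NatO \<Longrightarrow> ev M (negT p) v = bv (ev M p v = zr)"
  by (simp add: negT_def ev_negm)

lemma ev_disjT [simp]: "ev M p v \<in> El M NatO \<Longrightarrow> ev M q v \<in> El M NatO \<Longrightarrow>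
    ev M (disjT p q) v = bv (ev M p v \<noteq> zr \<or> ev M q v \<noteq> zr)"
  by (simp add: disjT_def ev_sgnm ad_eq_zr)

lemma ev_conjT [simp]: "ev M p v \<in> El M NatO \<Longrightarrow> ev M q v \<in> El M NatO \<Longrightarrow>
    ev M (conjT p q) v = bv (ev M p v \<noteq> zr \<and> ev M q v \<noteq> zr)"
  by (simp add: conjT_def)

lemma ev_impT [simp]: "ev M p v \<in> El M NatO \<Longrightarrow> ev M q v \<in> El M NatO \<Longrightarrow>
    ev M (impT p q) v = bv (ev M p v \<noteq> zr \<longrightarrow> ev M q v \<noteq> zr)"
  by (auto simp: impT_def)

lemma ev_condT_if [simp]: "ev M p v \<in> El M NatO \<Longrightarrow> ev M x v \<in> El M B \<Longrightarrow> ev M y v \<in> El M B \<Longrightarrow>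
    ev M (condT B p x y) v = (if ev M p v \<noteq> zr then ev M x v else ev M y v)"
  unfolding ev_condT by (rule nat_cases[of "ev M p v"]) (auto simp: sel_zr sel_sc)

end

lemma model_congr: "model S M \<Longrightarrow> congr S M"
  by (rule model.axioms)

lemma iter_eq:
  assumes h: "S \<turnstile> h \<Colon> Prod A NatO \<rightarrow> B" and h': "S \<turnstile> h' \<Colon> Prod A NatO \<rightarrow> B"
    and g: "S \<turnstile> g \<Colon> B \<rightarrow> B"
    and z: "\<And>M a. model S M \<Longrightarrow> a \<in> El M A \<Longrightarrow> ev M h (VP a (ev M Zr VU)) = ev M h' (VP a (ev M Zr VU))"
    and s: "\<And>M a n. model S M \<Longrightarrow> a \<in> El M A \<Longrightarrow> n \<in> El M NatO \<Longrightarrow>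
      ev M h (VP a (ev M Sc n)) = ev M g (ev M h (VP a n))"
    and s': "\<And>M a n. model S M \<Longrightarrow> a \<in> El M A \<Longrightarrow> n \<in> El M NatO \<Longrightarrow>
      ev M h' (VP a (ev M Sc n)) = ev M g (ev M h' (VP a n))"
    and M: "model S M" "a \<in> El M A" "n \<in> El M NatO"
  shows "ev M h (VP a n) = ev M h' (VP a n)"
proof -
  have "S \<turnstile> h \<approx> h' \<Colon> Prod A NatO \<rightarrow> B"
  proof (rule iter_eq_deq[OF h h' g])
    show "S \<turnstile> h \<odot> Ind (Idm A) (Zr \<odot> Bang A) \<approx> h' \<odot> Ind (Idm A) (Zr \<odot> Bang A) \<Colon> A \<rightarrow> B"
      by (rule complete) (rule typing h h' | simp add: z)+
    show "S \<turnstile> h \<odot> Ind (Lp A NatO) (Sc \<odot> Rp A NatO) \<approx> g \<odot> h \<Colon> Prod A NatO \<rightarrow> B"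
      by (rule complete) (rule typing h h' g | auto elim!: prod_elim[OF _ _ model_congr] simp: s)+
    show "S \<turnstile> h' \<odot> Ind (Lp A NatO) (Sc \<odot> Rp A NatO) \<approx> g \<odot> h' \<Colon> Prod A NatO \<rightarrow> B"
      by (rule complete) (rule typing h h' g | auto elim!: prod_elim[OF _ _ model_congr] simp: s')+
  qed
  from congr.sound[OF model_congr[OF M(1)] this h h', of "VP a n"] show ?thesis
    using M by (simp add: congr.VP_El[OF model_congr])
qed

text \<open>
  The truth value \<open>sgn(p(a, n))\<close> and the constant 1 are both iterates, carried along with \<open>(a, n)\<close>, of
  the same step "keep 1; otherwise take \<open>sgn(p(a, n + 1))\<close>": the inductive step is what makes this true
  of p.  Uniqueness of the iterated map identifies them.
\<close>

lemma global_induct: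
  assumes p: "S \<turnstile> p \<Colon> Prod A NatO \<rightarrow> NatO"
    and z: "\<And>M a. model S M \<Longrightarrow> a \<in> El M A \<Longrightarrow> ev M p (VP a (ev M Zr VU)) \<noteq> ev M Zr VU"
    and s: "\<And>M a n. model S M \<Longrightarrow> a \<in> El M A \<Longrightarrow> n \<in> El M NatO \<Longrightarrow>
      ev M p (VP a n) \<noteq> ev M Zr VU \<Longrightarrow> ev M p (VP a (ev M Sc n)) \<noteq> ev M Zr VU"
    and M: "model S M" "a \<in> El M A" "n \<in> El M NatO"
  shows "ev M p (VP a n) \<noteq> ev M Zr VU"
proof -
  let ?P = "Prod A NatO"
  let ?n = "Ind (Lp A NatO \<odot> Lp ?P NatO) (Sc \<odot> Rp A NatO \<odot> Lp ?P NatO)"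
  let ?g = "Ind ?n (condT NatO (Rp ?P NatO) (trueT (Prod ?P NatO)) (sgnm \<odot> p \<odot> ?n))"
  have t: "S \<turnstile> Ind (Idm ?P) (sgnm \<odot> p) \<Colon> ?P \<rightarrow> Prod ?P NatO"
    "S \<turnstile> Ind (Idm ?P) (trueT ?P) \<Colon> ?P \<rightarrow> Prod ?P NatO" 
    "S \<turnstile> ?g \<Colon> Prod ?P NatO \<rightarrow> Prod ?P NatO"
    by (rule typing p)+
  have "ev M (Ind (Idm ?P) (sgnm \<odot> p)) (VP a n) = ev M (Ind (Idm ?P) (trueT ?P)) (VP a n)"
  proof (rule iter_eq[OF t _ _ _ M])
    fix M a assume M: "model S M" and a: "a \<in> El M A"
    interpret model S M by fact
    have pE: "ev M p (VP b m) \<in> El M NatO" if "b \<in> El M A" "m \<in> El M NatO" for b m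
      by (rule ev_El[OF p]) (use that in simp)
    show "ev M (Ind (Idm ?P) (sgnm \<odot> p)) (VP a zr) = ev M (Ind (Idm ?P) (trueT ?P)) (VP a zr)"
      using z[OF M a] by (simp add: ev_sgnm pE a)
    fix n assume n: "n \<in> El M NatO"
    show "ev M (Ind (Idm ?P) (sgnm \<odot> p)) (VP a (sc n)) = ev M ?g (ev M (Ind (Idm ?P) (sgnm \<odot> p)) (VP a n))"
      using s[OF M a n] by (simp add: ev_sgnm pE a n)
    show "ev M (Ind (Idm ?P) (trueT ?P)) (VP a (sc n)) = ev M ?g (ev M (Ind (Idm ?P) (trueT ?P)) (VP a n))"
      by (simp add: ev_sgnm pE a n)
  qed
  moreover interpret model S M by fact
  have "ev M p (VP a n) \<in> El M NatO" by (rule ev_El[OF p]) (use M in simp)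
  ultimately show ?thesis by (auto simp: ev_sgnm)
qed

text \<open>
  For induction inside a single model, where the inductive step is known for the elements of that model
  only, a failing n has to yield an element at which p switches from true to false.  The last such
  switch below n is computed by iteration.
\<close>

lemma last_switch:
  assumes p: "S \<turnstile> p \<Colon> Prod A NatO \<rightarrow> NatO"
  obtains b where "S \<turnstile> b \<Colon> Prod A NatO \<rightarrow> NatO"
    "\<And>M a n. model S M \<Longrightarrow> a \<in> El M A \<Longrightarrow> n \<in> El M NatO \<Longrightarrow> ev M b (VP a (ev M Sc n)) =
      (if ev M p (VP a n) \<noteq> ev M Zr VU \<and> ev M p (VP a (ev M Sc n)) = ev M Zr VU then n else ev M b (VP a n))"
proof -
  let ?P = "Prod A NatO"
  let ?n = "Ind (Lp A NatO \<odot> Lp ?P NatO) (Sc \<odot> Rp A NatO \<odot> Lp ?P NatO)"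
  let ?g = "Ind ?n (condT NatO (conjT (p \<odot> Lp ?P NatO) (negT (p \<odot> ?n))) (Rp A NatO \<odot> Lp ?P NatO) (Rp ?P NatO))"
  let ?z = "Zr \<odot> Bang ?P"
  let ?W = "Iter ?g \<odot> Ind (Ind (Ind (Lp A NatO) ?z) ?z) (Rp A NatO)"
  let ?s = "Ind (Lp A NatO) (Sc \<odot> Rp A NatO)"
  have g: "S \<turnstile> ?g \<Colon> Prod ?P NatO \<rightarrow> Prod ?P NatO" by (rule typing p)+
  have t: "S \<turnstile> Lp ?P NatO \<odot> ?W \<Colon> ?P \<rightarrow> ?P" "S \<turnstile> Idm ?P \<Colon> ?P \<rightarrow> ?P" "S \<turnstile> ?s \<Colon> ?P \<rightarrow> ?P"
    by (rule typing p)+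
  have fst_W: "ev M (Lp ?P NatO \<odot> ?W) (VP a n) = ev M (Idm ?P) (VP a n)"
    if "model S M" "a \<in> El M A" "n \<in> El M NatO" for M a n
  proof (rule iter_eq[OF t _ _ _ that])
    fix M a assume M: "model S M" and a: "a \<in> El M A"
    interpret model S M by fact
    show "ev M (Lp ?P NatO \<odot> ?W) (VP a zr) = ev M (Idm ?P) (VP a zr)"
      by (simp add: Iter_zr[OF g] a)
    fix n assume n: "n \<in> El M NatO"
    show "ev M (Lp ?P NatO \<odot> ?W) (VP a (sc n)) = ev M ?s (ev M (Lp ?P NatO \<odot> ?W) (VP a n))"
      by (simp add: Iter_sc[OF g] a n)
    show "ev M (Idm ?P) (VP a (sc n)) = ev M ?s (ev M (Idm ?P) (VP a n))"
      by simp
  qed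
  show thesis
  proof (rule that)
    show "S \<turnstile> Rp ?P NatO \<odot> ?W \<Colon> ?P \<rightarrow> NatO" by (rule typing p)+
    fix M a n assume M: "model S M" and a: "a \<in> El M A" and n: "n \<in> El M NatO"
    interpret model S M by fact
    have pE: "ev M p (VP b m) \<in> El M NatO" if "b \<in> El M A" "m \<in> El M NatO" for b m
      by (rule ev_El[OF p]) (use that in simp)
    define w where "w = ev M (Iter ?g) (VP (VP (VP a zr) zr) n)"
    have w: "w \<in> El M (Prod ?P NatO)" unfolding w_def by (rule Iter_El[OF g]) (simp_all add: a n)
    have fw: "vfst w = VP a n"
      using fst_W[OF M a n] unfolding w_def by simp
    have sw: "vsnd w \<in> El M NatO" using w by simp
    show "ev M (Rp ?P NatO \<odot> ?W) (VP a (sc n)) =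
      (if ev M p (VP a n) \<noteq> zr \<and> ev M p (VP a (sc n)) = zr then n
       else ev M (Rp ?P NatO \<odot> ?W) (VP a n))"
      by (simp add: Iter_sc[OF g] a n fw sw pE flip: w_def)
  qed
qed

text \<open>
  That \<open>last_switch\<close> finds a switch whenever p holds at 0 and fails at n is provable by global
  induction; in the given model such a switch contradicts the inductive step.
\<close>

lemma (in model) local_induct:
  assumes p: "S \<turnstile> p \<Colon> Prod A NatO \<rightarrow> NatO" and a: "a \<in> El M A"
    and z: "ev M p (VP a zr) \<noteq> zr"
    and s: "\<And>n. n \<in> El M NatO \<Longrightarrow> ev M p (VP a n) \<noteq> zr \<Longrightarrow> ev M p (VP a (sc n)) \<noteq> zr"
    and n: "n \<in> El M NatO"
  shows "ev M p (VP a n) \<noteq> zr"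
proof -
  obtain b where b: "S \<turnstile> b \<Colon> Prod A NatO \<rightarrow> NatO"
    "\<And>M a n. model S M \<Longrightarrow> a \<in> El M A \<Longrightarrow> n \<in> El M NatO \<Longrightarrow> ev M b (VP a (ev M Sc n)) =
      (if ev M p (VP a n) \<noteq> ev M Zr VU \<and> ev M p (VP a (ev M Sc n)) = ev M Zr VU then n else ev M b (VP a n))"
    using last_switch[OF p] by blast
  let ?P = "Prod A NatO"
  let ?K = "impT (conjT (p \<odot> Ind (Lp A NatO) (Zr \<odot> Bang ?P)) (negT p))
     (conjT (p \<odot> Ind (Lp A NatO) b) (negT (p \<odot> Ind (Lp A NatO) (Sc \<odot> b))))"
  have K: "S \<turnstile> ?K \<Colon> ?P \<rightarrow> NatO" by (rule typing p b)+
  have "ev M ?K (VP a n) \<noteq> zr"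
  proof (rule global_induct[OF K _ _ model_axioms a n])
    fix M a assume M: "model S M" and a: "a \<in> El M A"
    interpret N: model S M by fact
    have pE: "ev M p (VP b m) \<in> El M NatO" if "b \<in> El M A" "m \<in> El M NatO" for b m
      by (rule N.ev_El[OF p]) (use that in simp)
    have bE: "ev M b (VP a m) \<in> El M NatO" if "m \<in> El M NatO" for m
      by (rule N.ev_El[OF b(1)]) (use that a in simp)
    show "ev M ?K (VP a N.zr) \<noteq> N.zr"
      by (simp add: a pE bE)
    fix n assume n: "n \<in> El M NatO" and "ev M ?K (VP a n) \<noteq> N.zr"
    then show "ev M ?K (VP a (N.sc n)) \<noteq> N.zr"
      by (auto simp add: a n pE bE b(2)[OF M] split: if_splits)
  qed
  moreover have pE: "ev M p (VP b m) \<in> El M NatO" if "b \<in> El M A" "m \<in> El M NatO" for b m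
    by (rule ev_El[OF p]) (use that in simp)
  moreover have bE: "ev M b (VP a n) \<in> El M NatO"
    by (rule ev_El[OF b(1)]) (use n a in simp)
  ultimately show ?thesis
    using s[OF bE] z by (auto simp: a n split: if_splits)
qed

context model
begin

text \<open>Induction applies to predicates given by a term with a parameter in the model.  The closure rules
  produce these terms, so that inductions can be stated in the metalogic.\<close>

definition definable_fun :: "obj \<Rightarrow> (val \<Rightarrow> val) \<Rightarrow> bool" where
  "definable_fun B F \<longleftrightarrow> (\<exists>A f a. S \<turnstile> f \<Colon> Prod A NatO \<rightarrow> B \<and> a \<in> El M A \<and>
     (\<forall>n\<in>El M NatO. F n = ev M f (VP a n)))"

definition definable_pred :: "(val \<Rightarrow> bool) \<Rightarrow> bool" where
  "definable_pred P \<longleftrightarrow> (\<exists>F. definable_fun NatO F \<and> (\<forall>n\<in>El M NatO. P n \<longleftrightarrow> F n \<noteq> zr))"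

lemma df_const: "c \<in> El M B \<Longrightarrow> definable_fun B (\<lambda>n. c)"
  unfolding definable_fun_def by (rule exI[of _ B], rule exI[of _ "Lp B NatO"], rule exI[of _ c]) (simp add: mp_lp mp_rp)

lemma df_id: "definable_fun NatO (\<lambda>n. n)"
  unfolding definable_fun_def by (rule exI[of _ One], rule exI[of _ "Rp One NatO"], rule exI[of _ VU]) (simp add: mp_lp mp_rp)

lemma df_ev:
  assumes "S \<turnstile> g \<Colon> B \<rightarrow> D" "definable_fun B F"
  shows "definable_fun D (\<lambda>n. ev M g (F n))"
proof -
  obtain A f a where f: "S \<turnstile> f \<Colon> Prod A NatO \<rightarrow> B" "a \<in> El M A"
    "\<forall>n\<in>El M NatO. F n = ev M f (VP a n)" using assms unfolding definable_fun_def by blast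
  have "S \<turnstile> g \<odot> f \<Colon> Prod A NatO \<rightarrow> D" using f assms by (auto intro: typing)
  then show ?thesis unfolding definable_fun_def using f by fastforce
qed

lemma df_VP:
  assumes "definable_fun B F" "definable_fun D G"
  shows "definable_fun (Prod B D) (\<lambda>n. VP (F n) (G n))"
proof -
  obtain A f a where f: "S \<turnstile> f \<Colon> Prod A NatO \<rightarrow> B" "a \<in> El M A"
    "\<forall>n\<in>El M NatO. F n = ev M f (VP a n)" using assms unfolding definable_fun_def by blast
  obtain A' f' a' where f': "S \<turnstile> f' \<Colon> Prod A' NatO \<rightarrow> D" "a' \<in> El M A'"
    "\<forall>n\<in>El M NatO. G n = ev M f' (VP a' n)" using assms unfolding definable_fun_def by blast
  let ?A = "Prod A A'"
  let ?h = "Ind (f \<odot> Ind (Lp A A' \<odot> Lp ?A NatO) (Rp ?A NatO)) (f' \<odot> Ind (Rp A A' \<odot> Lp ?A NatO) (Rp ?A NatO))"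
  have h: "S \<turnstile> ?h \<Colon> Prod ?A NatO \<rightarrow> Prod B D" by (rule typing f f')+
  show ?thesis
    unfolding definable_fun_def
    by (rule exI[of _ ?A], rule exI[of _ ?h], rule exI[of _ "VP a a'"]) (use h f f' in simp)
qed

lemma df_El: "definable_fun B F \<Longrightarrow> n \<in> El M NatO \<Longrightarrow> F n \<in> El M B"
  unfolding definable_fun_def using ev_El by fastforce

lemma dp_tt: "definable_fun NatO F \<Longrightarrow> definable_pred (\<lambda>n. F n \<noteq> zr)"
  unfolding definable_pred_def by blast

lemma dp_not:
  assumes "definable_pred P" shows "definable_pred (\<lambda>n. \<not> P n)"
proof -
  obtain F where F: "definable_fun NatO F" "\<forall>n\<in>El M NatO. P n \<longleftrightarrow> F n \<noteq> zr" using assms definable_pred_def by blast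
  show ?thesis unfolding definable_pred_def
    by (rule exI[of _ "\<lambda>n. ev M negm (F n)"]) (use F df_ev[OF typ_negm] in \<open>auto simp: ev_negm df_El\<close>)
qed

lemma dp_zr: "definable_fun NatO F \<Longrightarrow> definable_pred (\<lambda>n. F n = zr)"
  using dp_not[OF dp_tt, of F] by simp

lemma dp_disj:
  assumes "definable_pred P" "definable_pred Q" shows "definable_pred (\<lambda>n. P n \<or> Q n)"
proof -
  obtain F where F: "definable_fun NatO F" "\<forall>n\<in>El M NatO. P n \<longleftrightarrow> F n \<noteq> zr" using assms definable_pred_def by blast
  obtain G where G: "definable_fun NatO G" "\<forall>n\<in>El M NatO. Q n \<longleftrightarrow> G n \<noteq> zr" using assms definable_pred_def by blast
  show ?thesis unfolding definable_pred_def
    by (rule exI[of _ "\<lambda>n. ev M addm (VP (F n) (G n))"])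
      (use F G df_ev[OF typ_addm df_VP] in \<open>auto simp: ad_eq_zr df_El\<close>)
qed

lemma dp_imp: assumes "definable_pred P" "definable_pred Q" shows "definable_pred (\<lambda>n. P n \<longrightarrow> Q n)"
  unfolding imp_conv_disj by (rule dp_disj[OF dp_not]; fact)

lemma nat_induct [consumes 2, case_names zr sc]:
  assumes n: "n \<in> El M NatO" and P: "definable_pred P" and z: "P zr"
    and s: "\<And>n. n \<in> El M NatO \<Longrightarrow> P n \<Longrightarrow> P (sc n)"
  shows "P n"
proof -
  obtain F where F: "definable_fun NatO F" "\<forall>n\<in>El M NatO. P n \<longleftrightarrow> F n \<noteq> zr"
    using P unfolding definable_pred_def by (elim exE conjE)
  obtain A f a where f: "S \<turnstile> f \<Colon> Prod A NatO \<rightarrow> NatO" "a \<in> El M A"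
    "\<forall>n\<in>El M NatO. F n = ev M f (VP a n)" using F(1) unfolding definable_fun_def by (elim exE conjE)
  have Pf: "P n \<longleftrightarrow> ev M f (VP a n) \<noteq> zr" if "n \<in> El M NatO" for n
    using bspec[OF F(2) that] bspec[OF f(3) that] by simp
  have "ev M f (VP a n) \<noteq> zr"
  proof (rule local_induct[OF f(1,2) _ _ n])
    show "ev M f (VP a zr) \<noteq> zr" using z Pf[OF zr_El] by blast
    fix n assume n: "n \<in> El M NatO" and "ev M f (VP a n) \<noteq> zr"
    then have "P (sc n)" using Pf[OF n] s by blast
    then show "ev M f (VP a (sc n)) \<noteq> zr" using Pf[OF sc_El[OF n]] by blast
  qed
  then show ?thesis using Pf[OF n] by blast
qed

end


section \<open>Arithmetic\<close>

context model
begin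

lemma nonzero_sc:
  assumes "n \<in> El M NatO" "n \<noteq> zr"
  obtains m where "n = sc m" "m \<in> El M NatO"
  using nat_cases[OF assms(1)] assms(2) that by metis

lemma zr_sb [simp]: "y \<in> El M NatO \<Longrightarrow> ev M subm (VP zr y) = zr"
proof (rule nat_induct[of y "\<lambda>y. ev M subm (VP zr y) = zr"])
  show "definable_pred (\<lambda>y. ev M subm (VP zr y) = zr)"
    by (rule dp_zr df_id df_const df_ev[OF typ_subm] df_VP zr_El)+
qed (simp_all add: sb_sc pred_zr)

lemma sb_sc_sc [simp]:
  assumes "x \<in> El M NatO" "y \<in> El M NatO"
  shows "ev M subm (VP (sc x) (sc y)) = ev M subm (VP x y)"
proof -
  have t: "S \<turnstile> subm \<odot> Ind (Sc \<odot> Lp NatO NatO) (Sc \<odot> Rp NatO NatO) \<Colon> Prod NatO NatO \<rightarrow> NatO"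
    by (rule typing)+
  have "ev M (subm \<odot> Ind (Sc \<odot> Lp NatO NatO) (Sc \<odot> Rp NatO NatO)) (VP x y) = ev M subm (VP x y)"
    by (rule iter_eq[OF t typ_subm typ_predm _ _ _ model_axioms assms])
      (simp_all add: model.sb_sc model.sb_zr congr.pred_sc[OF model_congr] congr.sc_El[OF model_congr] congr.zr_El[OF model_congr])
  then show ?thesis by simp
qed

lemma zr_ad [simp]:
  assumes "y \<in> El M NatO"
  shows "ev M addm (VP zr y) = y"
proof -
  have t: "S \<turnstile> addm \<odot> Ind (Zr \<odot> Lp One NatO) (Rp One NatO) \<Colon> Prod One NatO \<rightarrow> NatO"
    by (rule typing)+
  have "ev M (addm \<odot> Ind (Zr \<odot> Lp One NatO) (Rp One NatO)) (VP VU y) = ev M (Rp One NatO) (VP VU y)"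
    by (rule iter_eq[OF t mp_rp mp_sc _ _ _ model_axioms VU_El assms])
      (auto simp: model.ad_sc model.ad_zr congr.zr_El[OF model_congr]
          dest!: congr.El_One[OF model_congr, rotated])
  then show ?thesis by simp
qed

lemma sc_ad [simp]:
  assumes "x \<in> El M NatO" "y \<in> El M NatO"
  shows "ev M addm (VP (sc x) y) = sc (ev M addm (VP x y))"
proof -
  have t: "S \<turnstile> addm \<odot> Ind (Sc \<odot> Lp NatO NatO) (Rp NatO NatO) \<Colon> Prod NatO NatO \<rightarrow> NatO"
    "S \<turnstile> Sc \<odot> addm \<Colon> Prod NatO NatO \<rightarrow> NatO"
    by (rule typing)+
  have "ev M (addm \<odot> Ind (Sc \<odot> Lp NatO NatO) (Rp NatO NatO)) (VP x y) = ev M (Sc \<odot> addm) (VP x y)"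
    by (rule iter_eq[OF t mp_sc _ _ _ model_axioms assms])
      (simp_all add: model.ad_sc model.ad_zr congr.sc_El[OF model_congr])
  then show ?thesis by simp
qed

lemma sb_self [simp]: "x \<in> El M NatO \<Longrightarrow> ev M subm (VP x x) = zr"
proof (rule nat_induct[of x "\<lambda>x. ev M subm (VP x x) = zr"])
  show "definable_pred (\<lambda>x. ev M subm (VP x x) = zr)"
    by (rule dp_zr df_id df_const df_ev[OF typ_subm] df_VP zr_El)+
qed simp_all

lemma sb_sc_self: "x \<in> El M NatO \<Longrightarrow> ev M subm (VP (sc x) x) \<noteq> zr"
proof (rule nat_induct[of x "\<lambda>x. ev M subm (VP (sc x) x) \<noteq> zr"])
  show "definable_pred (\<lambda>x. ev M subm (VP (sc x) x) \<noteq> zr)"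
    by (rule dp_tt df_id df_const df_ev[OF typ_subm] df_ev[OF mp_sc] df_VP zr_El)+
qed simp_all

end

text \<open>
  The recursion determines F along diagonals, but a step changes both arguments, which is not an
  iteration.  It becomes one with \<open>(c, k)\<close> as a parameter: \<open>F(x, c - (k - x))\<close>, as a function of x up to
  k, reaches \<open>F(k, c)\<close> at x = k, and increasing x moves the second argument along.  The guard in the
  proof, "x = 0 or k exceeds the predecessor of x", expresses that x is at most k without using
  properties of the order, which are derived from this lemma.
\<close>

lemma diagonal_unique:
  assumes F: "S \<turnstile> F \<Colon> Prod NatO NatO \<rightarrow> NatO" and G: "S \<turnstile> G \<Colon> Prod NatO NatO \<rightarrow> NatO"
    and rec: "\<And>M x y H. model S M \<Longrightarrow> x \<in> El M NatO \<Longrightarrow> y \<in> El M NatO \<Longrightarrow> H \<in> {F, G} \<Longrightarrow>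
      ev M H (VP (ev M Zr VU) y) = y \<and> ev M H (VP (ev M Sc x) (ev M Zr VU)) = ev M Sc x \<and>
      ev M H (VP (ev M Sc x) (ev M Sc y)) = ev M Sc (ev M H (VP x y))"
    and M: "model S M" and k: "k \<in> El M NatO" and c: "c \<in> El M NatO"
  shows "ev M F (VP k c) = ev M G (VP k c)"
proof -
  let ?A = "Prod NatO NatO"
  let ?P = "Prod ?A NatO"
  let ?c = "Lp NatO NatO \<odot> Lp ?A NatO"
  let ?k = "Rp NatO NatO \<odot> Lp ?A NatO"
  let ?x = "Rp ?A NatO"
  let ?z = "Zr \<odot> Bang ?P"
  let ?Q = "disjT (negT ?x) (subm \<odot> Ind ?k (predm \<odot> ?x))"
  let ?K = "\<lambda>H. Ind (Idm ?P) (condT NatO ?Q (H \<odot> Ind ?x (subm \<odot> Ind ?c (subm \<odot> Ind ?k ?x))) ?z)"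
  let ?L = "Lp ?P NatO"
  let ?d = "subm \<odot> Ind ?k ?x"
  let ?g = "Ind (Ind (Lp ?A NatO \<odot> ?L) (Sc \<odot> ?x \<odot> ?L))
    (condT NatO (?d \<odot> ?L)
      (condT NatO (subm \<odot> Ind (?c \<odot> ?L) (predm \<odot> ?d \<odot> ?L)) (Sc \<odot> Rp ?P NatO) (Sc \<odot> ?x \<odot> ?L))
      (?z \<odot> ?L))"
  have t: "S \<turnstile> ?K F \<Colon> ?P \<rightarrow> Prod ?P NatO" "S \<turnstile> ?K G \<Colon> ?P \<rightarrow> Prod ?P NatO"
    "S \<turnstile> ?g \<Colon> Prod ?P NatO \<rightarrow> Prod ?P NatO"
    by (rule typing F G)+
  have step: "ev M (?K H) (VP a (ev M Sc x)) = ev M ?g (ev M (?K H) (VP a x))"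
    if M: "model S M" and a: "a \<in> El M ?A" and x: "x \<in> El M NatO" and H: "H \<in> {F, G}" for M a x H
  proof -
    interpret model S M by fact
    from a obtain c k where a: "a = VP c k" and c: "c \<in> El M NatO" and k: "k \<in> El M NatO"
      by (rule El_ProdE)
    have HE: "ev M H (VP u v) \<in> El M NatO" if "u \<in> El M NatO" "v \<in> El M NatO" for u v
      using H ev_El[OF F, of "VP u v"] ev_El[OF G, of "VP u v"] that by auto
    define d where "d = ev M subm (VP k x)"
    have d: "d \<in> El M NatO" using k x by (simp add: d_def)
    define y where "y = ev M subm (VP c (ev M predm d))"
    have y: "y \<in> El M NatO" using c d by (simp add: y_def)
    have "ev M H (VP (sc x) y) = (if y \<noteq> zr then
      sc (if x = zr \<or> ev M subm (VP k (ev M predm x)) \<noteq> zr then ev M H (VP x (ev M subm (VP c d))) else zr)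
      else sc x)" if nz: "d \<noteq> zr"
    proof (cases "y = zr")
      case True
      then show ?thesis using rec[OF M x zr_El H] by simp
    next
      case False
      then obtain w where w: "y = sc w" "w \<in> El M NatO" using nonzero_sc[OF y] by metis
      obtain u where u: "d = sc u" "u \<in> El M NatO" using nonzero_sc[OF d nz] by metis
      have "ev M subm (VP c d) = w"
        using c u w by (simp add: sb_sc y_def pred_sc)
      moreover have "x = zr \<or> ev M subm (VP k (ev M predm x)) \<noteq> zr"
      proof (rule nat_cases[OF x])
        fix t assume t: "t \<in> El M NatO" "x = sc t"
        then have "d = ev M predm (ev M subm (VP k t))" using k by (simp add: d_def sb_sc)
        then show ?thesis using nz t pred_zr by (auto simp: pred_sc)
      qed simp
      ultimately show ?thesis using rec[OF M x w(2) H] w by simp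
    qed
    then show ?thesis
      using c k x d y by (simp add: a HE sb_sc pred_sc flip: d_def y_def)
  qed
  interpret model S M by fact
  have HE: "ev M H (VP u v) \<in> El M NatO" if "u \<in> El M NatO" "v \<in> El M NatO" "H \<in> {F, G}" for u v H
    using ev_El[OF F, of "VP u v"] ev_El[OF G, of "VP u v"] that by auto
  have "ev M (?K F) (VP (VP c k) k) = ev M (?K G) (VP (VP c k) k)"
  proof (rule iter_eq[OF t _ step step M _ k])
    fix M a assume M: "model S M" and a: "a \<in> El M ?A"
    interpret N: model S M by fact
    from a obtain c k where a: "a = VP c k" and c: "c \<in> El M NatO" and k: "k \<in> El M NatO"
      by (rule N.El_ProdE)
    show "ev M (?K F) (VP a N.zr) = ev M (?K G) (VP a N.zr)"
      using rec[OF M N.zr_El, of "ev M subm (VP c k)" F] rec[OF M N.zr_El, of "ev M subm (VP c k)" G] c k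
      by (simp add: a)
  qed (use k c in simp_all)
  moreover have "k = zr \<or> ev M subm (VP k (ev M predm k)) \<noteq> zr"
    by (rule nat_cases[OF k]) (auto simp: pred_sc sb_sc_self)
  ultimately show ?thesis
    using k c by (simp add: HE)
qed

context model
begin

abbreviation "le x y \<equiv> ev M subm (VP x y) = zr"

text \<open>
  Both sides are the maximum of x and y, by its diagonal recursion.  Antisymmetry of the order follows,
  and with it soundness of the equality predicate.
\<close>

lemma max_comm:
  assumes "x \<in> El M NatO" "y \<in> El M NatO"
  shows "ev M addm (VP x (ev M subm (VP y x))) = ev M addm (VP y (ev M subm (VP x y)))"
proof -
  let ?F = "addm \<odot> Ind (Lp NatO NatO) (subm \<odot> Ind (Rp NatO NatO) (Lp NatO NatO))"
  let ?G = "addm \<odot> Ind (Rp NatO NatO) (subm \<odot> Ind (Lp NatO NatO) (Rp NatO NatO))"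
  have t: "S \<turnstile> ?F \<Colon> Prod NatO NatO \<rightarrow> NatO" "S \<turnstile> ?G \<Colon> Prod NatO NatO \<rightarrow> NatO"
    by (rule typing)+
  have "ev M ?F (VP x y) = ev M ?G (VP x y)"
  proof (rule diagonal_unique[OF t _ model_axioms assms])
    fix M x y H assume M: "model S M" and x: "x \<in> El M NatO" and y: "y \<in> El M NatO" and H: "H \<in> {?F, ?G}"
    interpret N: model S M by fact
    show "ev M H (VP N.zr y) = y \<and> ev M H (VP (N.sc x) N.zr) = N.sc x \<and>
        ev M H (VP (N.sc x) (N.sc y)) = N.sc (ev M H (VP x y))"
      using H x y by auto
  qed
  then show ?thesis by simp
qed

lemma le_add: "x \<in> El M NatO \<Longrightarrow> y \<in> El M NatO \<Longrightarrow> le x y \<Longrightarrow> ev M addm (VP x (ev M subm (VP y x))) = y"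
  using max_comm[of x y] by simp

lemma le_antisym: "x \<in> El M NatO \<Longrightarrow> y \<in> El M NatO \<Longrightarrow> le x y \<Longrightarrow> le y x \<Longrightarrow> x = y"
  using max_comm[of x y] by simp

lemma ev_leT [simp]: "ev M f v \<in> El M NatO \<Longrightarrow> ev M g v \<in> El M NatO \<Longrightarrow>
    ev M (leT f g) v = bv (le (ev M f v) (ev M g v))"
  by (simp add: leT_def)

lemma ev_eqp [simp]: "x \<in> El M A \<Longrightarrow> y \<in> El M A \<Longrightarrow> ev M (eqp A) (VP x y) = bv (x = y)"
proof (induction A arbitrary: x y)
  case One
  then show ?case using El_One by auto
next
  case NatO
  then show ?case using le_antisym by auto
next
  case (Prod A B)
  then show ?case by (auto simp: Let_def elim!: El_ProdE)
qed

lemma ev_eqT [simp]: "ev M f v \<in> El M A \<Longrightarrow> ev M g v \<in> El M A \<Longrightarrow>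
    ev M (eqT A f g) v = bv (ev M f v = ev M g v)"
  by (simp add: eqT_def)

lemma dp_eq:
  assumes "definable_fun A F" "definable_fun A G" shows "definable_pred (\<lambda>n. F n = G n)"
  unfolding definable_pred_def
  by (rule exI[of _ "\<lambda>n. ev M (eqp A) (VP (F n) (G n))"])
    (use assms df_ev[OF typ_eqp df_VP] in \<open>auto simp: df_El\<close>)

lemma add_sb [simp]:
  assumes "x \<in> El M NatO" "z \<in> El M NatO"
  shows "ev M subm (VP (ev M addm (VP x z)) x) = z"
proof (rule nat_induct[of x "\<lambda>x. ev M subm (VP (ev M addm (VP x z)) x) = z"])
  show "definable_pred (\<lambda>x. ev M subm (VP (ev M addm (VP x z)) x) = z)"
    by (rule dp_eq[of NatO] df_id df_const df_ev[OF typ_subm] df_ev[OF typ_addm] df_VP assms)+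
qed (use assms in simp_all)

lemma le_add_right [simp]:
  assumes "x \<in> El M NatO" "z \<in> El M NatO"
  shows "le x (ev M addm (VP x z))"
proof (rule nat_induct[of x "\<lambda>x. le x (ev M addm (VP x z))"])
  show "definable_pred (\<lambda>x. le x (ev M addm (VP x z)))"
    by (rule dp_zr df_id df_const df_ev[OF typ_subm] df_ev[OF typ_addm] df_VP assms)+
qed (use assms in simp_all)

lemma le_neq_sc:
  assumes "x \<in> El M NatO" "y \<in> El M NatO" "le x y" "x \<noteq> y"
  shows "le (sc x) y"
proof -
  have y: "ev M addm (VP x (ev M subm (VP y x))) = y" using le_add assms by blast
  have "ev M subm (VP y x) \<noteq> zr" using le_antisym assms by blast
  then obtain u where u: "ev M subm (VP y x) = sc u" "u \<in> El M NatO"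
    using assms nonzero_sc[OF sb_El] by metis
  then have "ev M addm (VP (sc x) u) = y" using y assms by simp
  then show ?thesis using le_add_right[of "sc x" u] u assms by (simp del: sc_ad)
qed

lemma sc_le:
  assumes "x \<in> El M NatO" "y \<in> El M NatO" "le (sc x) y"
  shows "le x y" "ev M subm (VP y x) \<noteq> zr"
proof -
  define z where "z = ev M subm (VP y (sc x))"
  have z: "z \<in> El M NatO" using assms by (simp add: z_def)
  have y: "ev M addm (VP x (sc z)) = y" using le_add[of "sc x" y] assms z by (simp flip: z_def)
  show "le x y" "ev M subm (VP y x) \<noteq> zr"
    using le_add_right[of x "sc z"] add_sb[of x "sc z"] assms z by (simp_all only: y sc_El sc_neq not_False_eq_True)
qed

section \<open>The bounded minimum\<close>

lemma ev_bmin: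
  assumes \<phi>: "S \<turnstile> \<phi> \<Colon> Prod A NatO \<rightarrow> NatO" and a: "a \<in> El M A"
  shows "ev M (bmin A \<phi>) (VP a zr) = zr"
    and "n \<in> El M NatO \<Longrightarrow> ev M (bmin A \<phi>) (VP a n) \<in> El M NatO"
    and "n \<in> El M NatO \<Longrightarrow> ev M (bmin A \<phi>) (VP a (sc n)) =
      (if ev M \<phi> (VP a (ev M (bmin A \<phi>) (VP a n))) \<noteq> zr then ev M (bmin A \<phi>) (VP a n)
       else sc (ev M (bmin A \<phi>) (VP a n)))"
    and "definable_fun NatO (\<lambda>n. ev M (bmin A \<phi>) (VP a n))"
proof -
  let ?g = "Ind (Lp A NatO) (condT NatO \<phi> (Rp A NatO) (Sc \<odot> Rp A NatO))"
  have g: "S \<turnstile> ?g \<Colon> Prod A NatO \<rightarrow> Prod A NatO" by (rule typing \<phi>)+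
  define W where "W n = ev M (Iter ?g) (VP (VP a zr) n)" for n
  have W: "W n \<in> El M (Prod A NatO)" if "n \<in> El M NatO" for n
    unfolding W_def by (rule Iter_El[OF g]) (use a that in simp_all)
  have b: "ev M (bmin A \<phi>) (VP a n) = vsnd (W n)" for n
    by (simp add: bmin_def W_def)
  have \<phi>E: "ev M \<phi> v \<in> El M NatO" if "v \<in> El M (Prod A NatO)" for v
    by (rule ev_El[OF \<phi> that])
  have Wz: "W zr = VP a zr" unfolding W_def by (rule Iter_zr[OF g]) (simp add: a)
  have Ws: "W (sc n) = ev M ?g (W n)" if "n \<in> El M NatO" for n
    unfolding W_def by (rule Iter_sc[OF g _ that]) (simp add: a)
  have dW: "definable_fun (Prod A NatO) W"
    unfolding W_def by (rule df_id df_const df_ev[OF mp_iter[OF g]] df_VP a zr_El)+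
  have Wf: "vfst (W n) = a" if "n \<in> El M NatO" for n
    using that
  proof (rule nat_induct)
    have "definable_pred (\<lambda>n. ev M (Lp A NatO) (W n) = a)"
      by (rule dp_eq[of A] df_ev[OF mp_lp] dW df_const a)+
    then show "definable_pred (\<lambda>n. vfst (W n) = a)" by simp
  qed (simp_all add: Wz Ws)
  have WE: "W n = VP a (vsnd (W n))" if "n \<in> El M NatO" for n
    using VP_eta[OF W[OF that]] Wf[OF that] by simp
  show "ev M (bmin A \<phi>) (VP a zr) = zr" by (simp add: b Wz)
  show "n \<in> El M NatO \<Longrightarrow> ev M (bmin A \<phi>) (VP a n) \<in> El M NatO"
    using vsnd_El[OF W] by (simp add: b)
  show "n \<in> El M NatO \<Longrightarrow> ev M (bmin A \<phi>) (VP a (sc n)) =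
      (if ev M \<phi> (VP a (ev M (bmin A \<phi>) (VP a n))) \<noteq> zr then ev M (bmin A \<phi>) (VP a n)
       else sc (ev M (bmin A \<phi>) (VP a n)))"
    using W[of n] WE[of n] by (simp add: b Ws \<phi>E)
  have "definable_fun NatO (\<lambda>n. ev M (Rp A NatO) (W n))"
    by (rule df_ev[OF mp_rp dW])
  then show "definable_fun NatO (\<lambda>n. ev M (bmin A \<phi>) (VP a n))" by (simp add: b)
qed

lemma bmin_le:
  assumes \<phi>: "S \<turnstile> \<phi> \<Colon> Prod A NatO \<rightarrow> NatO" and a: "a \<in> El M A"
    and n: "n \<in> El M NatO" and m: "m \<in> El M NatO" "ev M \<phi> (VP a m) \<noteq> zr"
  shows "le (ev M (bmin A \<phi>) (VP a n)) m"
  using n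
proof (rule nat_induct)
  show "definable_pred (\<lambda>n. le (ev M (bmin A \<phi>) (VP a n)) m)"
    by (rule dp_zr df_ev[OF typ_subm] df_VP ev_bmin(4)[OF \<phi> a] df_const m)+
  show "le (ev M (bmin A \<phi>) (VP a zr)) m" using ev_bmin(1)[OF \<phi> a] m by simp
  fix n assume n: "n \<in> El M NatO" and IH: "le (ev M (bmin A \<phi>) (VP a n)) m"
  then show "le (ev M (bmin A \<phi>) (VP a (sc n))) m"
    using le_neq_sc[OF ev_bmin(2)[OF \<phi> a n] m(1) IH] m(2) by (auto simp: ev_bmin(3)[OF \<phi> a n])
qed

lemma bmin_holds:
  assumes \<phi>: "S \<turnstile> \<phi> \<Colon> Prod A NatO \<rightarrow> NatO" and a: "a \<in> El M A"
    and n: "n \<in> El M NatO" "ev M \<phi> (VP a n) \<noteq> zr"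
  shows "ev M \<phi> (VP a (ev M (bmin A \<phi>) (VP a n))) \<noteq> zr"
proof -
  let ?b = "\<lambda>n. ev M (bmin A \<phi>) (VP a n)"
  have "?b n = n \<or> ev M \<phi> (VP a (?b n)) \<noteq> zr"
    using n(1)
  proof (rule nat_induct)
    show "definable_pred (\<lambda>n. ?b n = n \<or> ev M \<phi> (VP a (?b n)) \<noteq> zr)"
      by (rule dp_disj dp_eq[of NatO] dp_tt df_id df_ev[OF \<phi>] df_VP ev_bmin(4)[OF \<phi> a] df_const a)+
  qed (auto simp: ev_bmin[OF \<phi> a])
  then show ?thesis using n by auto
qed

lemma bmin_unique:
  assumes \<phi>: "S \<turnstile> \<phi> \<Colon> Prod A NatO \<rightarrow> NatO" and a: "a \<in> El M A"
    and n: "n \<in> El M NatO" "ev M \<phi> (VP a n) \<noteq> zr"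
    and k: "k \<in> El M NatO" "ev M \<phi> (VP a k) \<noteq> zr" 
    and least: "\<And>m. m \<in> El M NatO \<Longrightarrow> ev M \<phi> (VP a m) \<noteq> zr \<Longrightarrow> le k m"
  shows "ev M (bmin A \<phi>) (VP a n) = k"
  using le_antisym ev_bmin(2)[OF \<phi> a n(1)] bmin_le[OF \<phi> a n(1) k] bmin_holds[OF \<phi> a n] least k by blast

section \<open>The Cantor count is onto\<close>

lemma Iter_ad:
  assumes g: "S \<turnstile> g \<Colon> A \<rightarrow> A" and a: "a \<in> El M A" and n: "n \<in> El M NatO" and k: "k \<in> El M NatO"
  shows "ev M (Iter g) (VP a (ev M addm (VP n k))) = ev M (Iter g) (VP (ev M (Iter g) (VP a n)) k)"
  using k
proof (rule nat_induct)
  have E: "ev M (Iter g) (VP a n) \<in> El M A" using Iter_El[OF g a n] .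
  show "definable_pred (\<lambda>k. ev M (Iter g) (VP a (ev M addm (VP n k))) = ev M (Iter g) (VP (ev M (Iter g) (VP a n)) k))"
    by (rule dp_eq[of A] df_id df_const df_ev[OF mp_iter[OF g]] df_ev[OF typ_addm] df_VP a n E)+
  show "ev M (Iter g) (VP a (ev M addm (VP n zr))) = ev M (Iter g) (VP (ev M (Iter g) (VP a n)) zr)"
    using n E by (simp add: Iter_zr[OF g])
qed (simp add: n a Iter_sc[OF g] Iter_El[OF g])

end

lemma typ_cantor_step [typing]: "S \<turnstile> cantor_step \<Colon> Prod NatO NatO \<rightarrow> Prod NatO NatO"
  unfolding cantor_step_def by (rule typing)+

lemma typ_cantor [typing]: "S \<turnstile> cantor \<Colon> NatO \<rightarrow> Prod NatO NatO"
  unfolding cantor_def by (rule typing)+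

lemma typ_count_fund [typing]: "S \<turnstile> count_fund A \<Colon> NatO \<rightarrow> A"
  by (induction A) (auto intro!: mp_bang mp_id mp_cmp[OF typ_cantor] mp_ind mp_cmp[OF mp_lp] mp_cmp[OF mp_rp])

text \<open>\<open>diag\<close> maps d to the index of \<open>(0, d)\<close> in the Cantor ordering, the d-th triangular number; the
  index of \<open>(x, y)\<close> is then \<open>diag(x + y) + x\<close>.\<close>

definition diag :: tm where
  "diag = Rp NatO NatO \<odot> Iter (Ind (Sc \<odot> Lp NatO NatO) (Sc \<odot> addm))
     \<odot> Ind (Ind (Zr \<odot> Bang NatO) (Zr \<odot> Bang NatO)) (Idm NatO)"

fun index_fund :: "obj \<Rightarrow> tm" where
  "index_fund One = Zr"
| "index_fund NatO = Idm NatO"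
| "index_fund (Prod A B) =
     addm \<odot> Ind (diag \<odot> addm) (Lp NatO NatO)
       \<odot> Ind (index_fund A \<odot> Lp A B) (index_fund B \<odot> Rp A B)"

lemma typ_diag [typing]: "S \<turnstile> diag \<Colon> NatO \<rightarrow> NatO"
  unfolding diag_def by (rule typing)+

lemma typ_index_fund [typing]: "S \<turnstile> index_fund A \<Colon> A \<rightarrow> NatO"
proof (induction A)
  case (Prod A B)
  show ?case unfolding index_fund.simps by (rule typing Prod)+
qed (auto intro: typing)

context model
begin

lemma ev_cantor_step: "x \<in> El M NatO \<Longrightarrow> y \<in> El M NatO \<Longrightarrow>
    ev M cantor_step (VP x y) = (if y \<noteq> zr then VP (sc x) (ev M predm y) else VP zr (sc x))"
  by (simp add: cantor_step_def)

text \<open>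
  Starting from \<open>(0, d)\<close>, the Cantor ordering runs through the diagonal of all pairs with sum d.
\<close>

lemma cantor_walk:
  assumes d: "d \<in> El M NatO" and k: "k \<in> El M NatO"
  shows "le k d \<Longrightarrow> ev M (Iter cantor_step) (VP (VP zr d) k) = VP k (ev M subm (VP d k))"
proof -
  have "le k d \<longrightarrow> ev M (Iter cantor_step) (VP (VP zr d) k) = VP k (ev M subm (VP d k))"
    using k
  proof (rule nat_induct)
    show "definable_pred (\<lambda>k. le k d \<longrightarrow> ev M (Iter cantor_step) (VP (VP zr d) k) = VP k (ev M subm (VP d k)))"
      by (rule dp_imp dp_zr dp_eq[of "Prod NatO NatO"] df_id df_const VP_El[THEN iffD2] conjI zr_El d
          df_ev[OF mp_iter[OF typ_cantor_step]] df_ev[OF typ_subm] df_VP)+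
    show "le zr d \<longrightarrow> ev M (Iter cantor_step) (VP (VP zr d) zr) = VP zr (ev M subm (VP d zr))"
      using d by (simp add: Iter_zr[OF typ_cantor_step])
    fix k assume k: "k \<in> El M NatO"
      and IH: "le k d \<longrightarrow> ev M (Iter cantor_step) (VP (VP zr d) k) = VP k (ev M subm (VP d k))"
    show "le (sc k) d \<longrightarrow> ev M (Iter cantor_step) (VP (VP zr d) (sc k)) = VP (sc k) (ev M subm (VP d (sc k)))"
    proof
      assume "le (sc k) d"
      then have "le k d" "ev M subm (VP d k) \<noteq> zr" using sc_le[OF k d] by simp_all
      then show "ev M (Iter cantor_step) (VP (VP zr d) (sc k)) = VP (sc k) (ev M subm (VP d (sc k)))"
        using IH k d by (simp add: Iter_sc[OF typ_cantor_step] ev_cantor_step sb_sc)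
    qed
  qed
  then show "le k d \<Longrightarrow> ev M (Iter cantor_step) (VP (VP zr d) k) = VP k (ev M subm (VP d k))" by simp
qed

lemma diag_rec:
  shows "ev M diag zr = zr"
    and "d \<in> El M NatO \<Longrightarrow> ev M diag (sc d) = sc (ev M addm (VP d (ev M diag d)))"
proof -
  let ?g = "Ind (Sc \<odot> Lp NatO NatO) (Sc \<odot> addm)"
  have g: "S \<turnstile> ?g \<Colon> Prod NatO NatO \<rightarrow> Prod NatO NatO" by (rule typing)+
  define W where "W n = ev M (Iter ?g) (VP (VP zr zr) n)" for n
  have W: "W n \<in> El M (Prod NatO NatO)" if "n \<in> El M NatO" for n
    unfolding W_def by (rule Iter_El[OF g]) (use that in simp_all)
  have b: "ev M diag n = vsnd (W n)" for n by (simp add: diag_def W_def)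
  have Wz: "W zr = VP zr zr" unfolding W_def by (rule Iter_zr[OF g]) simp
  have Ws: "W (sc n) = ev M ?g (W n)" if "n \<in> El M NatO" for n
    unfolding W_def by (rule Iter_sc[OF g _ that]) simp
  have dW: "definable_fun (Prod NatO NatO) W"
    unfolding W_def by (rule df_id df_const df_ev[OF mp_iter[OF g]] df_VP zr_El)+
  have Wf: "vfst (W n) = n" if "n \<in> El M NatO" for n
    using that
  proof (rule nat_induct)
    have "definable_pred (\<lambda>n. ev M (Lp NatO NatO) (W n) = n)"
      by (rule dp_eq[of NatO] df_ev[OF mp_lp] dW df_id)+
    then show "definable_pred (\<lambda>n. vfst (W n) = n)" by simp
  qed (simp_all add: Wz Ws)
  show "ev M diag zr = zr" by (simp add: b Wz)
  show "d \<in> El M NatO \<Longrightarrow> ev M diag (sc d) = sc (ev M addm (VP d (ev M diag d)))"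
    using VP_eta[OF W, of d] Wf[of d] by (simp add: b Ws)
qed

lemma diag_El [simp]: "d \<in> El M NatO \<Longrightarrow> ev M diag d \<in> El M NatO"
  by (rule ev_El[OF typ_diag])

lemma ad_comm:
  assumes "x \<in> El M NatO" "y \<in> El M NatO"
  shows "ev M addm (VP x y) = ev M addm (VP y x)"
  using assms(2)
proof (rule nat_induct)
  show "definable_pred (\<lambda>y. ev M addm (VP x y) = ev M addm (VP y x))"
    by (rule dp_eq[of NatO] df_id df_const df_ev[OF typ_addm] df_VP assms)+
qed (use assms in simp_all)

lemma cantor_diag:
  assumes d: "d \<in> El M NatO"
  shows "ev M cantor (ev M diag d) = VP zr d"
  using d
proof (rule nat_induct)
  show "definable_pred (\<lambda>d. ev M cantor (ev M diag d) = VP zr d)"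
    by (rule dp_eq[of "Prod NatO NatO"] df_id df_const df_ev[OF typ_cantor] df_ev[OF typ_diag] df_VP zr_El)+
  show "ev M cantor (ev M diag zr) = VP zr zr"
    by (simp add: diag_rec cantor_def Iter_zr[OF typ_cantor_step])
  fix d assume d: "d \<in> El M NatO" and IH: "ev M cantor (ev M diag d) = VP zr d"
  then have "ev M (Iter cantor_step) (VP (VP zr zr) (ev M addm (VP (ev M diag d) d))) = VP d zr"
    by (simp add: Iter_ad[OF typ_cantor_step] cantor_def cantor_walk)
  then show "ev M cantor (ev M diag (sc d)) = VP zr (sc d)"
    using d by (simp add: diag_rec cantor_def Iter_sc[OF typ_cantor_step] ev_cantor_step ad_comm[of d])
qed

lemma count_index:
  "x \<in> El M A \<Longrightarrow> ev M (count_fund A) (ev M (index_fund A) x) = x"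
proof (induction A arbitrary: x)
  case One
  then show ?case using El_One[OF One] by simp
next
  case (Prod A B)
  from Prod.prems obtain a b where x: "x = VP a b" "a \<in> El M A" "b \<in> El M B" by (rule El_ProdE)
  define i j where "i = ev M (index_fund A) a" and "j = ev M (index_fund B) b"
  have ij: "i \<in> El M NatO" "j \<in> El M NatO" 
    unfolding i_def j_def using x ev_El[OF typ_index_fund] by auto
  define n where "n = ev M diag (ev M addm (VP i j))"
  have n: "n \<in> El M NatO" using ij by (simp add: n_def)
  have "ev M (Iter cantor_step) (VP (VP zr zr) n) = VP zr (ev M addm (VP i j))"
    using cantor_diag[of "ev M addm (VP i j)"] ij by (simp add: n_def cantor_def)
  then have "ev M cantor (ev M addm (VP n i)) = VP i j"
    using n ij by (simp add: cantor_def Iter_ad[OF typ_cantor_step] cantor_walk)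
  then show ?case using Prod.IH x by (simp flip: i_def j_def n_def) (simp add: i_def j_def)
qed simp

end


section \<open>Predicates and quantifiers\<close>

lemma valid_imp:
  assumes p: "S \<turnstile> p \<Colon> A \<rightarrow> NatO" and q: "S \<turnstile> q \<Colon> A \<rightarrow> NatO"
  shows "S \<turnstile> impT p q \<approx> trueT A \<Colon> A \<rightarrow> NatO \<longleftrightarrow>
    (\<forall>M v. model S M \<longrightarrow> v \<in> El M A \<longrightarrow> ev M p v \<noteq> ev M Zr VU \<longrightarrow> ev M q v \<noteq> ev M Zr VU)"
    (is "?L \<longleftrightarrow> ?R")
proof
  assume L: ?L
  show ?R
  proof (intro allI impI)
    fix M v assume M: "model S M" and v: "v \<in> El M A" and pv: "ev M p v \<noteq> ev M Zr VU"
    interpret model S M by fact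
    have "ev M (impT p q) v = ev M (trueT A) v"
      by (rule sound[OF L _ _ v]) (rule typing p q)+
    then show "ev M q v \<noteq> zr"
      using pv ev_El[OF p v] ev_El[OF q v] by simp
  qed
next
  assume R: ?R
  show ?L
  proof (rule complete)
    fix M v assume M: "model S M" and v: "v \<in> El M A"
    interpret model S M by fact
    show "ev M (impT p q) v = ev M (trueT A) v"
      using R[rule_format, OF M v] ev_El[OF p v] ev_El[OF q v] by auto
  qed (rule typing p q)+
qed

definition predicate :: "thy \<Rightarrow> obj \<Rightarrow> tm \<Rightarrow> bool" where
  "predicate S A p \<longleftrightarrow> S \<turnstile> p \<Colon> A \<rightarrow> NatO \<and> S \<turnstile> sgnm \<odot> p \<approx> p \<Colon> A \<rightarrow> NatO"

lemma predicate_typ: "predicate S A p \<Longrightarrow> S \<turnstile> p \<Colon> A \<rightarrow> NatO"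
  by (simp add: predicate_def)

lemma (in model) predicate_val:
  assumes p: "predicate S A p" and v: "v \<in> El M A"
  shows "ev M p v = bv (ev M p v \<noteq> zr)"
proof -
  have t: "S \<turnstile> p \<Colon> A \<rightarrow> NatO" "S \<turnstile> sgnm \<odot> p \<approx> p \<Colon> A \<rightarrow> NatO"
    using p by (simp_all add: predicate_def)
  have "ev M (sgnm \<odot> p) v = ev M p v"
    by (rule sound[OF t(2) mp_cmp[OF t(1) typ_sgnm] t(1) v])
  then show ?thesis using ev_El[OF t(1) v] by (simp add: ev_sgnm)
qed

lemma predicateI:
  assumes p: "S \<turnstile> p \<Colon> A \<rightarrow> NatO"
    and "\<And>M v. model S M \<Longrightarrow> v \<in> El M A \<Longrightarrow> ev M p v \<noteq> ev M Zr VU \<Longrightarrow> ev M p v = ev M Sc (ev M Zr VU)"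
  shows "predicate S A p"
  unfolding predicate_def
proof (intro conjI p complete)
  fix M v assume M: "model S M" and v: "v \<in> El M A"
  interpret model S M by fact
  show "ev M (sgnm \<odot> p) v = ev M p v"
    using assms(2)[OF M v] ev_El[OF p v] by (auto simp: ev_sgnm)
qed (rule typing p)+

lemma predicate_trueT: "predicate S A (trueT A)"
  by (rule predicateI[OF typ_trueT]) (simp add: trueT_def)

lemma predicate_negT:
  assumes "S \<turnstile> p \<Colon> A \<rightarrow> NatO" shows "predicate S A (negT p)"
proof (rule predicateI)
  fix M v assume "model S M" and v: "v \<in> El M A"
  interpret model S M by fact
  show "ev M (negT p) v \<noteq> zr \<Longrightarrow> ev M (negT p) v = sc zr"
    using ev_El[OF assms v] by simp
qed (rule typing assms)+

lemma predicate_disjT: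
  assumes "S \<turnstile> p \<Colon> A \<rightarrow> NatO" "S \<turnstile> q \<Colon> A \<rightarrow> NatO" shows "predicate S A (disjT p q)"
proof (rule predicateI)
  fix M v assume "model S M" and v: "v \<in> El M A"
  interpret model S M by fact
  show "ev M (disjT p q) v \<noteq> zr \<Longrightarrow> ev M (disjT p q) v = sc zr"
    using ev_El[OF assms(1) v] ev_El[OF assms(2) v] by simp
qed (rule typing assms)+

lemma predicate_conjT: "S \<turnstile> p \<Colon> A \<rightarrow> NatO \<Longrightarrow> S \<turnstile> q \<Colon> A \<rightarrow> NatO \<Longrightarrow> predicate S A (conjT p q)"
  unfolding conjT_def by (intro predicate_negT typ_disjT typ_negT)

lemma predicate_impT: "S \<turnstile> p \<Colon> A \<rightarrow> NatO \<Longrightarrow> S \<turnstile> q \<Colon> A \<rightarrow> NatO \<Longrightarrow> predicate S A (impT p q)"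
  unfolding impT_def by (intro predicate_disjT typ_negT)

lemma predicate_eqT:
  assumes "S \<turnstile> f \<Colon> A \<rightarrow> B" "S \<turnstile> g \<Colon> A \<rightarrow> B" shows "predicate S A (eqT B f g)"
proof (rule predicateI)
  fix M v assume "model S M" and v: "v \<in> El M A"
  interpret model S M by fact
  show "ev M (eqT B f g) v \<noteq> zr \<Longrightarrow> ev M (eqT B f g) v = sc zr"
    using ev_El[OF assms(1) v] ev_El[OF assms(2) v] by simp
qed (rule typing assms)+

lemma predicate_cmp:
  assumes p: "predicate S B p" and f: "S \<turnstile> f \<Colon> A \<rightarrow> B" shows "predicate S A (p \<odot> f)"
proof (rule predicateI)
  fix M v assume "model S M" and v: "v \<in> El M A"
  interpret model S M by fact
  show "ev M (p \<odot> f) v \<noteq> zr \<Longrightarrow> ev M (p \<odot> f) v = sc zr"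
    using predicate_val[OF p ev_El[OF f v]] by auto
qed (rule typing predicate_typ p f)+

lemma typ_ExT: "predicate thQ (Prod A B) \<phi> \<Longrightarrow> thQ \<turnstile> ExT A B \<phi> \<Colon> A \<rightarrow> NatO"
  by (simp add: predicate_def mp_ex)

lemma typ_AllT: "predicate thQ (Prod A B) \<phi> \<Longrightarrow> thQ \<turnstile> AllT A B \<phi> \<Colon> A \<rightarrow> NatO"
  by (simp add: predicate_def mp_all)

lemma predicate_ExT: "predicate thQ (Prod A B) \<phi> \<Longrightarrow> predicate thQ A (ExT A B \<phi>)"
  using typ_ExT ex_pred by (simp add: predicate_def)

lemma predicate_AllT: "predicate thQ (Prod A B) \<phi> \<Longrightarrow> predicate thQ A (AllT A B \<phi>)"
  using typ_AllT all_pred by (simp add: predicate_def)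

lemma ExT_I:
  assumes \<phi>: "predicate thQ (Prod A B) \<phi>" and M: "model thQ M" and ab: "a \<in> El M A" "b \<in> El M B"
    and h: "ev M \<phi> (VP a b) \<noteq> ev M Zr VU"
  shows "ev M (ExT A B \<phi>) a \<noteq> ev M Zr VU"
proof -
  have t: "thQ \<turnstile> ExT A B \<phi> \<odot> Lp A B \<Colon> Prod A B \<rightarrow> NatO" by (rule typing typ_ExT \<phi>)+
  show ?thesis
    using valid_imp[OF predicate_typ[OF \<phi>] t, THEN iffD1, OF ex_intro[OF typ_ExT[OF \<phi>]],
        rule_format, OF M, of "VP a b"] ab h
    by (simp add: congr.VP_El[OF model_congr[OF M]])
qed

lemma AllT_E:
  assumes \<phi>: "predicate thQ (Prod A B) \<phi>" and M: "model thQ M" and ab: "a \<in> El M A" "b \<in> El M B"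
    and h: "ev M (AllT A B \<phi>) a \<noteq> ev M Zr VU"
  shows "ev M \<phi> (VP a b) \<noteq> ev M Zr VU"
proof -
  have t: "thQ \<turnstile> AllT A B \<phi> \<odot> Lp A B \<Colon> Prod A B \<rightarrow> NatO" by (rule typing typ_AllT \<phi>)+
  show ?thesis
    using valid_imp[OF t predicate_typ[OF \<phi>], THEN iffD1, OF all_elim[OF typ_AllT[OF \<phi>]],
        rule_format, OF M, of "VP a b"] ab h
    by (simp add: congr.VP_El[OF model_congr[OF M]])
qed

lemma ExT_E:
  assumes \<phi>: "predicate thQ (Prod A B) \<phi>" and \<psi>: "predicate thQ A \<psi>"
    and h: "\<And>M a b. model thQ M \<Longrightarrow> a \<in> El M A \<Longrightarrow> b \<in> El M B \<Longrightarrow>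
      ev M \<phi> (VP a b) \<noteq> ev M Zr VU \<Longrightarrow> ev M \<psi> a \<noteq> ev M Zr VU"
    and M: "model thQ M" "a \<in> El M A" "ev M (ExT A B \<phi>) a \<noteq> ev M Zr VU"
  shows "ev M \<psi> a \<noteq> ev M Zr VU"
proof -
  have t: "thQ \<turnstile> \<psi> \<odot> Lp A B \<Colon> Prod A B \<rightarrow> NatO" by (rule typing predicate_typ \<psi>)+
  have "thQ \<turnstile> impT \<phi> (\<psi> \<odot> Lp A B) \<approx> trueT (Prod A B) \<Colon> Prod A B \<rightarrow> NatO"
    unfolding valid_imp[OF predicate_typ[OF \<phi>] t]
    by (auto elim!: prod_elim[OF _ _ model_congr] dest: h)
  then have "thQ \<turnstile> impT (ExT A B \<phi>) \<psi> \<approx> trueT A \<Colon> A \<rightarrow> NatO"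
    using \<psi> by (auto intro!: ex_elim typ_ExT \<phi> simp: predicate_def)
  then show ?thesis
    using valid_imp[OF typ_ExT[OF \<phi>] predicate_typ[OF \<psi>]] M by blast
qed

text \<open>
  The rule for the universal quantifier speaks about a generic argument.  Stability under substitution
  allows it to be used at the argument \<open>f(c)\<close>, under a hypothesis on c.
\<close>

lemma AllT_I:
  assumes \<phi>: "predicate thQ (Prod A B) \<phi>" and \<psi>: "predicate thQ C \<psi>" and f: "thQ \<turnstile> f \<Colon> C \<rightarrow> A"
    and h: "\<And>M c b. model thQ M \<Longrightarrow> c \<in> El M C \<Longrightarrow> b \<in> El M B \<Longrightarrow> ev M \<psi> c \<noteq> ev M Zr VU \<Longrightarrow>
      ev M \<phi> (VP (ev M f c) b) \<noteq> ev M Zr VU"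
    and M: "model thQ M" and c: "c \<in> El M C" "ev M \<psi> c \<noteq> ev M Zr VU"
  shows "ev M (AllT A B \<phi>) (ev M f c) \<noteq> ev M Zr VU"
proof -
  let ?\<phi> = "\<phi> \<odot> Ind (f \<odot> Lp C B) (Rp C B)"
  have f': "thQ \<turnstile> Ind (f \<odot> Lp C B) (Rp C B) \<Colon> Prod C B \<rightarrow> Prod A B" by (rule typing f)+
  have \<phi>': "predicate thQ (Prod C B) ?\<phi>" by (rule predicate_cmp[OF \<phi> f'])
  have t: "thQ \<turnstile> \<psi> \<odot> Lp C B \<Colon> Prod C B \<rightarrow> NatO" by (rule typing predicate_typ \<psi>)+
  have "thQ \<turnstile> impT (\<psi> \<odot> Lp C B) ?\<phi> \<approx> trueT (Prod C B) \<Colon> Prod C B \<rightarrow> NatO"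
    unfolding valid_imp[OF t predicate_typ[OF \<phi>']]
    by (auto elim!: prod_elim[OF _ _ model_congr] dest: h)
  then have "thQ \<turnstile> impT \<psi> (AllT C B ?\<phi>) \<approx> trueT C \<Colon> C \<rightarrow> NatO"
    using \<psi> by (auto intro!: all_intro typ_AllT \<phi>' simp: predicate_def)
  then have "ev M (AllT C B ?\<phi>) c \<noteq> ev M Zr VU"
    using valid_imp[OF predicate_typ[OF \<psi>] typ_AllT[OF \<phi>']] M c by blast
  moreover have "ev M (AllT A B \<phi> \<odot> f) c = ev M (AllT C B ?\<phi>) c"
    by (rule congr.sound[OF model_congr[OF M] all_subst[OF typ_AllT[OF \<phi>] f]
          mp_cmp[OF f typ_AllT[OF \<phi>]] typ_AllT[OF \<phi>'] c(1)])
  ultimately show ?thesis by simp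
qed

lemma typ_Desc:
  assumes \<phi>: "predicate thQ (Prod A B) \<phi>"
    and ex: "\<And>M a. model thQ M \<Longrightarrow> a \<in> El M A \<Longrightarrow> ev M (ExT A B \<phi>) a \<noteq> ev M Zr VU"
    and uniq: "\<And>M a b b'. model thQ M \<Longrightarrow> a \<in> El M A \<Longrightarrow> b \<in> El M B \<Longrightarrow> b' \<in> El M B \<Longrightarrow>
      ev M \<phi> (VP a b) \<noteq> ev M Zr VU \<Longrightarrow> ev M \<phi> (VP a b') \<noteq> ev M Zr VU \<Longrightarrow> b = b'"
  shows "thQ \<turnstile> Desc A B \<phi> \<Colon> A \<rightarrow> B"
proof -
  let ?P = "Prod A B"
  let ?i = "impT (\<phi> \<odot> Ind (Lp A B \<odot> Lp ?P B) (Rp ?P B)) (eqT B (Rp A B \<odot> Lp ?P B) (Rp ?P B))"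
  let ?U = "AllT ?P B ?i"
  have i: "predicate thQ (Prod ?P B) ?i" by (rule predicate_impT typing predicate_typ \<phi>)+
  have U: "thQ \<turnstile> ?U \<Colon> ?P \<rightarrow> NatO" by (rule typ_AllT[OF i])
  have c: "predicate thQ ?P (conjT \<phi> ?U)" by (rule predicate_conjT predicate_typ \<phi> U)+
  have all: "ev M ?U (ev M (Idm ?P) v) \<noteq> ev M Zr VU"
    if M: "model thQ M" "v \<in> El M ?P" "ev M \<phi> v \<noteq> ev M Zr VU" for M v
  proof (rule AllT_I[OF i \<phi> mp_id _ M])
    fix M c b assume M: "model thQ M" and c: "c \<in> El M ?P" and b: "b \<in> El M B" and h: "ev M \<phi> c \<noteq> ev M Zr VU"
    interpret model thQ M by fact
    obtain x y where c: "c = VP x y" "x \<in> El M A" "y \<in> El M B" using c by (rule El_ProdE)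
    show "ev M ?i (VP (ev M (Idm ?P) c) b) \<noteq> zr"
      using uniq[OF M, of x y b] h b c ev_El[OF predicate_typ[OF \<phi>], of "VP x b"] by simp
  qed
  have "thQ \<turnstile> exuT A B \<phi> \<approx> trueT A \<Colon> A \<rightarrow> NatO"
    unfolding exuT_def
  proof (rule complete[OF typ_ExT[OF c] typ_trueT])
    fix M a assume M: "model thQ M" and a: "a \<in> El M A"
    interpret model thQ M by fact
    have "ev M (ExT A B (conjT \<phi> ?U)) a \<noteq> zr"
    proof (rule ExT_E[OF \<phi> predicate_ExT[OF c] _ M a ex[OF M a]])
      fix M a b assume M: "model thQ M" and a: "a \<in> El M A" and b: "b \<in> El M B"
        and h: "ev M \<phi> (VP a b) \<noteq> ev M Zr VU"
      interpret N: model thQ M by fact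
      have v: "VP a b \<in> El M ?P" using a b by simp
      have "ev M (conjT \<phi> ?U) (VP a b) \<noteq> N.zr"
        using all[OF M v h] h N.ev_El[OF predicate_typ[OF \<phi>] v] N.ev_El[OF U v] by simp
      then show "ev M (ExT A B (conjT \<phi> ?U)) a \<noteq> N.zr"
        by (rule ExT_I[OF c M a b])
    qed
    then show "ev M (ExT A B (conjT \<phi> ?U)) a = ev M (trueT A) a"
      using predicate_val[OF predicate_ExT[OF c] a] by simp
  qed
  then show ?thesis using \<phi> by (simp add: predicate_def mp_desc)
qed

lemma Desc_iff:
  assumes \<phi>: "predicate thQ (Prod A B) \<phi>" and D: "thQ \<turnstile> Desc A B \<phi> \<Colon> A \<rightarrow> B"
    and M: "model thQ M" and a: "a \<in> El M A" "b \<in> El M B"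
  shows "ev M \<phi> (VP a b) \<noteq> ev M Zr VU \<longleftrightarrow> ev M (Desc A B \<phi>) a = b"
proof -
  interpret model thQ M by fact
  have t: "thQ \<turnstile> eqT B (Desc A B \<phi> \<odot> Lp A B) (Rp A B) \<Colon> Prod A B \<rightarrow> NatO" by (rule typing D)+
  have "ev M (eqT B (Desc A B \<phi> \<odot> Lp A B) (Rp A B)) (VP a b) = ev M \<phi> (VP a b)"
    by (rule sound[OF desc_graph[OF D] t predicate_typ[OF \<phi>]]) (simp add: a)
  then show ?thesis using a ev_El[OF D a(1)] by (auto split: if_splits)
qed

section \<open>Least numbers\<close>

lemma typ_bmin [typing]: "S \<turnstile> \<phi> \<Colon> Prod A NatO \<rightarrow> NatO \<Longrightarrow> S \<turnstile> bmin A \<phi> \<Colon> Prod A NatO \<rightarrow> NatO"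
  unfolding bmin_def by (rule typing | assumption)+

context
  fixes A \<phi>
  assumes \<phi>: "predicate thQ (Prod A NatO) \<phi>"
begin

private abbreviation (input) "P \<equiv> Prod A NatO"

private abbreviation (input) "below \<equiv>
  impT (\<phi> \<odot> Ind (Lp A NatO \<odot> Lp P NatO) (Rp P NatO)) (leT (Rp A NatO \<odot> Lp P NatO) (Rp P NatO))"

private abbreviation (input) "graph \<equiv> disjT (is_least A \<phi>)
  (conjT (negT (ExT A NatO \<phi> \<odot> Lp A NatO)) (eqT NatO (Rp A NatO) (Zr \<odot> Bang P)))"

lemma predicate_below: "predicate thQ (Prod P NatO) below"
  by (rule predicate_impT typing predicate_typ \<phi>)+

lemma ev_below:
  assumes M: "model thQ M" and "a \<in> El M A" "n \<in> El M NatO" "m \<in> El M NatO"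
  shows "ev M below (VP (VP a n) m) \<noteq> ev M Zr VU \<longleftrightarrow>
    (ev M \<phi> (VP a m) \<noteq> ev M Zr VU \<longrightarrow> ev M subm (VP n m) = ev M Zr VU)"
proof -
  interpret model thQ M by fact
  show ?thesis using assms ev_El[OF predicate_typ[OF \<phi>], of "VP a m"] by auto
qed

lemma typ_is_least: "thQ \<turnstile> is_least A \<phi> \<Colon> P \<rightarrow> NatO"
  unfolding is_least_def by (rule typ_conjT predicate_typ[OF \<phi>] typ_AllT predicate_below)+

lemma is_least_D:
  assumes M: "model thQ M" and a: "a \<in> El M A" and n: "n \<in> El M NatO"
    and h: "ev M (is_least A \<phi>) (VP a n) \<noteq> ev M Zr VU"
  shows "ev M \<phi> (VP a n) \<noteq> ev M Zr VU"
    and "m \<in> El M NatO \<Longrightarrow> ev M \<phi> (VP a m) \<noteq> ev M Zr VU \<Longrightarrow> ev M subm (VP n m) = ev M Zr VU"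
proof -
  interpret model thQ M by fact
  have v: "VP a n \<in> El M P" using a n by simp
  have *: "ev M \<phi> (VP a n) \<noteq> zr" "ev M (AllT P NatO below) (VP a n) \<noteq> zr"
    using h ev_El[OF predicate_typ[OF \<phi>] v] ev_El[OF typ_AllT[OF predicate_below] v] by (simp_all add: is_least_def)
  show "ev M \<phi> (VP a n) \<noteq> zr" by fact
  show "le n m" if "m \<in> El M NatO" "ev M \<phi> (VP a m) \<noteq> zr"
    using AllT_E[OF predicate_below M v that(1) *(2)] ev_below[OF M a n that(1)] that(2) by simp
qed

text \<open>
  From any witness n the bounded search finds a least one, as a term in \<open>(a, n)\<close>; thus the least-number
  principle needs no induction on quantified formulas.
\<close>

lemma is_least_bmin:
  assumes M: "model thQ M" and a: "a \<in> El M A" and n: "n \<in> El M NatO"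
    and h: "ev M \<phi> (VP a n) \<noteq> ev M Zr VU"
  shows "ev M (is_least A \<phi>) (VP a (ev M (bmin A \<phi>) (VP a n))) \<noteq> ev M Zr VU"
proof -
  interpret model thQ M by fact
  let ?f = "Ind (Lp A NatO) (bmin A \<phi>)"
  have f: "thQ \<turnstile> ?f \<Colon> P \<rightarrow> P" by (rule typing predicate_typ \<phi>)+
  have v: "VP a n \<in> El M P" using a n by simp
  have "ev M (AllT P NatO below) (ev M ?f (VP a n)) \<noteq> zr"
  proof (rule AllT_I[OF predicate_below \<phi> f _ M v h])
    fix M c m assume M: "model thQ M" and c: "c \<in> El M P" and m: "m \<in> El M NatO" and h: "ev M \<phi> c \<noteq> ev M Zr VU"
    interpret N: model thQ M by fact
    obtain x y where c: "c = VP x y" "x \<in> El M A" "y \<in> El M NatO" using c by (rule N.El_ProdE)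
    have b: "ev M (bmin A \<phi>) c \<in> El M NatO" using N.ev_bmin(2)[OF predicate_typ[OF \<phi>]] c by simp
    show "ev M below (VP (ev M ?f c) m) \<noteq> N.zr"
      using ev_below[OF M c(2) b m] N.bmin_le[OF predicate_typ[OF \<phi>] c(2) c(3) m] c(1) by simp
  qed
  moreover have b: "ev M (bmin A \<phi>) (VP a n) \<in> El M NatO" using ev_bmin(2)[OF predicate_typ[OF \<phi>]] a n by simp
  moreover have "ev M (is_least A \<phi>) (VP a (ev M (bmin A \<phi>) (VP a n))) =
      bv (ev M \<phi> (VP a (ev M (bmin A \<phi>) (VP a n))) \<noteq> zr \<and>
          ev M (AllT P NatO below) (VP a (ev M (bmin A \<phi>) (VP a n))) \<noteq> zr)"
    unfolding is_least_def
    by (rule ev_conjT) (use a b in \<open>auto intro!: ev_El[OF predicate_typ[OF \<phi>]] ev_El[OF typ_AllT[OF predicate_below]]\<close>)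
  ultimately show ?thesis
    using bmin_holds[OF predicate_typ[OF \<phi>] a n h] by simp
qed

lemma predicate_graph: "predicate thQ P graph"
  by (rule predicate_disjT typ_is_least typing typ_ExT \<phi>)+

lemma ev_graph:
  assumes M: "model thQ M" and a: "a \<in> El M A" and n: "n \<in> El M NatO"
  shows "ev M graph (VP a n) \<noteq> ev M Zr VU \<longleftrightarrow>
    ev M (is_least A \<phi>) (VP a n) \<noteq> ev M Zr VU \<or> (ev M (ExT A NatO \<phi>) a = ev M Zr VU \<and> n = ev M Zr VU)"
proof -
  interpret model thQ M by fact
  show ?thesis
    using ev_El[OF typ_is_least, of "VP a n"] ev_El[OF typ_ExT[OF \<phi>] a] a n by simp
qed

text \<open>
  Existence is shown by cases: without a witness the graph holds at 0, and from a witness n elimination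
  of the existential quantifier leads to \<open>bmin(a, n)\<close>.
\<close>

lemma typ_minQ: "thQ \<turnstile> minQ A \<phi> \<Colon> A \<rightarrow> NatO"
  unfolding minQ_def
proof (rule typ_Desc[OF predicate_graph])
  fix M a assume M: "model thQ M" and a: "a \<in> El M A"
  interpret model thQ M by fact
  show "ev M (ExT A NatO graph) a \<noteq> zr"
  proof (cases "ev M (ExT A NatO \<phi>) a = zr")
    case True
    then have "ev M graph (VP a zr) \<noteq> zr" using ev_graph[OF M a zr_El] by simp
    then show ?thesis by (rule ExT_I[OF predicate_graph M a zr_El])
  next
    case False
    show ?thesis
    proof (rule ExT_E[OF \<phi> predicate_ExT[OF predicate_graph] _ M a False])
      fix M a n assume M: "model thQ M" and a: "a \<in> El M A" and n: "n \<in> El M NatO"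
        and h: "ev M \<phi> (VP a n) \<noteq> ev M Zr VU"
      interpret N: model thQ M by fact
      have b: "ev M (bmin A \<phi>) (VP a n) \<in> El M NatO" using N.ev_bmin(2)[OF predicate_typ[OF \<phi>]] a n by simp
      have "ev M graph (VP a (ev M (bmin A \<phi>) (VP a n))) \<noteq> N.zr"
        using ev_graph[OF M a b] is_least_bmin[OF M a n h] by simp
      then show "ev M (ExT A NatO graph) a \<noteq> N.zr" by (rule ExT_I[OF predicate_graph M a b])
    qed
  qed
next
  fix M a n m assume M: "model thQ M" and a: "a \<in> El M A" and n: "n \<in> El M NatO" and m: "m \<in> El M NatO"
    and h: "ev M graph (VP a n) \<noteq> ev M Zr VU" "ev M graph (VP a m) \<noteq> ev M Zr VU"
  interpret model thQ M by fact
  have ex: "ev M (ExT A NatO \<phi>) a \<noteq> zr" if "ev M (is_least A \<phi>) (VP a k) \<noteq> zr" "k \<in> El M NatO" for k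
    using ExT_I[OF \<phi> M a that(2)] is_least_D(1)[OF M a that(2,1)] by blast
  show "n = m"
    using h ex[OF _ n] ex[OF _ m] le_antisym[OF n m] is_least_D[OF M a n] is_least_D[OF M a m] n m
    unfolding ev_graph[OF M a n] ev_graph[OF M a m] by metis
qed

lemma minQ_least:
  assumes M: "model thQ M" and a: "a \<in> El M A" and ex: "ev M (ExT A NatO \<phi>) a \<noteq> ev M Zr VU"
  shows "ev M (is_least A \<phi>) (VP a (ev M (minQ A \<phi>) a)) \<noteq> ev M Zr VU"
proof -
  interpret model thQ M by fact
  have m: "ev M (minQ A \<phi>) a \<in> El M NatO" by (rule ev_El[OF typ_minQ a])
  have "ev M graph (VP a (ev M (minQ A \<phi>) a)) \<noteq> zr"
    using Desc_iff[OF predicate_graph typ_minQ[unfolded minQ_def] M a m] by (simp add: minQ_def)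
  then show ?thesis using ev_graph[OF M a m] ex by simp
qed

text \<open>
  A model consists of terms over a fixed context, so a true existential statement need not have a
  witness in it; here the least-number map provides one.
\<close>

lemma ExT_NatO_iff:
  assumes M: "model thQ M" and a: "a \<in> El M A"
  shows "ev M (ExT A NatO \<phi>) a \<noteq> ev M Zr VU \<longleftrightarrow> (\<exists>n\<in>El M NatO. ev M \<phi> (VP a n) \<noteq> ev M Zr VU)"
proof -
  interpret model thQ M by fact
  show ?thesis
    using minQ_least[OF M a] is_least_D(1)[OF M a ev_El[OF typ_minQ a]] ev_El[OF typ_minQ a]
      ExT_I[OF \<phi> M a] by blast
qed

lemma bmin_eq_minQ:
  assumes M: "model thQ M" and a: "a \<in> El M A" and n: "n \<in> El M NatO"
    and h: "ev M \<phi> (VP a n) \<noteq> ev M Zr VU"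
  shows "ev M (bmin A \<phi>) (VP a n) = ev M (minQ A \<phi>) a"
proof -
  interpret model thQ M by fact
  have m: "ev M (minQ A \<phi>) a \<in> El M NatO" by (rule ev_El[OF typ_minQ a])
  have l: "ev M (is_least A \<phi>) (VP a (ev M (minQ A \<phi>) a)) \<noteq> zr"
    by (rule minQ_least[OF M a ExT_I[OF \<phi> M a n h]])
  show ?thesis
    by (rule bmin_unique[OF predicate_typ[OF \<phi>] a n h m is_least_D(1)[OF M a m l] is_least_D(2)[OF M a m l]])
qed

end

lemma neg_ExT:
  assumes \<phi>: "predicate thQ (Prod A NatO) \<phi>"
  shows "thQ \<turnstile> negT (ExT A NatO \<phi>) \<approx> AllT A NatO (negT \<phi>) \<Colon> A \<rightarrow> NatO"
proof -
  have n: "predicate thQ (Prod A NatO) (negT \<phi>)" by (rule predicate_negT[OF predicate_typ[OF \<phi>]])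
  have nn: "predicate thQ (Prod A NatO) (negT (negT \<phi>))" by (rule predicate_negT[OF predicate_typ[OF n]])
  show ?thesis
  proof (rule complete)
    fix M a assume M: "model thQ M" and a: "a \<in> El M A"
    interpret model thQ M by fact
    have \<phi>E: "ev M \<phi> (VP a m) \<in> El M NatO" if "m \<in> El M NatO" for m
      by (rule ev_El[OF predicate_typ[OF \<phi>]]) (use a that in simp)
    have EE: "ev M (ExT A NatO \<phi>) a \<in> El M NatO" by (rule ev_El[OF typ_ExT[OF \<phi>] a])
    have t: "thQ \<turnstile> disjT (AllT A NatO (negT \<phi>)) (ExT A NatO (negT (negT \<phi>))) \<Colon> A \<rightarrow> NatO"
      by (rule typing typ_AllT typ_ExT n nn)+
    have "ev M (AllT A NatO (negT \<phi>)) a \<noteq> zr \<or> ev M (ExT A NatO (negT (negT \<phi>))) a \<noteq> zr"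
      using sound[OF quant_lem[OF typ_AllT[OF n]] t typ_trueT a]
        ev_El[OF typ_AllT[OF n] a] ev_El[OF typ_ExT[OF nn] a] by simp
    moreover have "ev M (ExT A NatO (negT (negT \<phi>))) a \<noteq> zr \<longleftrightarrow> ev M (ExT A NatO \<phi>) a \<noteq> zr"
      unfolding ExT_NatO_iff[OF nn M a] ExT_NatO_iff[OF \<phi> M a]
      by (rule bex_cong) (simp_all add: \<phi>E)
    moreover have "ev M (ExT A NatO \<phi>) a = zr" if "ev M (AllT A NatO (negT \<phi>)) a \<noteq> zr"
    proof (rule ccontr)
      assume "ev M (ExT A NatO \<phi>) a \<noteq> zr"
      then obtain m where m: "m \<in> El M NatO" "ev M \<phi> (VP a m) \<noteq> zr"
        using ExT_NatO_iff[OF \<phi> M a] by blast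
      show False using AllT_E[OF n M a m(1) that] m \<phi>E by simp
    qed
    ultimately show "ev M (negT (ExT A NatO \<phi>)) a = ev M (AllT A NatO (negT \<phi>)) a"
      using predicate_val[OF predicate_AllT[OF n] a] EE by (cases "ev M (AllT A NatO (negT \<phi>)) a = zr") auto
  qed (rule typing typ_ExT typ_AllT \<phi> n)+
qed


section \<open>Objects and partial maps in a model\<close>

text \<open>The elements of \<open>{A | chi}\<close> in a model.\<close>

definition points :: "ctx \<Rightarrow> aobj \<Rightarrow> val set" where
  "points M X = {v \<in> El M (base X). ev M (dpred X) v \<noteq> ev M Zr VU}"

lemma pt_El: "v \<in> points M X \<Longrightarrow> v \<in> El M (base X)"
  by (simp add: points_def)

lemma isobj_predicate: "isobj S X \<longleftrightarrow> predicate S (base X) (dpred X)"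
  by (simp add: isobj_def predicate_def)

lemma isobj_typ: "isobj S X \<Longrightarrow> S \<turnstile> dpred X \<Colon> base X \<rightarrow> NatO"
  by (simp add: isobj_def)

lemma amap_iff:
  "amap S f X Y \<longleftrightarrow> isobj S X \<and> isobj S Y \<and> S \<turnstile> f \<Colon> base X \<rightarrow> base Y \<and>
    (\<forall>M v. model S M \<longrightarrow> v \<in> points M X \<longrightarrow> ev M f v \<in> points M Y)"
proof (cases "isobj S X \<and> isobj S Y \<and> S \<turnstile> f \<Colon> base X \<rightarrow> base Y")
  case True
  then have t: "S \<turnstile> dpred X \<Colon> base X \<rightarrow> NatO" "S \<turnstile> dpred Y \<odot> f \<Colon> base X \<rightarrow> NatO"
    by (auto intro: isobj_typ mp_cmp)
  have "ev M f v \<in> El M (base Y)" if "model S M" "v \<in> El M (base X)" for M v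
    using congr.ev_El[OF model_congr[OF that(1)]] True that by blast
  then show ?thesis
    using True unfolding amap_def valid_imp[OF t] points_def by auto
qed (auto simp: amap_def)

lemma amapI:
  "isobj S X \<Longrightarrow> isobj S Y \<Longrightarrow> S \<turnstile> f \<Colon> base X \<rightarrow> base Y \<Longrightarrow>
    (\<And>M v. model S M \<Longrightarrow> v \<in> points M X \<Longrightarrow> ev M f v \<in> points M Y) \<Longrightarrow> amap S f X Y"
  by (simp add: amap_iff)

lemma amap_pt: "amap S f X Y \<Longrightarrow> model S M \<Longrightarrow> v \<in> points M X \<Longrightarrow> ev M f v \<in> points M Y"
  unfolding amap_iff by blast

lemma amap_typ: "amap S f X Y \<Longrightarrow> S \<turnstile> f \<Colon> base X \<rightarrow> base Y"
  by (simp add: amap_iff)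

lemma amap_isobj: "amap S f X Y \<Longrightarrow> isobj S X" "amap S f X Y \<Longrightarrow> isobj S Y"
  by (simp_all add: amap_iff)

lemma aeq_iff:
  "aeq S f g X Y \<longleftrightarrow> amap S f X Y \<and> amap S g X Y \<and>
    (\<forall>M v. model S M \<longrightarrow> v \<in> points M X \<longrightarrow> ev M f v = ev M g v)"
proof (cases "amap S f X Y \<and> amap S g X Y")
  case True
  then have t: "S \<turnstile> dpred X \<Colon> base X \<rightarrow> NatO" "S \<turnstile> eqT (base Y) f g \<Colon> base X \<rightarrow> NatO"
    by (auto intro: isobj_typ amap_isobj typ_eqT amap_typ)
  have "ev M (eqT (base Y) f g) v \<noteq> ev M Zr VU \<longleftrightarrow> ev M f v = ev M g v"
    if M: "model S M" and v: "v \<in> El M (base X)" for M v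
  proof -
    interpret model S M by fact
    show ?thesis
      using True ev_El[OF amap_typ[of S f X Y] v] ev_El[OF amap_typ[of S g X Y] v] by simp
  qed
  then show ?thesis
    using True unfolding aeq_def valid_imp[OF t] points_def by auto
qed (auto simp: aeq_def)

lemma base_simps [simp]:
  "base (fundO A) = A" "base (prodO X Y) = Prod (base X) (base Y)" "base (subO X \<psi>) = base X"
  by (simp_all add: fundO_def prodO_def subO_def)

lemma isobj_fundO: "isobj S (fundO A)"
  by (simp add: isobj_predicate fundO_def predicate_trueT)

lemma isobj_prodO: "isobj S X \<Longrightarrow> isobj S Y \<Longrightarrow> isobj S (prodO X Y)"
  unfolding isobj_predicate prodO_def aobj.sel
  by (rule predicate_conjT mp_cmp[OF mp_lp] mp_cmp[OF mp_rp] predicate_typ | assumption)+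

lemma isobj_subO: "isobj S X \<Longrightarrow> S \<turnstile> \<psi> \<Colon> base X \<rightarrow> NatO \<Longrightarrow> isobj S (subO X \<psi>)"
  unfolding isobj_predicate subO_def aobj.sel by (rule predicate_conjT[OF predicate_typ])

lemma pt_fundO: "model S M \<Longrightarrow> points M (fundO A) = El M A"
  using model.ev_trueT[of S M A] congr.zr_El[OF model_congr[of S M]] model.sc_neq[of S M]
  by (auto simp: points_def fundO_def)

lemma pt_prodO:
  assumes "isobj S X" "isobj S Y" "model S M"
  shows "v \<in> points M (prodO X Y) \<longleftrightarrow> (\<exists>a\<in>points M X. \<exists>b\<in>points M Y. v = VP a b)"
proof -
  interpret model S M by fact
  have "VP a b \<in> points M (prodO X Y) \<longleftrightarrow> a \<in> points M X \<and> b \<in> points M Y"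
    if "a \<in> El M (base X)" "b \<in> El M (base Y)" for a b
    using that ev_El[OF isobj_typ[OF assms(1)]] ev_El[OF isobj_typ[OF assms(2)]]
    by (auto simp: points_def prodO_def)
  then show ?thesis
    using El_ProdE[of v "base X" "base Y"] pt_El[of v M "prodO X Y"] pt_El[of _ M X] pt_El[of _ M Y]
    by (metis base_simps(2))
qed

lemma pt_subO:
  assumes "isobj S X" "S \<turnstile> \<psi> \<Colon> base X \<rightarrow> NatO" "model S M"
  shows "v \<in> points M (subO X \<psi>) \<longleftrightarrow> v \<in> points M X \<and> ev M \<psi> v \<noteq> ev M Zr VU"
proof -
  interpret model S M by fact
  show ?thesis
    using ev_El[OF isobj_typ[OF assms(1)], of v] ev_El[OF assms(2), of v]
    by (auto simp: points_def subO_def)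
qed

lemma is_pmap_iff:
  "is_pmap S F X Y \<longleftrightarrow> amap S (pemb F) (pdom F) X \<and> amap S (prule F) (pdom F) Y \<and>
    (\<forall>M d e. model S M \<longrightarrow> d \<in> points M (pdom F) \<longrightarrow> e \<in> points M (pdom F) \<longrightarrow>
      ev M (pemb F) d = ev M (pemb F) e \<longrightarrow> ev M (prule F) d = ev M (prule F) e)"
proof (cases "amap S (pemb F) (pdom F) X \<and> amap S (prule F) (pdom F) Y")
  case True
  let ?D = "pdom F"
  let ?B = "base ?D"
  let ?p = "conjT (dpred (prodO ?D ?D)) (eqT (base X) (pemb F \<odot> Lp ?B ?B) (pemb F \<odot> Rp ?B ?B))"
  let ?q = "eqT (base Y) (prule F \<odot> Lp ?B ?B) (prule F \<odot> Rp ?B ?B)"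
  have D: "isobj S ?D" and e: "S \<turnstile> pemb F \<Colon> ?B \<rightarrow> base X" and r: "S \<turnstile> prule F \<Colon> ?B \<rightarrow> base Y"
    using True by (auto intro: amap_typ amap_isobj)
  have dd: "S \<turnstile> dpred (prodO ?D ?D) \<Colon> Prod ?B ?B \<rightarrow> NatO"
    using isobj_typ[OF isobj_prodO[OF D D]] by simp
  have t: "S \<turnstile> ?p \<Colon> Prod ?B ?B \<rightarrow> NatO" "S \<turnstile> ?q \<Colon> Prod ?B ?B \<rightarrow> NatO"
    by (rule typing dd e r)+
  have "is_pmap S F X Y \<longleftrightarrow> (\<forall>M v. model S M \<longrightarrow> v \<in> El M (Prod ?B ?B) \<longrightarrow>
      ev M ?p v \<noteq> ev M Zr VU \<longrightarrow> ev M ?q v \<noteq> ev M Zr VU)"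
    using True valid_imp[OF t] by (simp add: is_pmap_def Let_def)
  also have "\<dots> \<longleftrightarrow> (\<forall>M d e. model S M \<longrightarrow> d \<in> points M ?D \<longrightarrow> e \<in> points M ?D \<longrightarrow>
      ev M (pemb F) d = ev M (pemb F) e \<longrightarrow> ev M (prule F) d = ev M (prule F) e)"
  proof -
    have "(\<forall>v\<in>El M (Prod ?B ?B). ev M ?p v \<noteq> ev M Zr VU \<longrightarrow> ev M ?q v \<noteq> ev M Zr VU) \<longleftrightarrow>
      (\<forall>d\<in>points M ?D. \<forall>e\<in>points M ?D.
        ev M (pemb F) d = ev M (pemb F) e \<longrightarrow> ev M (prule F) d = ev M (prule F) e)"
      if M: "model S M" for M
    proof -
      interpret model S M by fact
      have p: "ev M ?p (VP a b) \<noteq> zr \<longleftrightarrow> a \<in> points M ?D \<and> b \<in> points M ?D \<and> ev M (pemb F) a = ev M (pemb F) b"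
        and q: "ev M ?q (VP a b) \<noteq> zr \<longleftrightarrow> ev M (prule F) a = ev M (prule F) b"
        if "a \<in> El M ?B" "b \<in> El M ?B" for a b
        using that ev_El[OF e] ev_El[OF r] ev_El[OF isobj_typ[OF D]]
        by (auto simp: points_def prodO_def)
      show ?thesis
      proof
        assume L: "\<forall>v\<in>El M (Prod ?B ?B). ev M ?p v \<noteq> zr \<longrightarrow> ev M ?q v \<noteq> zr"
        show "\<forall>d\<in>points M ?D. \<forall>e\<in>points M ?D.
          ev M (pemb F) d = ev M (pemb F) e \<longrightarrow> ev M (prule F) d = ev M (prule F) e"
        proof (intro ballI impI)
          fix a b assume ab: "a \<in> points M ?D" "b \<in> points M ?D" "ev M (pemb F) a = ev M (pemb F) b"
          have El: "a \<in> El M ?B" "b \<in> El M ?B" using ab pt_El by blast+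
          then have "ev M ?q (VP a b) \<noteq> zr" using L p[OF El] ab by (metis VP_El)
          then show "ev M (prule F) a = ev M (prule F) b" using q[OF El] by blast
        qed
      next
        assume R: "\<forall>d\<in>points M ?D. \<forall>e\<in>points M ?D.
          ev M (pemb F) d = ev M (pemb F) e \<longrightarrow> ev M (prule F) d = ev M (prule F) e"
        show "\<forall>v\<in>El M (Prod ?B ?B). ev M ?p v \<noteq> zr \<longrightarrow> ev M ?q v \<noteq> zr"
        proof (intro ballI impI)
          fix v assume v: "v \<in> El M (Prod ?B ?B)" and pv: "ev M ?p v \<noteq> zr"
          from v obtain a b where v: "v = VP a b" and El: "a \<in> El M ?B" "b \<in> El M ?B"
            by (rule El_ProdE)
          then show "ev M ?q v \<noteq> zr" using R p[OF El] q[OF El] pv by metis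
        qed
      qed
    qed
    then show ?thesis by blast
  qed
  finally show ?thesis using True by blast
qed (auto simp: is_pmap_def)

lemma pincl_intro:
  assumes F: "is_pmap S F X Y" and G: "is_pmap S G X Y"
    and i: "S \<turnstile> i \<Colon> base (pdom F) \<rightarrow> base (pdom G)"
    and h: "\<And>M d. model S M \<Longrightarrow> d \<in> points M (pdom F) \<Longrightarrow> ev M i d \<in> points M (pdom G) \<and>
      ev M (pemb G) (ev M i d) = ev M (pemb F) d \<and> ev M (prule G) (ev M i d) = ev M (prule F) d"
  shows "pincl S X Y F G"
proof -
  have F': "amap S (pemb F) (pdom F) X" "amap S (prule F) (pdom F) Y"
    and G': "amap S (pemb G) (pdom G) X" "amap S (prule G) (pdom G) Y"
    using F G by (simp_all add: is_pmap_iff)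
  have "amap S i (pdom F) (pdom G)"
    by (rule amapI) (use F' G' i h in \<open>auto intro: amap_isobj\<close>)
  moreover have "amap S (pemb G \<odot> i) (pdom F) X"
    by (rule amapI)
      (use F' G' h in \<open>auto intro: amap_isobj mp_cmp[OF i amap_typ] amap_pt\<close>)
  moreover have "amap S (prule G \<odot> i) (pdom F) Y"
    by (rule amapI)
      (use F' G' h in \<open>auto intro: amap_isobj mp_cmp[OF i amap_typ] amap_pt\<close>)
  ultimately show ?thesis
    unfolding pincl_def aeq_iff using F' h by auto
qed

lemma is_pmap_tot:
  assumes f: "amap S f X Y" shows "is_pmap S (tot X f) X Y"
  unfolding is_pmap_iff tot_def pmap.sel
  using f by (auto intro!: amapI mp_id amap_isobj[OF f])

context
  fixes S X Y Z F G
  assumes F: "amap S (pemb F) (pdom F) X" "amap S (prule F) (pdom F) Y"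
    and G: "amap S (pemb G) (pdom G) Y" "amap S (prule G) (pdom G) Z"
begin

lemma isobj_pcomp: "isobj S (pdom (pcomp Y G F))"
proof -
  note t = amap_typ[OF F(2)] amap_typ[OF G(1)]
  show ?thesis
    unfolding pcomp_def Let_def pmap.sel
  proof (rule isobj_subO[OF isobj_prodO])
    show "S \<turnstile> eqT (base Y) (prule F \<odot> Lp (base (pdom F)) (base (pdom G)))
       (pemb G \<odot> Rp (base (pdom F)) (base (pdom G))) \<Colon> base (prodO (pdom F) (pdom G)) \<rightarrow> NatO"
      unfolding base_simps by (rule typing t)+
  qed (use amap_isobj[OF F(1)] amap_isobj[OF G(1)] in auto)
qed

lemma pt_pcomp:
  assumes M: "model S M"
  shows "v \<in> points M (pdom (pcomp Y G F)) \<longleftrightarrow>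
    (\<exists>d\<in>points M (pdom F). \<exists>e\<in>points M (pdom G). v = VP d e \<and> ev M (prule F) d = ev M (pemb G) e)"
proof -
  interpret model S M by fact
  note t = amap_typ[OF F(2)] amap_typ[OF G(1)]
  let ?q = "eqT (base Y) (prule F \<odot> Lp (base (pdom F)) (base (pdom G)))
       (pemb G \<odot> Rp (base (pdom F)) (base (pdom G)))"
  have q: "S \<turnstile> ?q \<Colon> base (prodO (pdom F) (pdom G)) \<rightarrow> NatO"
    unfolding base_simps by (rule typing t)+
  have ob: "isobj S (pdom F)" "isobj S (pdom G)" using amap_isobj F G by blast+
  have "ev M ?q (VP d e) \<noteq> zr \<longleftrightarrow> ev M (prule F) d = ev M (pemb G) e"
    if "d \<in> points M (pdom F)" "e \<in> points M (pdom G)" for d e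
    using that[THEN pt_El] ev_El[OF t(1)] ev_El[OF t(2)] by simp
  then show ?thesis
    unfolding pcomp_def Let_def pmap.sel pt_subO[OF isobj_prodO[OF ob] q M] pt_prodO[OF ob M]
    by blast
qed

lemma pcomp_amap:
  "amap S (pemb (pcomp Y G F)) (pdom (pcomp Y G F)) X"
  "amap S (prule (pcomp Y G F)) (pdom (pcomp Y G F)) Z"
proof -
  note t = amap_typ[OF F(1)] amap_typ[OF G(2)]
  have b: "base (pdom (pcomp Y G F)) = Prod (base (pdom F)) (base (pdom G))"
    by (simp add: pcomp_def Let_def)
  show "amap S (pemb (pcomp Y G F)) (pdom (pcomp Y G F)) X"
  proof (rule amapI[OF isobj_pcomp amap_isobj(2)[OF F(1)]])
    show "S \<turnstile> pemb (pcomp Y G F) \<Colon> base (pdom (pcomp Y G F)) \<rightarrow> base X"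
      unfolding b by (simp add: pcomp_def Let_def mp_cmp[OF mp_lp t(1)])
    fix M v assume M: "model S M" and "v \<in> points M (pdom (pcomp Y G F))"
    then show "ev M (pemb (pcomp Y G F)) v \<in> points M X"
      using amap_pt[OF F(1) M] pt_pcomp[OF M] by (auto simp: pcomp_def Let_def)
  qed
  show "amap S (prule (pcomp Y G F)) (pdom (pcomp Y G F)) Z"
  proof (rule amapI[OF isobj_pcomp amap_isobj(2)[OF G(2)]])
    show "S \<turnstile> prule (pcomp Y G F) \<Colon> base (pdom (pcomp Y G F)) \<rightarrow> base Z"
      unfolding b by (simp add: pcomp_def Let_def mp_cmp[OF mp_rp t(2)])
    fix M v assume M: "model S M" and "v \<in> points M (pdom (pcomp Y G F))"
    then show "ev M (prule (pcomp Y G F)) v \<in> points M Z"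
      using amap_pt[OF G(2) M] pt_pcomp[OF M] by (auto simp: pcomp_def Let_def)
  qed
qed

end

lemma pcomp_simps:
  "base (pdom (pcomp Y G F)) = Prod (base (pdom F)) (base (pdom G))"
  "ev M (pemb (pcomp Y G F)) (VP d e) = ev M (pemb F) d"
  "ev M (prule (pcomp Y G F)) (VP d e) = ev M (prule G) e"
  by (simp_all add: pcomp_def Let_def)

lemma is_pmap_pcomp:
  assumes F: "is_pmap S F X Y" and G: "is_pmap S G Y Z"
  shows "is_pmap S (pcomp Y G F) X Z"
proof -
  have F': "amap S (pemb F) (pdom F) X" "amap S (prule F) (pdom F) Y"
    and Fu: "\<And>M d e. model S M \<Longrightarrow> d \<in> points M (pdom F) \<Longrightarrow> e \<in> points M (pdom F) \<Longrightarrow>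
      ev M (pemb F) d = ev M (pemb F) e \<Longrightarrow> ev M (prule F) d = ev M (prule F) e"
    using F unfolding is_pmap_iff by blast+
  have G': "amap S (pemb G) (pdom G) Y" "amap S (prule G) (pdom G) Z"
    and Gu: "\<And>M d e. model S M \<Longrightarrow> d \<in> points M (pdom G) \<Longrightarrow> e \<in> points M (pdom G) \<Longrightarrow>
      ev M (pemb G) d = ev M (pemb G) e \<Longrightarrow> ev M (prule G) d = ev M (prule G) e"
    using G unfolding is_pmap_iff by blast+
  show ?thesis
    unfolding is_pmap_iff
  proof (intro conjI pcomp_amap[OF F' G'] allI impI)
    fix M v w assume M: "model S M" and v: "v \<in> points M (pdom (pcomp Y G F))"
      and w: "w \<in> points M (pdom (pcomp Y G F))"
      and e: "ev M (pemb (pcomp Y G F)) v = ev M (pemb (pcomp Y G F)) w"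
    obtain d e where v: "v = VP d e" "d \<in> points M (pdom F)" "e \<in> points M (pdom G)"
      "ev M (prule F) d = ev M (pemb G) e" using v pt_pcomp[OF F' G' M] by blast
    obtain d' e' where w: "w = VP d' e'" "d' \<in> points M (pdom F)" "e' \<in> points M (pdom G)"
      "ev M (prule F) d' = ev M (pemb G) e'" using w pt_pcomp[OF F' G' M] by blast
    have "ev M (prule F) d = ev M (prule F) d'"
      by (rule Fu[OF M v(2) w(2)]) (use e v w in \<open>simp add: pcomp_simps\<close>)
    then show "ev M (prule (pcomp Y G F)) v = ev M (prule (pcomp Y G F)) w"
      using Gu[OF M v(3) w(3)] v w by (simp add: pcomp_simps)
  qed
qed

text \<open>
  The domain of \<open>F \<circ> G \<circ> F\<close> consists of triples of a d in the domain of F, an e in the domain of G at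
  the value of d, and a d' in the domain of F at the value of e.  Projection to d gives one inclusion,
  and the terms j and k choose e and d' for the other.
\<close>

lemma middle_inverse_criterion:
  assumes F: "is_pmap S F X Y" and G: "is_pmap S G Y X"
    and sect: "\<And>M d e. model S M \<Longrightarrow> d \<in> points M (pdom F) \<Longrightarrow> e \<in> points M (pdom G) \<Longrightarrow>
      ev M (pemb F) d = ev M (prule G) e \<Longrightarrow> ev M (prule F) d = ev M (pemb G) e"
    and j: "S \<turnstile> j \<Colon> base (pdom F) \<rightarrow> base (pdom G)"
    and k: "S \<turnstile> k \<Colon> base (pdom F) \<rightarrow> base (pdom F)"
    and jk: "\<And>M d. model S M \<Longrightarrow> d \<in> points M (pdom F) \<Longrightarrow> ev M j d \<in> points M (pdom G) \<and>
      ev M (pemb G) (ev M j d) = ev M (prule F) d \<and> ev M k d \<in> points M (pdom F) \<and>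
      ev M (pemb F) (ev M k d) = ev M (prule G) (ev M j d)"
  shows "peq S X Y (pcomp X F (pcomp Y G F)) F"
proof -
  have F': "amap S (pemb F) (pdom F) X" "amap S (prule F) (pdom F) Y"
    and G': "amap S (pemb G) (pdom G) Y" "amap S (prule G) (pdom G) X"
    using F G by (simp_all add: is_pmap_iff)
  let ?GF = "pcomp Y G F"
  note GF = pcomp_amap[OF F' G']
  have H: "is_pmap S (pcomp X F ?GF) X Y"
    by (rule is_pmap_pcomp[OF is_pmap_pcomp[OF F G] F])
  have pts: "v \<in> points M (pdom (pcomp X F ?GF)) \<longleftrightarrow> (\<exists>d\<in>points M (pdom F). \<exists>e\<in>points M (pdom G). \<exists>d'\<in>points M (pdom F).
      v = VP (VP d e) d' \<and> ev M (prule F) d = ev M (pemb G) e \<and> ev M (prule G) e = ev M (pemb F) d')"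
    if "model S M" for M v
    unfolding pt_pcomp[OF GF F' that]
    using pt_pcomp[OF F' G' that] by (fastforce simp: pcomp_simps)
  have "pincl S X Y (pcomp X F ?GF) F"
  proof (rule pincl_intro[OF H F])
    show "S \<turnstile> Lp (base (pdom F)) (base (pdom G)) \<odot> Lp (base (pdom ?GF)) (base (pdom F))
      \<Colon> base (pdom (pcomp X F ?GF)) \<rightarrow> base (pdom F)"
      unfolding pcomp_simps by (rule typing)+
    fix M v assume M: "model S M" and "v \<in> points M (pdom (pcomp X F ?GF))"
    then obtain d e d' where v: "d \<in> points M (pdom F)" "e \<in> points M (pdom G)" "d' \<in> points M (pdom F)"
      "v = VP (VP d e) d'" "ev M (prule F) d = ev M (pemb G) e" "ev M (prule G) e = ev M (pemb F) d'"
      using pts by blast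
    then show "ev M (Lp (base (pdom F)) (base (pdom G)) \<odot> Lp (base (pdom ?GF)) (base (pdom F))) v \<in> points M (pdom F) \<and>
      ev M (pemb F) (ev M (Lp (base (pdom F)) (base (pdom G)) \<odot> Lp (base (pdom ?GF)) (base (pdom F))) v)
        = ev M (pemb (pcomp X F ?GF)) v \<and>
      ev M (prule F) (ev M (Lp (base (pdom F)) (base (pdom G)) \<odot> Lp (base (pdom ?GF)) (base (pdom F))) v)
        = ev M (prule (pcomp X F ?GF)) v"
      using sect[OF M v(3,2)] by (simp add: pcomp_simps)
  qed
  moreover have "pincl S X Y F (pcomp X F ?GF)"
  proof (rule pincl_intro[OF F H])
    show "S \<turnstile> Ind (Ind (Idm (base (pdom F))) j) k \<Colon> base (pdom F) \<rightarrow> base (pdom (pcomp X F ?GF))"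
      unfolding pcomp_simps by (rule typing j k)+
    fix M d assume M: "model S M" and d: "d \<in> points M (pdom F)"
    have "ev M (prule F) (ev M k d) = ev M (prule F) d"
      using sect[OF M, of "ev M k d" "ev M j d"] jk[OF M d] by simp
    then show "ev M (Ind (Ind (Idm (base (pdom F))) j) k) d \<in> points M (pdom (pcomp X F ?GF)) \<and>
      ev M (pemb (pcomp X F ?GF)) (ev M (Ind (Ind (Idm (base (pdom F))) j) k) d) = ev M (pemb F) d \<and>
      ev M (prule (pcomp X F ?GF)) (ev M (Ind (Ind (Idm (base (pdom F))) j) k) d) = ev M (prule F) d"
      using jk[OF M d] d by (simp add: pts[OF M] pcomp_simps)
  qed
  ultimately show ?thesis by (simp add: peq_def)
qed


section \<open>Minimisation as a partial map\<close>

lemma (in model) bmin_indep: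
  assumes \<phi>: "S \<turnstile> \<phi> \<Colon> Prod A NatO \<rightarrow> NatO" and a: "a \<in> El M A"
    and n: "n \<in> El M NatO" "ev M \<phi> (VP a n) \<noteq> zr"
    and m: "m \<in> El M NatO" "ev M \<phi> (VP a m) \<noteq> zr"
  shows "ev M (bmin A \<phi>) (VP a n) = ev M (bmin A \<phi>) (VP a m)"
  by (rule bmin_unique[OF \<phi> a n ev_bmin(2)[OF \<phi> a m(1)] bmin_holds[OF \<phi> a m]])
    (rule bmin_le[OF \<phi> a m(1)])

lemma isobj_muPR:
  assumes "isobj S Y" "S \<turnstile> \<phi> \<Colon> Prod (base Y) NatO \<rightarrow> NatO"
  shows "isobj S (pdom (muPR Y \<phi>))"
  unfolding muPR_def pmap.sel
  by (rule isobj_subO[OF isobj_prodO[OF assms(1) isobj_fundO]]) (use assms in simp)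

lemma pt_muPR:
  assumes Y: "isobj S Y" and \<phi>: "S \<turnstile> \<phi> \<Colon> Prod (base Y) NatO \<rightarrow> NatO" and M: "model S M"
  shows "v \<in> points M (pdom (muPR Y \<phi>)) \<longleftrightarrow>
    (\<exists>b\<in>points M Y. \<exists>n\<in>El M NatO. v = VP b n \<and> ev M \<phi> v \<noteq> ev M Zr VU)"
proof -
  have \<phi>': "S \<turnstile> \<phi> \<Colon> base (prodO Y (fundO NatO)) \<rightarrow> NatO" using \<phi> by simp
  show ?thesis
    unfolding muPR_def pmap.sel pt_subO[OF isobj_prodO[OF Y isobj_fundO] \<phi>' M]
      pt_prodO[OF Y isobj_fundO M] pt_fundO[OF M] by blast
qed

lemma is_pmap_muPR:
  assumes Y: "isobj S Y" and \<phi>: "S \<turnstile> \<phi> \<Colon> Prod (base Y) NatO \<rightarrow> NatO"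
  shows "is_pmap S (muPR Y \<phi>) Y (fundO NatO)"
  unfolding is_pmap_iff
proof (intro conjI allI impI amapI isobj_muPR[OF Y \<phi>] Y isobj_fundO)
  show "S \<turnstile> pemb (muPR Y \<phi>) \<Colon> base (pdom (muPR Y \<phi>)) \<rightarrow> base Y"
    by (simp add: muPR_def mp_lp)
  show "S \<turnstile> prule (muPR Y \<phi>) \<Colon> base (pdom (muPR Y \<phi>)) \<rightarrow> base (fundO NatO)"
    by (simp add: muPR_def typ_bmin \<phi>)
  fix M v assume M: "model S M" and v: "v \<in> points M (pdom (muPR Y \<phi>))"
  interpret model S M by fact
  obtain b n where v: "v = VP b n" "b \<in> points M Y" "n \<in> El M NatO" "ev M \<phi> v \<noteq> zr"
    using v pt_muPR[OF Y \<phi> M] by blast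
  show "ev M (pemb (muPR Y \<phi>)) v \<in> points M Y"
    using v by (simp add: muPR_def)
  show "ev M (prule (muPR Y \<phi>)) v \<in> points M (fundO NatO)"
    using v ev_bmin(2)[OF \<phi> pt_El] by (simp add: muPR_def pt_fundO[OF M])
  fix w assume w: "w \<in> points M (pdom (muPR Y \<phi>))"
    and e: "ev M (pemb (muPR Y \<phi>)) v = ev M (pemb (muPR Y \<phi>)) w"
  obtain c m where w: "w = VP c m" "c \<in> points M Y" "m \<in> El M NatO" "ev M \<phi> w \<noteq> zr"
    using w pt_muPR[OF Y \<phi> M] by blast
  show "ev M (prule (muPR Y \<phi>)) v = ev M (prule (muPR Y \<phi>)) w"
    using bmin_indep[OF \<phi> pt_El[OF v(2)] v(3) _ w(3)] e v w by (simp add: muPR_def)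
qed

lemma muQ_dom:
  assumes Y: "isobj thQ Y" and \<phi>: "predicate thQ (Prod (base Y) NatO) \<phi>"
  shows "isobj thQ (pdom (muQ Y \<phi>))"
    and "model thQ M \<Longrightarrow> b \<in> points M (pdom (muQ Y \<phi>)) \<longleftrightarrow>
      b \<in> points M Y \<and> (\<exists>n\<in>El M NatO. ev M \<phi> (VP b n) \<noteq> ev M Zr VU)"
  unfolding muQ_def pmap.sel
  using isobj_subO[OF Y typ_ExT[OF \<phi>]] pt_subO[OF Y typ_ExT[OF \<phi>]] ExT_NatO_iff[OF \<phi>] pt_El
  by blast+

lemma is_pmap_muQ:
  assumes Y: "isobj thQ Y" and \<phi>: "predicate thQ (Prod (base Y) NatO) \<phi>"
  shows "is_pmap thQ (muQ Y \<phi>) Y (fundO NatO)"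
  unfolding is_pmap_iff
proof (intro conjI allI impI amapI muQ_dom(1)[OF Y \<phi>] Y isobj_fundO)
  fix M v assume M: "model thQ M" and v: "v \<in> points M (pdom (muQ Y \<phi>))"
  interpret model thQ M by fact
  have v: "v \<in> points M Y" using v muQ_dom(2)[OF Y \<phi> M] by blast
  then show "ev M (pemb (muQ Y \<phi>)) v \<in> points M Y" by (simp add: muQ_def)
  show "ev M (prule (muQ Y \<phi>)) v \<in> points M (fundO NatO)"
    using ev_El[OF typ_minQ[OF \<phi>] pt_El[OF v]] by (simp add: muQ_def pt_fundO[OF M])
qed (simp_all add: muQ_def mp_id typ_minQ \<phi>)

section \<open>Counting an object with a point\<close>

lemma typ_count:
  assumes a0: "amap S a0 (fundO One) X"
  shows "S \<turnstile> count X a0 \<Colon> NatO \<rightarrow> base X"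
proof -
  have t: "S \<turnstile> a0 \<Colon> One \<rightarrow> base X" using amap_typ[OF a0] by simp
  show ?thesis
    unfolding count_def by (rule typing t isobj_typ amap_isobj(2)[OF a0])+
qed

lemma point_pt: "amap S a0 (fundO One) X \<Longrightarrow> model S M \<Longrightarrow> ev M a0 VU \<in> points M X"
  using amap_pt[of S a0 "fundO One" X M VU] pt_fundO[of S M One] congr.VU_El[OF model_congr[of S M]]
  by simp

lemma ev_count:
  assumes a0: "amap S a0 (fundO One) X" and M: "model S M" and n: "n \<in> El M NatO"
  shows "ev M (count X a0) n =
    (if ev M (count_fund (base X)) n \<in> points M X then ev M (count_fund (base X)) n else ev M a0 VU)"
proof -
  interpret model S M by fact
  have c: "ev M (count_fund (base X)) n \<in> El M (base X)" by (rule ev_El[OF typ_count_fund n])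
  show ?thesis
    unfolding count_def
    using c ev_El[OF isobj_typ[OF amap_isobj(2)[OF a0]] c] pt_El[OF point_pt[OF a0 M]]
    by (simp add: points_def)
qed

lemma count_pt:
  "amap S a0 (fundO One) X \<Longrightarrow> model S M \<Longrightarrow> n \<in> El M NatO \<Longrightarrow> ev M (count X a0) n \<in> points M X"
  by (simp add: ev_count point_pt)

lemma count_onto:
  assumes a0: "amap S a0 (fundO One) X" and M: "model S M" and v: "v \<in> points M X"
  shows "ev M (count X a0) (ev M (index_fund (base X)) v) = v"
proof -
  interpret model S M by fact
  show ?thesis
    using ev_count[OF a0 M ev_El[OF typ_index_fund pt_El[OF v]]] count_index[OF pt_El[OF v]] v
    by simp
qed

lemma amap_count: "amap S a0 (fundO One) X \<Longrightarrow> amap S (count X a0) (fundO NatO) X"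
  by (rule amapI) (simp_all add: isobj_fundO amap_isobj typ_count pt_fundO count_pt)

section \<open>Partial middle inverses\<close>

text \<open>
  The domain D of F may have no point although the source of F has one, so \<open>count D\<close> is not available.
  The search runs over the fundamental object below D instead, and the predicate \<open>\<phi>\<close> asks for an n
  whose value lies in D and is mapped to y.
\<close>

theorem hat_middle_inverse: "hat_middle_inverse_property S"
  unfolding hat_middle_inverse_property_def
proof (intro allI impI, elim conjE)
  fix X Y a0 F assume F: "is_pmap S F X Y"
  let ?D = "pdom F"
  let ?c = "count_fund (base ?D)"
  let ?n = "Rp (base Y) NatO"
  let ?\<phi> = "conjT (dpred ?D \<odot> ?c \<odot> ?n) (eqT (base Y) (prule F \<odot> ?c \<odot> ?n) (Lp (base Y) NatO))"
  let ?G = "PMap (pdom (muPR Y ?\<phi>)) (Lp (base Y) NatO) (pemb F \<odot> ?c \<odot> bmin (base Y) ?\<phi>)"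
  have F': "amap S (pemb F) ?D X" "amap S (prule F) ?D Y"
    and Fu: "\<And>M d e. model S M \<Longrightarrow> d \<in> points M ?D \<Longrightarrow> e \<in> points M ?D \<Longrightarrow>
      ev M (pemb F) d = ev M (pemb F) e \<Longrightarrow> ev M (prule F) d = ev M (prule F) e"
    using F unfolding is_pmap_iff by blast+
  have D: "isobj S ?D" and X: "isobj S X" and Y: "isobj S Y"
    using amap_isobj[OF F'(1)] amap_isobj[OF F'(2)] by auto
  note t = isobj_typ[OF D] amap_typ[OF F'(1)] amap_typ[OF F'(2)]
  have \<phi>: "S \<turnstile> ?\<phi> \<Colon> Prod (base Y) NatO \<rightarrow> NatO" by (rule typing t)+
  have b: "base (pdom (muPR Y ?\<phi>)) = Prod (base Y) NatO" by (simp add: muPR_def)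
  have ev\<phi>: "ev M ?\<phi> (VP y n) \<noteq> ev M Zr VU \<longleftrightarrow> ev M ?c n \<in> points M ?D \<and> ev M (prule F) (ev M ?c n) = y"
    if M: "model S M" and y: "y \<in> El M (base Y)" and n: "n \<in> El M NatO" for M y n
  proof -
    interpret model S M by fact
    have c: "ev M ?c n \<in> El M (base ?D)" by (rule ev_El[OF typ_count_fund n])
    show ?thesis
      using ev_El[OF t(1) c] ev_El[OF t(3) c] c y by (simp add: points_def)
  qed
  have min: "ev M ?c (ev M (bmin (base Y) ?\<phi>) e) \<in> points M ?D \<and>
      ev M (prule F) (ev M ?c (ev M (bmin (base Y) ?\<phi>) e)) = vfst e"
    if M: "model S M" and e: "e \<in> points M (pdom (muPR Y ?\<phi>))" for M e
  proof -
    interpret model S M by fact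
    obtain y n where e: "e = VP y n" "y \<in> points M Y" "n \<in> El M NatO" "ev M ?\<phi> e \<noteq> zr"
      using e pt_muPR[OF Y \<phi> M] by blast
    show ?thesis
      using ev\<phi>[OF M pt_El[OF e(2)] ev_bmin(2)[OF \<phi> pt_El[OF e(2)] e(3)]]
        bmin_holds[OF \<phi> pt_El[OF e(2)] e(3)] e by simp
  qed
  have G: "is_pmap S ?G Y X"
    unfolding is_pmap_iff pmap.sel
  proof (intro conjI allI impI amapI isobj_muPR[OF Y \<phi>] X Y)
    show "S \<turnstile> Lp (base Y) NatO \<Colon> base (pdom (muPR Y ?\<phi>)) \<rightarrow> base Y"
      "S \<turnstile> pemb F \<odot> ?c \<odot> bmin (base Y) ?\<phi> \<Colon> base (pdom (muPR Y ?\<phi>)) \<rightarrow> base X"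
      unfolding b by (rule typing t)+
    fix M v assume M: "model S M" and v: "v \<in> points M (pdom (muPR Y ?\<phi>))"
    show "ev M (Lp (base Y) NatO) v \<in> points M Y"
      using v pt_muPR[OF Y \<phi> M] by auto
    show "ev M (pemb F \<odot> ?c \<odot> bmin (base Y) ?\<phi>) v \<in> points M X"
      using amap_pt[OF F'(1) M] min[OF M v] by simp
    fix w assume w: "w \<in> points M (pdom (muPR Y ?\<phi>))"
      and e: "ev M (Lp (base Y) NatO) v = ev M (Lp (base Y) NatO) w"
    have "ev M (bmin (base Y) ?\<phi>) v = ev M (bmin (base Y) ?\<phi>) w"
    proof -
      interpret model S M by fact
      obtain y n where v: "v = VP y n" "y \<in> points M Y" "n \<in> El M NatO" "ev M ?\<phi> v \<noteq> zr"
        using v pt_muPR[OF Y \<phi> M] by blast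
      obtain y' m where w: "w = VP y' m" "y' \<in> points M Y" "m \<in> El M NatO" "ev M ?\<phi> w \<noteq> zr"
        using w pt_muPR[OF Y \<phi> M] by blast
      have "y' = y" using e v w by simp
      then show ?thesis
        using bmin_indep[OF \<phi> pt_El[OF v(2)] v(3) _ w(3)] v(1,4) w(1,4) by simp
    qed
    then show "ev M (pemb F \<odot> ?c \<odot> bmin (base Y) ?\<phi>) v = ev M (pemb F \<odot> ?c \<odot> bmin (base Y) ?\<phi>) w"
      by simp
  qed
  let ?j = "Ind (prule F) (index_fund (base ?D))"
  let ?k = "?c \<odot> bmin (base Y) ?\<phi> \<odot> ?j"
  have "peq S X Y (pcomp X F (pcomp Y ?G F)) F"
  proof (rule middle_inverse_criterion[OF F G])
    show "S \<turnstile> ?j \<Colon> base ?D \<rightarrow> base (pdom ?G)" unfolding pmap.sel b by (rule typing t)+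
    show "S \<turnstile> ?k \<Colon> base ?D \<rightarrow> base ?D" by (rule typing t)+
    fix M d assume M: "model S M" and d: "d \<in> points M ?D"
    interpret model S M by fact
    have i: "ev M (index_fund (base ?D)) d \<in> El M NatO" by (rule ev_El[OF typ_index_fund pt_El[OF d]])
    have y: "ev M (prule F) d \<in> points M Y" by (rule amap_pt[OF F'(2) M d])
    have "ev M ?\<phi> (ev M ?j d) \<noteq> zr"
      using ev\<phi>[OF M pt_El[OF y] i] d count_index[OF pt_El[OF d]] by simp
    then have j: "ev M ?j d \<in> points M (pdom (muPR Y ?\<phi>))"
      using pt_muPR[OF Y \<phi> M, of "ev M ?j d"] y i by auto
    then show "ev M ?j d \<in> points M (pdom ?G) \<and> ev M (pemb ?G) (ev M ?j d) = ev M (prule F) d \<and>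
        ev M ?k d \<in> points M ?D \<and> ev M (pemb F) (ev M ?k d) = ev M (prule ?G) (ev M ?j d)"
      using min[OF M j] by simp
    fix e assume e: "e \<in> points M (pdom ?G)" and eq: "ev M (pemb F) d = ev M (prule ?G) e"
    have e': "e \<in> points M (pdom (muPR Y ?\<phi>))" using e by simp
    have "ev M (prule F) d = ev M (prule F) (ev M ?c (ev M (bmin (base Y) ?\<phi>) e))"
      by (rule Fu[OF M d]) (use min[OF M e'] eq in simp_all)
    then show "ev M (prule F) d = ev M (pemb ?G) e"
      using min[OF M e'] by simp
  qed
  then show "\<exists>G. is_pmap S G Y X \<and> peq S X Y (pcomp X F (pcomp Y G F)) F"
    using G by blast
qed

context
  fixes S X Y a0 f
  assumes a0: "amap S a0 (fundO One) X" and f: "amap S f X Y"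
begin

private abbreviation (input) "hit \<equiv> hits X Y a0 f"
private abbreviation (input) "bY \<equiv> base Y"
private abbreviation (input) "cnt \<equiv> count X a0"

lemma predicate_hits: "predicate S (Prod bY NatO) hit"
  unfolding hits_def
  by (rule predicate_eqT typing amap_typ[OF f] typ_count[OF a0])+

lemma typ_hits: "S \<turnstile> hit \<Colon> Prod bY NatO \<rightarrow> NatO"
  by (rule predicate_typ[OF predicate_hits])

lemma ev_hits:
  assumes M: "model S M" and b: "b \<in> El M bY" and n: "n \<in> El M NatO"
  shows "ev M hit (VP b n) \<noteq> ev M Zr VU \<longleftrightarrow> ev M f (ev M cnt n) = b"
proof -
  interpret model S M by fact
  show ?thesis
    unfolding hits_def using pt_El[OF amap_pt[OF f M count_pt[OF a0 M n]]] b n by simp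
qed

lemma is_pmap_fminusPR: "is_pmap S (fminusPR X Y a0 f) Y X"
  unfolding fminusPR_def
  by (rule is_pmap_pcomp[OF is_pmap_muPR[OF amap_isobj(2)[OF f] typ_hits] is_pmap_tot[OF amap_count[OF a0]]])

lemma fminusPR_base: "base (pdom (fminusPR X Y a0 f)) = Prod (Prod bY NatO) NatO"
  by (simp add: fminusPR_def pcomp_simps muPR_def tot_def)

lemma fminusPR_ev:
  "ev M (pemb (fminusPR X Y a0 f)) (VP (VP b n) m) = b"
  "ev M (prule (fminusPR X Y a0 f)) (VP (VP b n) m) = ev M cnt m"
  by (simp_all add: fminusPR_def pcomp_simps muPR_def tot_def)

lemma pt_fminusPR:
  assumes M: "model S M"
  shows "v \<in> points M (pdom (fminusPR X Y a0 f)) \<longleftrightarrow>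
    (\<exists>b\<in>points M Y. \<exists>n\<in>El M NatO. ev M f (ev M cnt n) = b \<and> v = VP (VP b n) (ev M (bmin bY hit) (VP b n)))"
proof -
  interpret model S M by fact
  note mu = is_pmap_muPR[OF amap_isobj(2)[OF f] typ_hits, unfolded is_pmap_iff]
  note tc = is_pmap_tot[OF amap_count[OF a0], unfolded is_pmap_iff]
  have "v \<in> points M (pdom (fminusPR X Y a0 f)) \<longleftrightarrow>
    (\<exists>d\<in>points M (pdom (muPR Y hit)). \<exists>e\<in>El M NatO. v = VP d e \<and> ev M (bmin bY hit) d = e)"
    unfolding fminusPR_def
    using pt_pcomp[where S = S and F = "muPR Y hit" and X = Y and Y = "fundO NatO" and G = "tot (fundO NatO) cnt" and Z = X and M = M and v = v] mu tc M
    by (simp add: tot_def muPR_def pt_fundO[OF M])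
  then show ?thesis
    using pt_muPR[OF amap_isobj(2)[OF f] typ_hits M] ev_hits[OF M pt_El] ev_bmin(2)[OF typ_hits pt_El]
    by auto
qed

lemma bmin_hits:
  assumes M: "model S M" and b: "b \<in> points M Y" and n: "n \<in> El M NatO" "ev M f (ev M cnt n) = b"
  shows "ev M (bmin bY hit) (VP b n) \<in> El M NatO" "ev M f (ev M cnt (ev M (bmin bY hit) (VP b n))) = b"
proof -
  interpret model S M by fact
  note b' = pt_El[OF b]
  show m: "ev M (bmin bY hit) (VP b n) \<in> El M NatO" by (rule ev_bmin(2)[OF typ_hits b' n(1)])
  show "ev M f (ev M cnt (ev M (bmin bY hit) (VP b n))) = b"
    using bmin_holds[OF typ_hits b' n(1)] ev_hits[OF M b' n(1)] ev_hits[OF M b' m] n by simp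
qed

lemma fminusPR_middle_inverse:
  "peq S X Y (pcomp X (tot X f) (pcomp Y (fminusPR X Y a0 f) (tot X f))) (tot X f)"
proof (rule middle_inverse_criterion[OF is_pmap_tot[OF f] is_pmap_fminusPR])
  let ?i = "Ind f (index_fund (base X))"
  show "S \<turnstile> Ind ?i (bmin bY hit \<odot> ?i) \<Colon> base (pdom (tot X f)) \<rightarrow> base (pdom (fminusPR X Y a0 f))"
    unfolding fminusPR_base tot_def pmap.sel by (rule typing typ_hits amap_typ[OF f])+
  show "S \<turnstile> cnt \<odot> bmin bY hit \<odot> ?i \<Colon> base (pdom (tot X f)) \<rightarrow> base (pdom (tot X f))"
    unfolding tot_def pmap.sel by (rule typing typ_hits amap_typ[OF f] typ_count[OF a0])+
  fix M d assume M: "model S M" and d: "d \<in> points M (pdom (tot X f))"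
  interpret model S M by fact
  have d: "d \<in> points M X" using d by (simp add: tot_def)
  have i: "ev M (index_fund (base X)) d \<in> El M NatO" by (rule ev_El[OF typ_index_fund pt_El[OF d]])
  have b: "ev M f d \<in> points M Y" by (rule amap_pt[OF f M d])
  have h: "ev M f (ev M cnt (ev M (index_fund (base X)) d)) = ev M f d"
    using count_onto[OF a0 M d] by simp
  show "ev M (Ind ?i (bmin bY hit \<odot> ?i)) d \<in> points M (pdom (fminusPR X Y a0 f)) \<and>
    ev M (pemb (fminusPR X Y a0 f)) (ev M (Ind ?i (bmin bY hit \<odot> ?i)) d) = ev M (prule (tot X f)) d \<and>
    ev M (cnt \<odot> bmin bY hit \<odot> ?i) d \<in> points M (pdom (tot X f)) \<and>
    ev M (pemb (tot X f)) (ev M (cnt \<odot> bmin bY hit \<odot> ?i) d) =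
      ev M (prule (fminusPR X Y a0 f)) (ev M (Ind ?i (bmin bY hit \<odot> ?i)) d)"
    using pt_fminusPR[OF M] b i h bmin_hits(1)[OF M b i h] count_pt[OF a0 M]
    by (simp add: fminusPR_ev tot_def)
  fix e assume e: "e \<in> points M (pdom (fminusPR X Y a0 f))"
    and eq: "ev M (pemb (tot X f)) d = ev M (prule (fminusPR X Y a0 f)) e"
  obtain b n where "b \<in> points M Y" "n \<in> El M NatO" "ev M f (ev M cnt n) = b"
    "e = VP (VP b n) (ev M (bmin bY hit) (VP b n))" using e pt_fminusPR[OF M] by blast
  then show "ev M (prule (tot X f)) d = ev M (pemb (fminusPR X Y a0 f)) e"
    using bmin_hits(2)[OF M] eq by (simp add: fminusPR_ev tot_def)
qed

end

section \<open>The middle inverse in Q\<close>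

context
  fixes X Y a0 f
  assumes a0: "amap thQ a0 (fundO One) X" and f: "amap thQ f X Y"
begin

private abbreviation (input) "\<phi> \<equiv> hits X Y a0 f"
private abbreviation (input) "B \<equiv> base Y"
private abbreviation (input) "c \<equiv> count X a0"
private abbreviation (input) "f' \<equiv> fprime X Y a0 f"

private lemma pr\<phi>: "predicate thQ (Prod B NatO) \<phi>" by (rule predicate_hits[OF a0 f])
private lemma Y: "isobj thQ Y" by (rule amap_isobj(2)[OF f])
private lemma X: "isobj thQ X" by (rule amap_isobj(1)[OF f])

lemma ExT_hits:
  assumes M: "model thQ M" and b: "b \<in> points M Y"
  shows "ev M (ExT B NatO \<phi>) b \<noteq> ev M Zr VU \<longleftrightarrow> (\<exists>n\<in>El M NatO. ev M f (ev M c n) = b)"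
  using ExT_NatO_iff[OF pr\<phi> M pt_El[OF b]] ev_hits[OF a0 f M pt_El[OF b]] by blast

lemma minQ_hits:
  assumes M: "model thQ M" and b: "b \<in> points M Y" and n: "n \<in> El M NatO" "ev M f (ev M c n) = b"
  shows "ev M (bmin B \<phi>) (VP b n) = ev M (minQ B \<phi>) b"
    and "ev M (minQ B \<phi>) b \<in> El M NatO"
    and "ev M f (ev M c (ev M (minQ B \<phi>) b)) = b"
proof -
  show "ev M (bmin B \<phi>) (VP b n) = ev M (minQ B \<phi>) b"
    by (rule bmin_eq_minQ[OF pr\<phi> M pt_El[OF b] n(1)]) (simp add: ev_hits[OF a0 f M pt_El[OF b]] n)
  then show "ev M (minQ B \<phi>) b \<in> El M NatO" "ev M f (ev M c (ev M (minQ B \<phi>) b)) = b"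
    using bmin_hits[OF a0 f M b n] by simp_all
qed

lemma is_pmap_fminusQ: "is_pmap thQ (fminusQ X Y a0 f) Y X"
  unfolding fminusQ_def
  by (rule is_pmap_pcomp[OF is_pmap_muQ[OF Y pr\<phi>] is_pmap_tot[OF amap_count[OF a0]]])

lemma fminusQ_simps:
  "base (pdom (fminusQ X Y a0 f)) = Prod B NatO"
  "ev M (pemb (fminusQ X Y a0 f)) (VP b m) = b"
  "ev M (prule (fminusQ X Y a0 f)) (VP b m) = ev M c m"
  by (simp_all add: fminusQ_def pcomp_simps muQ_def tot_def)

lemma pt_fminusQ:
  assumes M: "model thQ M"
  shows "v \<in> points M (pdom (fminusQ X Y a0 f)) \<longleftrightarrow>
    (\<exists>b\<in>points M Y. (\<exists>n\<in>El M NatO. ev M f (ev M c n) = b) \<and> v = VP b (ev M (minQ B \<phi>) b))"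
proof -
  note mu = is_pmap_muQ[OF Y pr\<phi>, unfolded is_pmap_iff]
  note tc = is_pmap_tot[OF amap_count[OF a0], unfolded is_pmap_iff]
  have "v \<in> points M (pdom (fminusQ X Y a0 f)) \<longleftrightarrow>
    (\<exists>d\<in>points M (pdom (muQ Y \<phi>)). \<exists>e\<in>El M NatO. v = VP d e \<and> ev M (minQ B \<phi>) d = e)"
    unfolding fminusQ_def
    using pt_pcomp[where S = thQ and F = "muQ Y \<phi>" and X = Y and Y = "fundO NatO" and G = "tot (fundO NatO) c" and Z = X and M = M and v = v] mu tc M
    by (simp add: tot_def muQ_def pt_fundO[OF M])
  moreover have "d \<in> points M (pdom (muQ Y \<phi>)) \<longleftrightarrow> d \<in> points M Y \<and> (\<exists>n\<in>El M NatO. ev M f (ev M c n) = d)" for d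
    using muQ_dom(2)[OF Y pr\<phi> M] ev_hits[OF a0 f M pt_El] by blast
  ultimately show ?thesis using minQ_hits(2)[OF M] by blast
qed

lemma fminusPR_eq_fminusQ: "peq thQ Y X (fminusPR X Y a0 f) (fminusQ X Y a0 f)"
  unfolding peq_def
proof
  note tm = typ_minQ[OF pr\<phi>]
  show "pincl thQ Y X (fminusPR X Y a0 f) (fminusQ X Y a0 f)"
  proof (rule pincl_intro[OF is_pmap_fminusPR[OF a0 f] is_pmap_fminusQ])
    let ?i = "Ind (Lp B NatO \<odot> Lp (Prod B NatO) NatO) (Rp (Prod B NatO) NatO)"
    show "thQ \<turnstile> ?i \<Colon> base (pdom (fminusPR X Y a0 f)) \<rightarrow> base (pdom (fminusQ X Y a0 f))"
      unfolding fminusPR_base[OF a0 f] fminusQ_simps by (rule typing)+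
    fix M d assume M: "model thQ M" and "d \<in> points M (pdom (fminusPR X Y a0 f))"
    then obtain b n where "b \<in> points M Y" "n \<in> El M NatO" "ev M f (ev M c n) = b"
      "d = VP (VP b n) (ev M (bmin B \<phi>) (VP b n))" using pt_fminusPR[OF a0 f M] by blast
    then show "ev M ?i d \<in> points M (pdom (fminusQ X Y a0 f)) \<and>
        ev M (pemb (fminusQ X Y a0 f)) (ev M ?i d) = ev M (pemb (fminusPR X Y a0 f)) d \<and>
        ev M (prule (fminusQ X Y a0 f)) (ev M ?i d) = ev M (prule (fminusPR X Y a0 f)) d"
      using minQ_hits(1)[OF M] pt_fminusQ[OF M] by (auto simp: fminusPR_ev[OF a0 f] fminusQ_simps)
  qed
  show "pincl thQ Y X (fminusQ X Y a0 f) (fminusPR X Y a0 f)"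
  proof (rule pincl_intro[OF is_pmap_fminusQ is_pmap_fminusPR[OF a0 f]])
    let ?i = "Ind (Idm (Prod B NatO)) (Rp B NatO)"
    show "thQ \<turnstile> ?i \<Colon> base (pdom (fminusQ X Y a0 f)) \<rightarrow> base (pdom (fminusPR X Y a0 f))"
      unfolding fminusPR_base[OF a0 f] fminusQ_simps by (rule typing)+
    fix M d assume M: "model thQ M" and "d \<in> points M (pdom (fminusQ X Y a0 f))"
    then obtain b n where b: "b \<in> points M Y" and n: "n \<in> El M NatO" "ev M f (ev M c n) = b"
      and d: "d = VP b (ev M (minQ B \<phi>) b)" using pt_fminusQ[OF M] by blast
    note m = minQ_hits[OF M b n]
    have "ev M ?i d \<in> points M (pdom (fminusPR X Y a0 f))"
      unfolding pt_fminusPR[OF a0 f M] using b m minQ_hits(1)[OF M b m(2,3)] d by auto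
    then show "ev M ?i d \<in> points M (pdom (fminusPR X Y a0 f)) \<and>
        ev M (pemb (fminusPR X Y a0 f)) (ev M ?i d) = ev M (pemb (fminusQ X Y a0 f)) d \<and>
        ev M (prule (fminusPR X Y a0 f)) (ev M ?i d) = ev M (prule (fminusQ X Y a0 f)) d"
      using d by (simp add: fminusPR_ev[OF a0 f] fminusQ_simps)
  qed
qed

lemma typ_fprime: "thQ \<turnstile> f' \<Colon> B \<rightarrow> base X"
proof -
  have t: "thQ \<turnstile> a0 \<Colon> One \<rightarrow> base X" using amap_typ[OF a0] by simp
  show ?thesis
    unfolding fprime_def by (rule typing t typ_ExT[OF pr\<phi>] typ_minQ[OF pr\<phi>] typ_count[OF a0])+
qed

lemma ev_fprime:
  assumes M: "model thQ M" and b: "b \<in> points M Y"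
  shows "ev M f' b = (if \<exists>n\<in>El M NatO. ev M f (ev M c n) = b then ev M c (ev M (minQ B \<phi>) b) else ev M a0 VU)"
proof -
  interpret model thQ M by fact
  note b' = pt_El[OF b]
  have "ev M c (ev M (minQ B \<phi>) b) \<in> El M (base X)"
    by (rule ev_El[OF typ_count[OF a0] ev_El[OF typ_minQ[OF pr\<phi>] b']])
  then show ?thesis
    unfolding fprime_def ExT_hits[OF M b, symmetric]
    using ev_El[OF typ_ExT[OF pr\<phi>] b'] pt_El[OF point_pt[OF a0 M]] by simp
qed

lemma amap_fprime: "amap thQ f' Y X"
proof (rule amapI[OF Y X typ_fprime])
  fix M b assume M: "model thQ M" and b: "b \<in> points M Y"
  then show "ev M f' b \<in> points M X"
    using minQ_hits(2)[OF M b] count_pt[OF a0 M] point_pt[OF a0 M] by (auto simp: ev_fprime)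
qed

lemma fprime_middle_inverse: "aeq thQ (f \<odot> f' \<odot> f) f X Y"
  unfolding aeq_iff
proof (intro conjI allI impI f)
  have *: "ev M f (ev M f' (ev M f v)) = ev M f v" if M: "model thQ M" and v: "v \<in> points M X" for M v
  proof -
    interpret model thQ M by fact
    have b: "ev M f v \<in> points M Y" by (rule amap_pt[OF f M v])
    have n: "ev M (index_fund (base X)) v \<in> El M NatO" by (rule ev_El[OF typ_index_fund pt_El[OF v]])
    have h: "ev M f (ev M c (ev M (index_fund (base X)) v)) = ev M f v"
      using count_onto[OF a0 M v] by simp
    show ?thesis using minQ_hits(3)[OF M b n h] n h by (auto simp: ev_fprime[OF M b])
  qed
  show "amap thQ (f \<odot> f' \<odot> f) X Y"
    by (rule amapI[OF X Y])
      (use * amap_pt[OF f] in \<open>auto intro: mp_cmp amap_typ[OF f] typ_fprime\<close>)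
  show "model thQ M \<Longrightarrow> v \<in> points M X \<Longrightarrow> ev M (f \<odot> f' \<odot> f) v = ev M f v" for M v
    using * by simp
qed

lemma isobj_Ex: "isobj thQ (subO Y (ExT B NatO \<phi>))" "isobj thQ (subO Y (negT (ExT B NatO \<phi>)))"
  by (rule isobj_subO[OF Y] typing typ_ExT[OF pr\<phi>])+

lemma pt_Ex:
  assumes M: "model thQ M"
  shows "b \<in> points M (subO Y (ExT B NatO \<phi>)) \<longleftrightarrow> b \<in> points M Y \<and> (\<exists>n\<in>El M NatO. ev M f (ev M c n) = b)"
    and "b \<in> points M (subO Y (negT (ExT B NatO \<phi>))) \<longleftrightarrow> b \<in> points M Y \<and> \<not> (\<exists>n\<in>El M NatO. ev M f (ev M c n) = b)"
proof -
  interpret model thQ M by fact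
  show "b \<in> points M (subO Y (ExT B NatO \<phi>)) \<longleftrightarrow> b \<in> points M Y \<and> (\<exists>n\<in>El M NatO. ev M f (ev M c n) = b)"
    using pt_subO[OF Y typ_ExT[OF pr\<phi>] M] ExT_hits[OF M] by blast
  show "b \<in> points M (subO Y (negT (ExT B NatO \<phi>))) \<longleftrightarrow> b \<in> points M Y \<and> \<not> (\<exists>n\<in>El M NatO. ev M f (ev M c n) = b)"
    unfolding pt_subO[OF Y typ_negT[OF typ_ExT[OF pr\<phi>]] M]
    using ExT_hits[OF M, of b] ev_El[OF typ_ExT[OF pr\<phi>] pt_El[of b M Y]] by auto
qed

lemma fprime_on_image:
  "peq thQ Y X (PMap (subO Y (ExT B NatO \<phi>)) (Idm B) f') (fminusPR X Y a0 f)"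
proof -
  let ?P = "PMap (subO Y (ExT B NatO \<phi>)) (Idm B) f'"
  have P: "is_pmap thQ ?P Y X"
    unfolding is_pmap_iff pmap.sel
    by (intro conjI allI impI amapI isobj_Ex X Y)
      (use pt_Ex amap_pt[OF amap_fprime] in \<open>auto intro: mp_id typ_fprime\<close>)
  have "pincl thQ Y X ?P (fminusPR X Y a0 f)"
  proof (rule pincl_intro[OF P is_pmap_fminusPR[OF a0 f]])
    let ?m = "minQ B \<phi>"
    let ?i = "Ind (Ind (Idm B) ?m) ?m"
    show "thQ \<turnstile> ?i \<Colon> base (pdom ?P) \<rightarrow> base (pdom (fminusPR X Y a0 f))"
      unfolding fminusPR_base[OF a0 f] pmap.sel base_simps by (rule typing typ_minQ[OF pr\<phi>])+
    fix M b assume M: "model thQ M" and "b \<in> points M (pdom ?P)"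
    then obtain n where b: "b \<in> points M Y" and n: "n \<in> El M NatO" "ev M f (ev M c n) = b"
      using pt_Ex[OF M] by auto
    note m = minQ_hits[OF M b n]
    have "ev M ?i b \<in> points M (pdom (fminusPR X Y a0 f))"
      unfolding pt_fminusPR[OF a0 f M] using b m minQ_hits(1)[OF M b m(2,3)] by auto
    then show "ev M ?i b \<in> points M (pdom (fminusPR X Y a0 f)) \<and>
        ev M (pemb (fminusPR X Y a0 f)) (ev M ?i b) = ev M (pemb ?P) b \<and>
        ev M (prule (fminusPR X Y a0 f)) (ev M ?i b) = ev M (prule ?P) b"
      using n by (auto simp: fminusPR_ev[OF a0 f] ev_fprime[OF M b])
  qed
  moreover have "pincl thQ Y X (fminusPR X Y a0 f) ?P"
  proof (rule pincl_intro[OF is_pmap_fminusPR[OF a0 f] P])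
    let ?i = "Lp B NatO \<odot> Lp (Prod B NatO) NatO"
    show "thQ \<turnstile> ?i \<Colon> base (pdom (fminusPR X Y a0 f)) \<rightarrow> base (pdom ?P)"
      unfolding fminusPR_base[OF a0 f] pmap.sel base_simps by (rule typing)+
    fix M d assume M: "model thQ M" and "d \<in> points M (pdom (fminusPR X Y a0 f))"
    then obtain b n where b: "b \<in> points M Y" and n: "n \<in> El M NatO" "ev M f (ev M c n) = b"
      and d: "d = VP (VP b n) (ev M (bmin B \<phi>) (VP b n))" using pt_fminusPR[OF a0 f M] by blast
    then show "ev M ?i d \<in> points M (pdom ?P) \<and>
        ev M (pemb ?P) (ev M ?i d) = ev M (pemb (fminusPR X Y a0 f)) d \<and>
        ev M (prule ?P) (ev M ?i d) = ev M (prule (fminusPR X Y a0 f)) d"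
      using pt_Ex(1)[OF M] minQ_hits(1)[OF M b n]
      by (auto simp: fminusPR_ev[OF a0 f] ev_fprime[OF M b])
  qed
  ultimately show ?thesis by (simp add: peq_def)
qed

lemma fprime_off_image: "aeq thQ f' (a0 \<odot> Bang B) (subO Y (negT (ExT B NatO \<phi>))) X"
  unfolding aeq_iff
proof (intro conjI allI impI amapI isobj_Ex X)
  have t: "thQ \<turnstile> a0 \<Colon> One \<rightarrow> base X" using amap_typ[OF a0] by simp
  show "thQ \<turnstile> f' \<Colon> base (subO Y (negT (ExT B NatO \<phi>))) \<rightarrow> base X"
    "thQ \<turnstile> a0 \<odot> Bang B \<Colon> base (subO Y (negT (ExT B NatO \<phi>))) \<rightarrow> base X"
    unfolding base_simps by (rule typ_fprime mp_cmp[OF mp_bang t])+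
  fix M v assume M: "model thQ M" and "v \<in> points M (subO Y (negT (ExT B NatO \<phi>)))"
  then have v: "v \<in> points M Y" "\<not> (\<exists>n\<in>El M NatO. ev M f (ev M c n) = v)"
    using pt_Ex(2)[OF M] by blast+
  show "ev M f' v \<in> points M X" by (rule amap_pt[OF amap_fprime M v(1)])
  show "ev M (a0 \<odot> Bang B) v \<in> points M X" using point_pt[OF a0 M] by simp
  show "ev M f' v = ev M (a0 \<odot> Bang B) v" using v(2) by (simp add: ev_fprime[OF M v(1)])
qed

end

section \<open>PR as a subtheory of Q\<close>

lemma PR_sub_Q:
  "S \<turnstile> f \<Colon> A \<rightarrow> B \<Longrightarrow> thQ \<turnstile> f \<Colon> A \<rightarrow> B"
  "S \<turnstile> f \<approx> g \<Colon> A \<rightarrow> B \<Longrightarrow> thQ \<turnstile> f \<approx> g \<Colon> A \<rightarrow> B"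
  by (induction rule: mp_deq.inducts) (blast intro: mp_deq.intros)+

lemma amap_PR_Q: "amap thPR f X Y \<Longrightarrow> amap thQ f X Y"
  by (auto simp: amap_def isobj_def intro: PR_sub_Q)

theorem mainTheorem3:
  shows
    "(hat_middle_inverse_property thPR \<and> middle_inverse_property thQ \<and>
      (\<forall>X Y a0 f. amap thPR a0 (fundO One) X \<and> amap thPR f X Y \<longrightarrow>
         is_pmap thPR (fminusPR X Y a0 f) Y X \<and>
         is_pmap thQ (fminusQ X Y a0 f) Y X \<and>
         peq thQ Y X (fminusPR X Y a0 f) (fminusQ X Y a0 f) \<and>
         (let fff = pcomp X (tot X f) (pcomp Y (fminusPR X Y a0 f) (tot X f)) in
          peq thPR X Y fff (tot X f) \<and> peq thQ X Y fff (tot X f))))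
     \<and>
     (\<forall>X Y a0 f. amap thPR a0 (fundO One) X \<and> amap thPR f X Y \<longrightarrow>
        (let \<phi> = hits X Y a0 f; B = base Y; f' = fprime X Y a0 f in

         peq thQ Y X (PMap (subO Y (ExT B NatO \<phi>)) (Idm B) f') (fminusPR X Y a0 f) \<and>
         aeq thQ f' (a0 \<odot> Bang B) (subO Y (negT (ExT B NatO \<phi>))) X \<and>
         thQ \<turnstile> negT (ExT B NatO \<phi>) \<approx> AllT B NatO (negT \<phi>) \<Colon> B \<rightarrow> NatO \<and>

         amap thQ f' Y X \<and>
         aeq thQ (f \<odot> f' \<odot> f) f X Y))"
proof (intro conjI allI impI)
  show "hat_middle_inverse_property thPR" by (rule hat_middle_inverse)
  show "middle_inverse_property thQ"
    unfolding middle_inverse_property_def using amap_fprime fprime_middle_inverse by blast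
next
  fix X Y a0 f assume "amap thPR a0 (fundO One) X \<and> amap thPR f X Y"
  then have a0: "amap thPR a0 (fundO One) X" and f: "amap thPR f X Y" by auto
  note Q = amap_PR_Q[OF a0] amap_PR_Q[OF f]
  show "is_pmap thPR (fminusPR X Y a0 f) Y X" by (rule is_pmap_fminusPR[OF a0 f])
  show "is_pmap thQ (fminusQ X Y a0 f) Y X" by (rule is_pmap_fminusQ[OF Q])
  show "peq thQ Y X (fminusPR X Y a0 f) (fminusQ X Y a0 f)" by (rule fminusPR_eq_fminusQ[OF Q])
  show "let fff = pcomp X (tot X f) (pcomp Y (fminusPR X Y a0 f) (tot X f)) in
      peq thPR X Y fff (tot X f) \<and> peq thQ X Y fff (tot X f)"
    unfolding Let_def using fminusPR_middle_inverse[OF a0 f] fminusPR_middle_inverse[OF Q] by blast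
  show "let \<phi> = hits X Y a0 f; B = base Y; f' = fprime X Y a0 f in
      peq thQ Y X (PMap (subO Y (ExT B NatO \<phi>)) (Idm B) f') (fminusPR X Y a0 f) \<and>
      aeq thQ f' (a0 \<odot> Bang B) (subO Y (negT (ExT B NatO \<phi>))) X \<and>
      thQ \<turnstile> negT (ExT B NatO \<phi>) \<approx> AllT B NatO (negT \<phi>) \<Colon> B \<rightarrow> NatO \<and>
      amap thQ f' Y X \<and> aeq thQ (f \<odot> f' \<odot> f) f X Y"
    unfolding Let_def
    by (intro conjI fprime_on_image[OF Q] fprime_off_image[OF Q] neg_ExT[OF predicate_hits[OF Q]]
        amap_fprime[OF Q] fprime_middle_inverse[OF Q])
qed

end
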